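(* Let $0<k<1$ be the modulus, $k':=\sqrt{1-k^2}$, $z:=2K(k)/\pi$, and $q:=\exp(-\pi K(k')/K(k))$. Let $n=1,2,3,\dots$. With $E_m$, $B_m$ the Euler and Bernoulli numbers, $H_n^{(m)}(\{c_\nu\})$ the Hankel determinants, and $U,G,R,C,D,T,N,\widehat C,\widehat T$ the Lambert series defined in the context, put $$\epsilon_\nu:=(-1)^{\nu-1}\tfrac14|E_{2\nu-2}|,\quad \epsilon'_\nu:=(-1)^{\nu}\tfrac14|E_{2\nu}|,\quad \beta_\nu:=(-1)^{\nu-1}\tfrac{2^{2\nu}-1}{4\nu}|B_{2\nu}|,\quad \beta'_\nu:=(-1)^{\nu}\tfrac{2^{2\nu+2}-1}{4(\nu+1)}|B_{2\nu+2}|,$$ $$P_n:=\prod_{r=1}^{n-1}\bigl((2r)!\bigr)^{-2},\quad Q_n:=\prod_{r=1}^{n}\bigl((2r-1)!\bigr)^{-2},\quad F_n:=\prod_{r=1}^{2n-1}(r!)^{-1},\quad F'_n:=\prod_{r=1}^{2n}(r!)^{-1}.$$ Then the following expansions hold: (1) $k^{n^2-n}z^{2n^2-n}=4^{n^2}P_n\,H_n^{(1)}(\{N_{2\nu-2}(q)\})+4^{n^2-1}P_n\,H_{n-1}^{(3)}(\{N_{2\nu-2}(q)\})$; (2) $(k')^{n^2-n}z^{2n^2-n}=(-1)^n4^nP_n\,H_n^{(1)}(\{R_{2\nu-2}(-q)-\epsilon_\nu\})$; (3) $k^{n^2}z^{2n^2-n}=4^nP_n\,H_n^{(1)}(\{T_{2\nu-2}(q)\})$;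 (4) $k^{n^2}(k')^{n^2-n}z^{2n^2-n}=(-1)^{n(n+1)/2}4^nP_n\,H_n^{(1)}(\{\widehat T_{2\nu-2}(q)\})$; (5) $(k')^{n^2}z^{2n^2-n}=(-1)^n4^nP_n\,H_n^{(1)}(\{R_{2\nu-2}(q)-\epsilon_\nu\})$; (6) $k^{n^2-n}(k')^{n^2}z^{2n^2-n}=(-1)^{n(n-1)/2}4^{n^2}P_n\,H_n^{(1)}(\{N_{2\nu-2}(-q)\})+(-1)^{n(n-1)/2}4^{n^2-1}P_n\,H_{n-1}^{(3)}(\{N_{2\nu-2}(-q)\})$; (7) $(k')^{n^2/2}(1+k')^{n^2-n}z^{2n^2-n}=(-1)^n2^{n(n+1)}P_n\,H_n^{(1)}(\{R_{2\nu-2}(q^2)-\epsilon_\nu\})$; (8) $z^{2n^2}=(-1)^n2^{2n^2+n}F_n\,H_n^{(1)}(\{U_{2\nu-1}(-q)-\beta_\nu\})$; (9) $(kz)^{2n^2}=4^{n(n+1)}F_n\,H_n^{(1)}(\{C_{2\nu-1}(q)\})$; (10) $(k'z)^{2n^2}=(-1)^n2^{2n^2+n}F_n\,H_n^{(1)}(\{U_{2\nu-1}(q)-\beta_\nu\})$; (11) $(kk')^{n^2}z^{2n^2}=(-1)^{n(n+1)/2}4^nF_n\,H_n^{(1)}(\{\widehat C_{2\nu-1}(q)\})$; (12) $(k')^{n^2}z^{2n^2}=(-1)^n2^{2n^2+n}F_n\,H_n^{(1)}(\{U_{2\nu-1}(q^2)-\beta_\nu\})$; (13) $k^{n^2}z^{2n^2}=4^nF_n\,H_n^{(1)}(\{C_{2\nu-1}(\sqrt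 q)\})$; (14) $k^{n^2}z^{2n^2+n}=4^nQ_n\,H_n^{(1)}(\{T_{2\nu}(q)\})$; (15) $(k')^{n^2}z^{2n^2+n}=4^nQ_n\,H_n^{(1)}(\{R_{2\nu}(q)-\epsilon'_\nu\})$; (16) $k^{n^2+n}z^{2n^2+n}=4^{n(n+1)}Q_n\,H_n^{(1)}(\{N_{2\nu}(q)\})$; (17) $k^{n^2}(k')^{n^2+n}z^{2n^2+n}=(-1)^{n(n+1)/2}4^nQ_n\,H_n^{(1)}(\{\widehat T_{2\nu}(q)\})$; (18) $(k')^{n^2+n}z^{2n^2+n}=4^nQ_n\,H_n^{(1)}(\{R_{2\nu}(-q)-\epsilon'_\nu\})$; (19) $k^{n^2+n}(k')^{n^2}z^{2n^2+n}=(-1)^{n(n+1)/2}4^{n(n+1)}Q_n\,H_n^{(1)}(\{N_{2\nu}(-q)\})$; (20) $k^{n^2+n}z^{2n^2+2n}=2^{2n^2+3n}F'_n\,H_n^{(1)}(\{D_{2\nu+1}(q)\})$; (21) $k^{n^2+n}(k')^{n^2+n}z^{2n^2+2n}=(-1)^{n(n+1)/2}2^{2n^2+3n}F'_n\,H_n^{(1)}(\{D_{2\nu+1}(-q)\})$; (22) $(kz)^{2n^2+2n}=2^{4n^2+5n}F'_n\,H_n^{(1)}(\{D_{2\nu+1}(q^2)\})$; (23) $(k'z)^{2n^2+2n}=2^{2n^2+3n}F'_n\,H_n^{(1)}(\{G_{2\nu+1}(q)-\beta'_\nu\})$; (24) $z^{2n^2+2n}=2^{2n^2+3n}F'_n\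,H_n^{(1)}(\{G_{2\nu+1}(-q)-\beta'_\nu\})$.
   Context: $K(k):=\int_0^1\frac{dt}{\sqrt{(1-t^2)(1-k^2t^2)}}$ is the complete elliptic integral of the first kind. Bernoulli and Euler numbers: $\frac{t}{e^t-1}=\sum_{n\ge0}B_n\frac{t^n}{n!}$, $\frac{2e^t}{e^{2t}+1}=\sum_{n\ge0}E_n\frac{t^n}{n!}$. For a sequence $\{c_\nu\}_{\nu\ge1}$ and $m\ge1$, $H_n^{(m)}(\{c_\nu\}):=\det\left(c_{m+i+j-2}\right)_{1\le i,j\le n}$ is the $n\times n$ Hankel determinant, with $H_0^{(m)}:=1$. In $H_n^{(m)}(\{f(\nu)\})$ the sequence is $c_\nu=f(\nu)$, $\nu=1,2,3,\dots$. Lambert series (for $|x|<1$, and with the indices $m$ for which they are used): $$U_{2m-1}(x)=\sum_{r\ge1}(-1)^{r-1}\frac{r^{2m-1}x^r}{1+x^r},\quad G_{2m+1}(x)=\sum_{r\ge1}(-1)^r\frac{r^{2m+1}x^r}{1-x^r},\quad R_{2m}(x)=\sum_{r\ge1}(-1)^{r+1}\frac{(2r-1)^{2m}x^{2r-1}}{1+x^{2r-1}},$$ $$C_{2m-1}(x)=\sum_{r\ge1}\frac{(2r-1)^{2m-1}x^{2r-1}}{1-x^{2(2r-1)}},\quad D_{2m+1}(x)=\sum_{r\ge1}\frac{r^{2m+1}x^r}{1-x^{2r}},\quad N_{2m}(x)=\sum_{r\ge1}\frac{r^{2m}x^r}{1+x^{2r}},$$ $$T_{2m}(x)=\sum_{r\ge1}\frac{(2r-1)^{2m}x^{r-1/2}}{1+x^{2r-1}},\quad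 \widehat C_{2m-1}(x)=\sum_{r\ge1}\frac{(2r-1)^{2m-1}(-1)^rx^{r-1/2}}{1+x^{2r-1}},\quad \widehat T_{2m}(x)=\sum_{r\ge1}\frac{(2r-1)^{2m}(-1)^rx^{r-1/2}}{1-x^{2r-1}}.$$ Here $m\ge0$ for the even-indexed series $R,N,T,\widehat T$, and $m\ge1$ for the others. Half-integer powers of $q\in(0,1)$ are the positive ones. *)

theory Defs
  imports
    "HOL-Analysis.Analysis"
    "Jordan_Normal_Form.Determinant"
begin

text \<open>The complete elliptic integral of the first kind. The integrand has a singularity at
  \<open>t = 1\<close>; there the total division of HOL gives the value \<open>0\<close> at that single point, and the
  Henstock--Kurzweil integral is the convergent improper integral.\<close>

definition ellK :: "real \<Rightarrow> real" where
  "ellK k = integral {0..1} (\<lambda>t. 1 / sqrt ((1 - t^2) * (1 - k^2 * t^2)))"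

text \<open>Bernoulli and Euler numbers, read off from their exponential generating functions as
  formal power series; \<open>fps_exp c\<close> is the series of \<open>e\<^sup>c\<^sup>t\<close>. Thus the first Bernoulli number
  is \<open>-1/2\<close>.\<close>

definition bernoulli_num :: "nat \<Rightarrow> real" where
  "bernoulli_num n = fact n * fps_nth (fps_X / (fps_exp 1 - 1)) n"

definition euler_num :: "nat \<Rightarrow> real" where
  "euler_num n = fact n * fps_nth (2 * fps_exp 1 / (fps_exp 2 + 1)) n"

lemma bernoulli_num_egf:
  "Abs_fps (\<lambda>n. bernoulli_num n / fact n) * (fps_exp 1 - 1) = fps_X"
proof -
  have sd: "subdegree (fps_exp (1::real) - 1) = 1"
    by (rule subdegreeI) auto
  then have nz: "fps_exp (1::real) - 1 \<noteq> 0"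
    by (metis subdegree_0 zero_neq_one)
  have "(fps_exp (1::real) - 1) dvd fps_X"
    unfolding fps_dvd_iff[OF nz fps_X_neq_zero] sd subdegree_fps_X by (rule order_refl)
  then have "fps_X / (fps_exp 1 - 1) * (fps_exp (1::real) - 1) = fps_X"
    by (rule dvd_div_mult_self)
  then show ?thesis
    unfolding bernoulli_num_def nonzero_mult_div_cancel_left[OF fact_nonzero] fps_nth_inverse .
qed

lemma euler_num_egf:
  "Abs_fps (\<lambda>n. euler_num n / fact n) * (fps_exp 2 + 1) = 2 * fps_exp 1"
proof -
  have "is_unit (fps_exp (2::real) + 1)"
    unfolding fps_is_unit_iff by (simp only: fps_add_nth fps_exp_nth) simp
  then have "2 * fps_exp 1 / (fps_exp 2 + 1) * (fps_exp (2::real) + 1) = 2 * fps_exp 1"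
    by (rule dvd_div_mult_self[OF unit_imp_dvd])
  then show ?thesis
    unfolding euler_num_def nonzero_mult_div_cancel_left[OF fact_nonzero] fps_nth_inverse .
qed

text \<open>\<open>hankel n m c\<close> is the Hankel determinant of order \<open>n\<close> with superscript \<open>m\<close>. Matrix
  indices are 0-based here, so the entry \<open>c (m + i + j - 2)\<close> for \<open>1 \<le> i, j \<le> n\<close> becomes
  \<open>c (m + i + j)\<close> for \<open>0 \<le> i, j < n\<close>. For \<open>m \<ge> 1\<close> only the values \<open>c \<nu>\<close> with \<open>\<nu> \<ge> 1\<close>
  enter.\<close>

definition hankel :: "nat \<Rightarrow> nat \<Rightarrow> (nat \<Rightarrow> real) \<Rightarrow> real" where
  "hankel n m c = Determinant.det (Matrix.mat n n (\<lambda>(i, j). c (m + i + j)))"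

lemma hankel_0: "hankel 0 m c = 1"
  by (simp add: hankel_def)

definition series1 :: "(nat \<Rightarrow> real) \<Rightarrow> real" where
  "series1 f = (\<Sum>i. f (Suc i))"

text \<open>The Lambert series, for \<open>\<bar>x\<bar> < 1\<close>. The first argument \<open>s\<close> is the full index: the
  subscript \<open>2m\<close>, \<open>2m - 1\<close> or \<open>2m + 1\<close> itself. The series with half-integer powers are used
  for \<open>0 < x < 1\<close> only, where \<open>powr\<close> is the positive power.\<close>

definition lambert_U :: "nat \<Rightarrow> real \<Rightarrow> real" where
  "lambert_U s x = series1 (\<lambda>r. (-1)^(r - 1) * (real r^s * x^r / (1 + x^r)))"

definition lambert_G :: "nat \<Rightarrow> real \<Rightarrow> real" where
  "lambert_G s x = series1 (\<lambda>r. (-1)^r * (real r^s * x^r / (1 - x^r)))"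

definition lambert_R :: "nat \<Rightarrow> real \<Rightarrow> real" where
  "lambert_R s x = series1 (\<lambda>r. (-1)^(r + 1) * (real (2*r - 1)^s * x^(2*r - 1) / (1 + x^(2*r - 1))))"

definition lambert_C :: "nat \<Rightarrow> real \<Rightarrow> real" where
  "lambert_C s x = series1 (\<lambda>r. real (2*r - 1)^s * x^(2*r - 1) / (1 - x^(2*(2*r - 1))))"

definition lambert_D :: "nat \<Rightarrow> real \<Rightarrow> real" where
  "lambert_D s x = series1 (\<lambda>r. real r^s * x^r / (1 - x^(2*r)))"

definition lambert_N :: "nat \<Rightarrow> real \<Rightarrow> real" where
  "lambert_N s x = series1 (\<lambda>r. real r^s * x^r / (1 + x^(2*r)))"

definition lambert_T :: "nat \<Rightarrow> real \<Rightarrow> real" where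
  "lambert_T s x = series1 (\<lambda>r. real (2*r - 1)^s * x powr (real r - 1/2) / (1 + x^(2*r - 1)))"

definition lambert_C_hat :: "nat \<Rightarrow> real \<Rightarrow> real" where
  "lambert_C_hat s x =
    series1 (\<lambda>r. real (2*r - 1)^s * (-1)^r * x powr (real r - 1/2) / (1 + x^(2*r - 1)))"

definition lambert_T_hat :: "nat \<Rightarrow> real \<Rightarrow> real" where
  "lambert_T_hat s x =
    series1 (\<lambda>r. real (2*r - 1)^s * (-1)^r * x powr (real r - 1/2) / (1 - x^(2*r - 1)))"

text \<open>The correction sequences are meant for \<open>\<nu> \<ge> 1\<close>.\<close>

definition eps_seq :: "nat \<Rightarrow> real" where
  "eps_seq \<nu> = (-1)^(\<nu> - 1) * (1/4) * \<bar>euler_num (2*\<nu> - 2)\<bar>"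

definition eps'_seq :: "nat \<Rightarrow> real" where
  "eps'_seq \<nu> = (-1)^\<nu> * (1/4) * \<bar>euler_num (2*\<nu>)\<bar>"

definition beta_seq :: "nat \<Rightarrow> real" where
  "beta_seq \<nu> = (-1)^(\<nu> - 1) * ((2^(2*\<nu>) - 1) / (4 * real \<nu>)) * \<bar>bernoulli_num (2*\<nu>)\<bar>"

definition beta'_seq :: "nat \<Rightarrow> real" where
  "beta'_seq \<nu> = (-1)^\<nu> * ((2^(2*\<nu> + 2) - 1) / (4 * (real \<nu> + 1))) * \<bar>bernoulli_num (2*\<nu> + 2)\<bar>"

definition P_fac :: "nat \<Rightarrow> real" where
  "P_fac n = (\<Prod>r = 1..n - 1. 1 / (fact (2*r))^2)"

definition Q_fac :: "nat \<Rightarrow> real" where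
  "Q_fac n = (\<Prod>r = 1..n. 1 / (fact (2*r - 1))^2)"

definition F_fac :: "nat \<Rightarrow> real" where
  "F_fac n = (\<Prod>r = 1..2*n - 1. 1 / fact r)"

definition F'_fac :: "nat \<Rightarrow> real" where
  "F'_fac n = (\<Prod>r = 1..2*n. 1 / fact r)"

end

theory Submission
  imports Defs "HOL-Complex_Analysis.Complex_Analysis"
begin

text \<open>
  Up to signs and powers of two, each Lambert series lists the Taylor coefficients at \<open>0\<close> of a Jacobian
  elliptic function or of the square of one: \<open>SS\<close>, \<open>CC\<close>, \<open>DD\<close> are \<open>z k sn\<close>, \<open>z k cn\<close>, \<open>z dn\<close>, rescaled
  to the period \<open>2 \<pi>\<close>, and \<open>TT\<close>, \<open>GG\<close>, \<open>HH\<close> are their translates by a half period, whose secant and tangent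
  parts account for the Euler and Bernoulli numbers. These functions are defined here by their Fourier series, and
  the differential equations \<open>SS' = CC DD\<close>, \<open>CC' = - SS DD\<close>, \<open>DD' = - SS CC\<close> hold because the convolutions
  of the Fourier coefficients telescope.

  For every solution \<open>S\<close>, \<open>C\<close>, \<open>D\<close> of these equations with \<open>S 0 = 0\<close>, the even derivatives at \<open>0\<close> of
  \<open>C S\<^sup>2\<^sup>m\<close> satisfy a three-term recurrence in \<open>m\<close>. Hence the Hankel matrix of the even derivatives of \<open>C\<close> is a
  product of triangular matrices, and its determinant is an explicit monomial in \<open>C 0\<close> and \<open>D 0\<close>; the same
  holds for \<open>S\<close> and \<open>S\<^sup>2\<close>. The 24 identities are the instances of a few such evaluations at the complex
  parameters \<open>Q\<close> with \<open>Q\<^sup>2 = \<plusminus>q\<close>, \<open>Q = q\<close>, \<open>Q\<^sup>4 = \<plusminus>q\<close>.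

  The constants \<open>C 0\<close>, \<open>D 0\<close> are identified with \<open>z\<close>, \<open>k z\<close>, \<open>k' z\<close> by substituting in the elliptic integral
  along the real axis, which gives \<open>K\<close>, and along the imaginary axis up to the pole, which gives \<open>K'\<close>. As \<open>K\<close>
  is strictly increasing, the modulus is determined by \<open>K' / K\<close>, that is, by the nome.
\<close>

section \<open>Hankel determinants and three-term recurrences\<close>

text \<open>The corrected series live on the line \<open>Im w = - b\<close> that bounds the strip of
  convergence. There the factor \<open>1 / (1 + q^m)\<close> tends to 1 as \<open>m\<close> grows;
  subtracting this limit leaves an error of size \<open>q^m\<close>, whose series converges in a
  strip twice as wide, while the subtracted part is a geometric series summing to a secant or
  tangent. Relations reach this line by analytic continuation inside a small ball. Turning
  \<open>Q\<close> into \<open>\<i> * Q\<close> changes the sign of \<open>q\<close>, exchanges the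
  constants \<open>theta3 q\<close> and \<open>theta3 (- q)\<close> and multiplies
  \<open>CC 0\<close> by \<open>\<i>\<close>, whence the signs in the hatted and alternating cases.
  The absolute values of Euler and Bernoulli numbers are resolved by the nonnegative Taylor
  coefficients of secant and tangent. Relations between theta constants come from first integrals of
  the equations and from splitting a Lambert series into even and odd terms, not from product
  formulas. What remains is positivity, of \<open>SS\<close> between its zeros and of
  \<open>theta3 (- q)\<close>; the latter separates \<open>CC 0\<close> from \<open>DD 0\<close> and
  keeps the modulus below 1.\<close>

definition hankel_det :: "nat \<Rightarrow> (nat \<Rightarrow> 'a :: comm_ring_1) \<Rightarrow> 'a" where
  "hankel_det n c = Determinant.det (Matrix.mat n n (\<lambda>(i, j). c (i + j)))"

lemma hankel_altdef: "hankel n m c = hankel_det n (\<lambda>i. c (m + i))"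
  by (simp add: hankel_def hankel_det_def add.assoc)

lemma hankel_det_cong: "(\<And>i. c i = c' i) \<Longrightarrow> hankel_det n c = hankel_det n c'"
  by (simp add: hankel_det_def)

lemma of_real_hankel_det: "of_real (hankel_det n c) = (hankel_det n (\<lambda>i. of_real (c i)) :: complex)"
proof -
  have "map_mat (of_real :: real \<Rightarrow> complex) (Matrix.mat n n (\<lambda>(i, j). c (i + j))) =
      Matrix.mat n n (\<lambda>(i, j). of_real (c (i + j)))"
    by (rule eq_matI) auto
  then show ?thesis
    unfolding hankel_det_def of_real_hom.hom_det[symmetric] by simp
qed

text \<open>Row \<open>i\<close> and column \<open>j\<close> contribute \<open>y^i\<close> and
  \<open>y^j\<close>. In the Leibniz expansion this says that \<open>i + p i\<close> sums to twice
  the sum of the indices, for every permutation \<open>p\<close>.\<close>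

lemma hankel_det_scale:
  "hankel_det n (\<lambda>i. x * y ^ i * c i) = x ^ n * y ^ (2 * (\<Sum>m<n. m)) * hankel_det n c"
proof -
  have "(\<Prod>i = 0..<n. x * y ^ (i + p i) * c (i + p i)) =
      x ^ n * y ^ (2 * (\<Sum>m<n. m)) * (\<Prod>i = 0..<n. c (i + p i))" if "p permutes {0..<n}" for p
  proof -
    have "(\<Sum>i = 0..<n. p i) = (\<Sum>m = 0..<n. m)"
      using sum.permute[OF that, of "\<lambda>x. x"] by (simp add: o_def)
    then have "(\<Sum>i = 0..<n. i + p i) = 2 * (\<Sum>m<n. m)"
      by (simp add: sum.distrib atLeast0LessThan)
    then show ?thesis
      by (simp add: prod.distrib flip: power_sum)
  qed
  note prod_eq = this
  have entry: "(\<Prod>i = 0..<n. Matrix.mat n n (\<lambda>(i, j). f (i + j)) $$ (i, p i)) = (\<Prod>i = 0..<n. f (i + p i))"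
    if "p permutes {0..<n}" for p and f :: "nat \<Rightarrow> 'a"
    by (rule prod.cong) (use permutes_in_image[OF that] in auto)
  define K where "K = x ^ n * y ^ (2 * (\<Sum>m<n. m))"
  have "signof p * (\<Prod>i = 0..<n. x * y ^ (i + p i) * c (i + p i)) =
      K * (signof p * (\<Prod>i = 0..<n. c (i + p i)))" if "p permutes {0..<n}" for p
    by (simp only: prod_eq[OF that] K_def) (simp only: mult_ac)
  then show ?thesis
    unfolding hankel_det_def Determinant.det_def K_def[symmetric]
    by (simp add: entry sum_distrib_left cong: sum.cong_simp)
qed

text \<open>Moments of a Jacobi matrix: \<open>a i\<close> is the i-th iterate of a tridiagonal
  operator on the sequence \<open>\<kappa>, 0, 0, ...\<close>, read at entry 0. Pairing with the
  iterates \<open>b\<close> of the transposed operator factors the Hankel matrix into triangular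
  matrices, whose diagonals are products of off-diagonal entries of the operator.\<close>

lemma hankel_det_tridiagonal:
  fixes a :: "nat \<Rightarrow> nat \<Rightarrow> 'a :: idom" and A B C :: "nat \<Rightarrow> 'a"
  assumes a0: "\<And>m. a 0 m = (if m = 0 then \<kappa> else 0)"
    and aS0: "\<And>i. a (Suc i) 0 = B 0 * a i 0 + C 0 * a i 1"
    and aS: "\<And>i m. a (Suc i) (Suc m) =
      A (Suc m) * a i m + B (Suc m) * a i (Suc m) + C (Suc m) * a i (Suc (Suc m))"
  shows "hankel_det n (\<lambda>i. a i 0) = (\<Prod>m<n. \<kappa> * (\<Prod>l<m. A (Suc l) * C l))"
proof -
  \<comment> \<open>The transposed recurrence, started at the unit vector because the moment is
    entry 0.\<close>
  define b where "b = rec_nat (\<lambda>m. if m = 0 then 1 else 0)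
    (\<lambda>i r m. (if m = 0 then 0 else C (m - 1) * r (m - 1)) + B m * r m + A (Suc m) * r (Suc m))"
  have b0: "b 0 m = (if m = 0 then 1 else 0)" for m
    by (simp add: b_def)
  have bS0: "b (Suc i) 0 = B 0 * b i 0 + A 1 * b i 1" for i
    by (simp add: b_def)
  have bS: "b (Suc i) (Suc m) = C m * b i m + B (Suc m) * b i (Suc m) + A (Suc (Suc m)) * b i (Suc (Suc m))" for i m
    by (simp add: b_def)
  have a_up: "a i m = 0" if "m > i" for i m
    using that
  proof (induction i arbitrary: m)
    case (Suc i)
    then obtain m' where "m = Suc m'" by (cases m) auto
    then show ?case using Suc by (simp add: aS)
  qed (simp add: a0)
  have b_up: "b i m = 0" if "m > i" for i m
    using that
  proof (induction i arbitrary: m)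
    case (Suc i)
    then obtain m' where "m = Suc m'" by (cases m) auto
    then show ?case using Suc by (simp add: bS)
  qed (simp add: b0)
  have a_diag: "a i i = \<kappa> * (\<Prod>l<i. A (Suc l))" for i
    by (induction i) (simp_all add: a0 aS a_up)
  have b_diag: "b i i = (\<Prod>l<i. C l)" for i
    by (induction i) (simp_all add: b0 bS b_up)
  \<comment> \<open>Summation by parts moves one application of the operator from \<open>b\<close>
    to \<open>a\<close>. The range reaches \<open>i + j + 1\<close> so that the boundary terms
    vanish by triangularity.\<close>
  have "(\<Sum>m\<le>i + j + 1. b (Suc i) m * a j m) = (\<Sum>m\<le>i + j + 1. b i m * a (Suc j) m)" for i j
  proof -
    define N where "N = i + j"
    have 1: "(\<Sum>m\<le>Suc N. b (Suc i) m * a j m) =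
      (\<Sum>m\<le>Suc N. B m * b i m * a j m) + (\<Sum>m\<le>N. C m * b i m * a j (Suc m))
        + (\<Sum>m\<le>Suc N. A (Suc m) * b i (Suc m) * a j m)"
      unfolding sum.atMost_Suc_shift by (simp add: bS bS0 algebra_simps sum.distrib)
    have 2: "(\<Sum>m\<le>Suc N. b i m * a (Suc j) m) =
      (\<Sum>m\<le>Suc N. B m * b i m * a j m) + (\<Sum>m\<le>N. A (Suc m) * b i (Suc m) * a j m)
        + (\<Sum>m\<le>Suc N. C m * b i m * a j (Suc m))"
      unfolding sum.atMost_Suc_shift by (simp add: aS aS0 algebra_simps sum.distrib)
    show ?thesis
      using 1 2 by (simp add: N_def a_up b_up)
  qed
  note step = this
  have stab: "(\<Sum>m\<le>N. b i m * a j m) = (\<Sum>m\<le>i. b i m * a j m)" if "N \<ge> i" for N i j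
    by (rule sum.mono_neutral_right) (use that in \<open>auto simp: b_up\<close>)
  have stab': "(\<Sum>m\<le>N. b i m * a j m) = (\<Sum>m\<le>j. b i m * a j m)" if "N \<ge> j" for N i j
    by (rule sum.mono_neutral_right) (use that in \<open>auto simp: a_up\<close>)
  \<comment> \<open>Shifting all of \<open>i\<close> onto \<open>j\<close> leaves
    \<open>b 0\<close>, which picks out entry 0.\<close>
  have main: "(\<Sum>m\<le>i. b i m * a j m) = a (i + j) 0" for i j
  proof (induction i arbitrary: j)
    case 0
    then show ?case by (simp add: b0)
  next
    case (Suc i)
    have "(\<Sum>m\<le>Suc i. b (Suc i) m * a j m) = (\<Sum>m\<le>i. b i m * a (Suc j) m)"
      using step[of i j] stab[of "Suc i" "i + j + 1" j] stab[of i "i + j + 1" "Suc j"] by simp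
    then show ?case using Suc.IH[of "Suc j"] by simp
  qed
  let ?L = "Matrix.mat n n (\<lambda>(i, m). b i m)" and ?U = "Matrix.mat n n (\<lambda>(m, j). a j m)"
  have "Matrix.mat n n (\<lambda>(i, j). a (i + j) 0) = ?L * ?U"
  proof (rule eq_matI)
    fix i j assume ij: "i < dim_row (?L * ?U)" "j < dim_col (?L * ?U)"
    have "(\<Sum>m<n. b i m * a j m) = a (i + j) 0"
      using stab[of i "n - 1" j] ij main[of i j] by (cases n) (auto simp: lessThan_Suc_atMost)
    then show "Matrix.mat n n (\<lambda>(i, j). a (i + j) 0) $$ (i, j) = (?L * ?U) $$ (i, j)"
      using ij by (simp add: scalar_prod_def atLeast0LessThan)
  qed auto
  then have "hankel_det n (\<lambda>i. a i 0) = Determinant.det ?L * Determinant.det ?U"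
    unfolding hankel_det_def by (metis det_mult mat_carrier)
  also have "Determinant.det ?L = (\<Prod>m<n. b m m)"
    by (subst det_lower_triangular[where n = n])
      (auto simp: b_up prod_list_diag_prod atLeast0LessThan intro: prod.cong)
  also have "Determinant.det ?U = (\<Prod>m<n. a m m)"
    by (subst det_upper_triangular[where n = n])
      (auto simp: a_up prod_list_diag_prod atLeast0LessThan intro: prod.cong)
  finally show ?thesis
    by (simp add: a_diag b_diag mult_ac flip: prod.distrib)
qed

section \<open>Determinants of Jacobian elliptic systems\<close>

definition fps_diff :: "'a :: field_char_0 fps \<Rightarrow> nat \<Rightarrow> 'a" where
  "fps_diff f k = fact k * fps_nth f k"

lemma fps_diff_Suc: "fps_diff f (Suc k) = fps_diff (fps_deriv f) k"
  by (simp add: fps_diff_def)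

lemma fps_diff_add: "fps_diff (f + g) k = fps_diff f k + fps_diff g k"
  by (simp add: fps_diff_def algebra_simps)

lemma fps_diff_cmult: "fps_diff (fps_const x * f) k = x * fps_diff f k"
  by (simp add: fps_diff_def algebra_simps)

text \<open>The operator is the second derivative on the span of the \<open>g m\<close>, so each
  step of the recurrence uses up two derivatives. The offset \<open>r\<close> selects even or odd
  orders; only \<open>g 0\<close> may have a nonzero \<open>r\<close>-th derivative at 0.\<close>

lemma hankel_det_tridiagonal_fps:
  fixes g :: "nat \<Rightarrow> 'a :: field_char_0 fps"
  assumes g0: "\<And>m. fps_diff (g m) r = (if m = 0 then \<kappa> else 0)"
    and gS0: "fps_deriv (fps_deriv (g 0)) = fps_const (B 0) * g 0 + fps_const (C 0) * g 1"
    and gS: "\<And>m. fps_deriv (fps_deriv (g (Suc m))) = fps_const (A (Suc m)) * g m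
      + fps_const (B (Suc m)) * g (Suc m) + fps_const (C (Suc m)) * g (Suc (Suc m))"
  shows "hankel_det n (\<lambda>i. fps_diff (g 0) (2 * i + r)) = (\<Prod>m<n. \<kappa> * (\<Prod>l<m. A (Suc l) * C l))"
proof -
  have shift: "fps_diff f (2 * Suc i + r) = fps_diff (fps_deriv (fps_deriv f)) (2 * i + r)"
    for f :: "'a fps" and i
    by (simp add: fps_diff_Suc)
  have step0: "fps_diff (g 0) (2 * Suc i + r) =
      B 0 * fps_diff (g 0) (2 * i + r) + C 0 * fps_diff (g 1) (2 * i + r)" for i
    unfolding shift gS0 by (simp only: fps_diff_add fps_diff_cmult)
  have step: "fps_diff (g (Suc m)) (2 * Suc i + r) = A (Suc m) * fps_diff (g m) (2 * i + r)
      + B (Suc m) * fps_diff (g (Suc m)) (2 * i + r)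
      + C (Suc m) * fps_diff (g (Suc (Suc m))) (2 * i + r)" for i m
    unfolding shift gS by (simp only: fps_diff_add fps_diff_cmult)
  show ?thesis
    by (rule hankel_det_tridiagonal[where a = "\<lambda>i m. fps_diff (g m) (2 * i + r)" and \<kappa> = \<kappa>
          and A = A and B = B and C = C, OF _ step0 step]) (simp add: g0)
qed

section \<open>Products of recurrence coefficients as factorials\<close>

lemma prod_const_power:
  fixes x y :: "'a :: comm_ring_1"
  shows "(\<Prod>m<n. x * (y ^ (2 * m) * f m)) = x ^ n * y ^ (2 * (\<Sum>m<n. m)) * (\<Prod>m<n. f m)"
  by (induction n) (simp_all add: power_add algebra_simps)

lemma prod_fact_even:
  "(\<Prod>l<m. of_nat ((2 * l + 1) * (2 * l + 2)) * z * of_nat ((2 * l + 1) * (2 * l + 2))) =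
    z ^ m * (fact (2 * m) ^ 2 :: 'a :: field_char_0)"
  by (induction m) (simp_all add: power2_eq_square algebra_simps)

lemma prod_fact_odd:
  "(\<Prod>l<m. of_nat ((2 * Suc l) * (2 * Suc l + 1)) * z * of_nat ((2 * l + 2) * (2 * l + 3))) =
    z ^ m * (fact (2 * m + 1) ^ 2 :: 'a :: field_char_0)"
  by (induction m) (simp_all add: power2_eq_square algebra_simps)

lemma prod_fact_odd_even:
  "(\<Prod>l<m. of_nat ((2 * Suc l) * (2 * Suc l + 1)) * z * of_nat ((2 * l + 1) * (2 * l + 2))) =
    z ^ m * (fact (2 * m) * fact (2 * m + 1) :: 'a :: field_char_0)"
  by (induction m) (simp_all add: algebra_simps)

text \<open>The factor 2 makes the case \<open>m = 0\<close> equal to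
  \<open>fact 1 * fact 2\<close>; it is supplied later by the second derivative of
  \<open>S^2\<close> at 0.\<close>

lemma prod_fact_even_odd:
  "2 * (\<Prod>l<m. of_nat ((2 * Suc l + 1) * (2 * Suc l + 2)) * z * of_nat ((2 * l + 2) * (2 * l + 3))) =
    z ^ m * (fact (2 * m + 1) * fact (2 * m + 2) :: 'a :: field_char_0)"
proof (induction m)
  case (Suc m)
  have F: "fact (2 * Suc m + 1) * fact (2 * Suc m + 2) =
      of_nat ((2 * Suc m + 1) * (2 * Suc m + 2)) * of_nat ((2 * m + 2) * (2 * m + 3)) *
      (fact (2 * m + 1) * fact (2 * m + 2) :: 'a)"
    by (simp add: algebra_simps)
  then show ?case
    unfolding prod.lessThan_Suc F mult.assoc[symmetric] Suc.IH by (simp only: power_Suc mult_ac)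
qed simp

lemma fps_const_of_nat_mult: "fps_const (of_nat m * x) = of_nat m * fps_const (x :: 'a :: comm_ring_1)"
  by (simp add: fps_of_nat flip: fps_const_mult)

text \<open>The equations are kept formal so that one evaluation serves both the functions at 0 and
  their translates by a half period.\<close>

locale jacobi_system =
  fixes S C D :: "'a :: field_char_0 fps" and c d :: 'a
  assumes deriv_S: "fps_deriv S = C * D"
    and deriv_C: "fps_deriv C = - (S * D)"
    and deriv_D: "fps_deriv D = - (S * C)"
    and nth_S: "fps_nth S 0 = 0"
    and nth_C: "fps_nth C 0 = c"
    and nth_D: "fps_nth D 0 = d"
begin

text \<open>The equations are symmetric in \<open>C\<close> and \<open>D\<close>, so every
  evaluation for \<open>C\<close> is also one for \<open>D\<close>.\<close>

lemma swap: "jacobi_system S D C d c"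
  by (rule jacobi_system.intro)
    (simp_all only: deriv_S deriv_C deriv_D nth_S nth_C nth_D mult.commute)

lemma C_sqr: "C * C = fps_const (c ^ 2) - S * S"
proof -
  have "fps_deriv (C * C + S * S) = 0"
    by (simp add: deriv_S deriv_C algebra_simps del: fps_deriv_eq_0_iff)
  then have "C * C + S * S = fps_const (fps_nth (C * C + S * S) 0)"
    by (rule iffD1[OF fps_deriv_eq_0_iff])
  then show ?thesis
    by (simp add: nth_S nth_C power2_eq_square algebra_simps)
qed

lemma D_sqr: "D * D = fps_const (d ^ 2) - S * S"
  using jacobi_system.C_sqr[OF swap] .

lemma nth_S1: "fps_nth S (Suc 0) = c * d"
  using arg_cong[OF deriv_S, of "\<lambda>f. fps_nth f 0"] by (simp add: nth_C nth_D)

lemma deriv_S_power: "fps_deriv (S ^ Suc p) = of_nat (Suc p) * (S ^ p * (C * D))"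
  by (simp only: fps_deriv_power' deriv_S diff_Suc_1 mult_ac)

lemma deriv_C_S_power:
  "fps_deriv (C * S ^ Suc p) = of_nat (p + 1) * (fps_const (c ^ 2) * (S ^ p * D))
    - of_nat (p + 2) * (S ^ (p + 2) * D)"
proof -
  have "fps_deriv (C * S ^ Suc p) = of_nat (Suc p) * (S ^ p * D * (C * C)) - S ^ (p + 2) * D"
    unfolding fps_deriv_mult deriv_S_power deriv_C by (simp add: algebra_simps)
  then show ?thesis
    by (simp only: C_sqr) (simp add: algebra_simps)
qed

lemma deriv_D_S_power:
  "fps_deriv (D * S ^ Suc p) = of_nat (p + 1) * (fps_const (d ^ 2) * (S ^ p * C))
    - of_nat (p + 2) * (S ^ (p + 2) * C)"
  using jacobi_system.deriv_C_S_power[OF swap] .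

text \<open>Both \<open>C^2\<close> and \<open>D^2\<close> are constants minus \<open>S^2\<close>.
  Hence two derivatives of \<open>C * S^(p+2)\<close> return to \<open>C\<close> times powers of
  \<open>S\<close> whose exponents differ by even numbers.\<close>

lemma deriv2_C_S_power:
  "fps_deriv (fps_deriv (C * S ^ (p + 2))) =
    fps_const (of_nat ((p + 1) * (p + 2)) * (c * d) ^ 2) * (C * S ^ p)
    + fps_const (- (of_nat ((p + 2) ^ 2) * c ^ 2 + of_nat ((p + 3) ^ 2) * d ^ 2)) * (C * S ^ (p + 2))
    + fps_const (of_nat ((p + 3) * (p + 4))) * (C * S ^ (p + 4))"
proof -
  have 1: "fps_deriv (C * S ^ (p + 2)) = of_nat (p + 2) * (fps_const (c ^ 2) * (D * S ^ Suc p))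
      - of_nat (p + 3) * (D * S ^ Suc (p + 2))"
    using deriv_C_S_power[of "Suc p"] by (simp add: mult_ac numeral_eq_Suc)
  have 2: "fps_deriv (of_nat m * f) = of_nat m * fps_deriv f"
      "fps_deriv (fps_const x * f) = fps_const x * fps_deriv f" for m x and f :: "'a fps"
    by (simp_all flip: fps_of_nat)
  have 3: "fps_const (- (of_nat m * x + of_nat k * y)) =
      - (of_nat m * fps_const x + of_nat k * fps_const y)" for m k and x y :: 'a
    by (simp only: fps_const_of_nat_mult fps_const_neg[symmetric] fps_const_add[symmetric])
  show ?thesis
    unfolding 1 fps_deriv_sub 2 deriv_D_S_power 3 fps_const_of_nat_mult fps_of_nat
    by (simp add: algebra_simps power2_eq_square numeral_eq_Suc flip: fps_const_mult)
qed

lemma deriv2_S_power: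
  "fps_deriv (fps_deriv (S ^ (p + 2))) =
    fps_const (of_nat ((p + 1) * (p + 2)) * (c * d) ^ 2) * S ^ p
    + fps_const (of_nat ((p + 2) ^ 2) * - (c ^ 2 + d ^ 2)) * S ^ (p + 2)
    + fps_const (of_nat ((p + 2) * (p + 3))) * S ^ (p + 4)"
proof -
  have 1: "fps_deriv (S ^ (p + 2)) = of_nat (p + 2) * ((C * S ^ Suc p) * D)"
    using deriv_S_power[of "Suc p"] by (simp add: mult_ac numeral_eq_Suc)
  have 2: "fps_deriv (of_nat m * f) = of_nat m * fps_deriv f" for m and f :: "'a fps"
    by (simp flip: fps_of_nat)
  have "fps_deriv ((C * S ^ Suc p) * D) =
      of_nat (p + 1) * (fps_const (c ^ 2) * (S ^ p * (D * D))) - of_nat (p + 2) * (S ^ (p + 2) * (D * D))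
      - S ^ (p + 2) * (C * C)"
    unfolding fps_deriv_mult[of "C * S ^ Suc p" D] deriv_C_S_power deriv_D
    by (simp add: algebra_simps)
  also have "\<dots> = of_nat (p + 1) * (fps_const (c ^ 2 * d ^ 2) * S ^ p)
      - of_nat (p + 2) * (fps_const (c ^ 2 + d ^ 2) * S ^ (p + 2)) + of_nat (p + 3) * S ^ (p + 4)"
    unfolding D_sqr C_sqr
    by (simp add: algebra_simps power2_eq_square numeral_eq_Suc flip: fps_const_mult fps_const_add)
  finally have 3: "fps_deriv ((C * S ^ Suc p) * D) = \<dots>" .
  show ?thesis
    unfolding 1 2 3 fps_const_of_nat_mult fps_of_nat fps_const_neg[symmetric]
    by (simp add: algebra_simps power2_eq_square del: fps_const_neg)
qed

lemma hankel_det_C: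
  "hankel_det n (\<lambda>i. fps_diff C (2 * i)) = c ^ n * (c * d) ^ (2 * (\<Sum>m<n. m)) * (\<Prod>m<n. fact (2 * m) ^ 2)"
proof -
  \<comment> \<open>The bottom of the chain has no lower neighbour and is computed apart; the
    general recurrence starts at \<open>C * S^2\<close>.\<close>
  have "fps_deriv (fps_deriv C) = - (fps_deriv S * D + S * fps_deriv D)"
    by (simp add: deriv_C)
  also have "\<dots> = - (C * (D * D)) + C * (S * S)"
    by (simp add: deriv_S deriv_D algebra_simps)
  also have "\<dots> = fps_const (- (d ^ 2)) * C + fps_const 2 * (C * S ^ 2)"
    unfolding D_sqr by (simp add: algebra_simps power2_eq_square flip: fps_const_neg)
  finally have 1: "fps_deriv (fps_deriv C) = \<dots>" .
  have "hankel_det n (\<lambda>i. fps_diff (C * S ^ (2 * 0)) (2 * i + 0)) =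
      (\<Prod>m<n. c * (\<Prod>l<m. (of_nat ((2 * Suc l - 1) * (2 * Suc l)) * (c * d) ^ 2) * of_nat ((2 * l + 1) * (2 * l + 2))))"
  proof (rule hankel_det_tridiagonal_fps[where g = "\<lambda>m. C * S ^ (2 * m)" and
        A = "\<lambda>m. of_nat ((2 * m - 1) * (2 * m)) * (c * d) ^ 2" and
        B = "\<lambda>m. - (of_nat ((2 * m) ^ 2) * c ^ 2 + of_nat ((2 * m + 1) ^ 2) * d ^ 2)" and
        C = "\<lambda>m. of_nat ((2 * m + 1) * (2 * m + 2))"])
    show "fps_diff (C * S ^ (2 * m)) 0 = (if m = 0 then c else 0)" for m
      by (simp add: fps_diff_def nth_C nth_S)
  qed (use 1 deriv2_C_S_power[of "2 * m" for m] in \<open>simp_all add: numeral_eq_Suc\<close>)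
  then show ?thesis
    using prod_fact_even[where z = "(c * d) ^ 2"]
    by (simp add: prod_const_power flip: power_mult)
qed

text \<open>Leaving out the 0-th derivative changes the chain: by \<open>C' = - (S * D)\<close>, the
  derivatives of \<open>C\<close> of order \<open>2 i + 2\<close> are odd derivatives of
  \<open>- (D * S)\<close>, and \<open>D * S^(2m+1)\<close> obeys the recurrence with
  \<open>C\<close> and \<open>D\<close> exchanged.\<close>

lemma hankel_det_C2:
  "hankel_det n (\<lambda>i. fps_diff C (2 * i + 2)) =
    (-1) ^ n * (c * d ^ 2) ^ n * (c * d) ^ (2 * (\<Sum>m<n. m)) * (\<Prod>m<n. fact (2 * m + 1) ^ 2)"
proof -
  interpret sw: jacobi_system S D C d c
    by (rule swap)
  have "fps_deriv (fps_deriv (D * S)) = fps_deriv (fps_const (d ^ 2) * C - 2 * (C * S ^ Suc 1))"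
    using deriv_D_S_power[of 0] by (simp add: power2_eq_square mult_ac)
  also have "\<dots> = fps_const (d ^ 2) * (- (S * D)) - 2 * fps_deriv (C * S ^ Suc 1)"
    unfolding fps_deriv_sub fps_deriv_mult[of 2] fps_deriv_mult[of "fps_const (d ^ 2)"] deriv_C by simp
  also have "\<dots> = fps_const (- (d ^ 2 + 4 * c ^ 2)) * (D * S) + fps_const 6 * (D * S ^ 3)"
    unfolding deriv_C_S_power fps_const_neg[symmetric] fps_const_add[symmetric] fps_const_mult[symmetric]
    by (simp add: algebra_simps numeral_eq_Suc flip: numeral_fps_const del: fps_const_neg fps_const_add fps_const_mult)
  finally have 1: "fps_deriv (fps_deriv (D * S)) = \<dots>" .
  have dS: "fps_diff (D * S ^ Suc p) (Suc 0) = (if p = 0 then c * d ^ 2 else 0)" for p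
    using nth_S1 by (simp add: fps_diff_def nth_C nth_S nth_D power2_eq_square)
  have "hankel_det n (\<lambda>i. fps_diff (D * S ^ (2 * 0 + 1)) (2 * i + 1)) =
      (\<Prod>m<n. c * d ^ 2 * (\<Prod>l<m. (of_nat ((2 * Suc l) * (2 * Suc l + 1)) * (c * d) ^ 2) * of_nat ((2 * l + 2) * (2 * l + 3))))"
  proof (rule hankel_det_tridiagonal_fps[where g = "\<lambda>m. (D * S ^ (2 * m + 1))" and
        A = "\<lambda>m. of_nat ((2 * m) * (2 * m + 1)) * (c * d) ^ 2" and
        B = "\<lambda>m. - (of_nat ((2 * m + 1) ^ 2) * d ^ 2 + of_nat ((2 * m + 2) ^ 2) * c ^ 2)" and
        C = "\<lambda>m. of_nat ((2 * m + 2) * (2 * m + 3))"])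
    show "fps_diff ((D * S ^ (2 * m + 1))) 1 = (if m = 0 then c * d ^ 2 else 0)" for m
      using dS[of "2 * m"] by simp
  qed (use 1 sw.deriv2_C_S_power[of "2 * m + 1" for m] in \<open>simp_all add: numeral_eq_Suc mult_ac\<close>)
  then have "hankel_det n (\<lambda>i. fps_diff (D * S) (2 * i + 1)) =
      (c * d ^ 2) ^ n * (c * d) ^ (2 * (\<Sum>m<n. m)) * (\<Prod>m<n. fact (2 * m + 1) ^ 2)"
    unfolding prod_fact_odd power_mult[symmetric] prod_const_power by simp
  moreover have "fps_diff C (2 * i + 2) = (-1) * 1 ^ i * fps_diff (D * S) (2 * i + 1)" for i
    using fps_diff_Suc[of C "2 * i + 1"] by (simp add: deriv_C mult.commute[of S D] fps_diff_def del: fact_Suc)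
  ultimately show ?thesis
    using hankel_det_scale[of n "-1" 1 "\<lambda>i. fps_diff (D * S) (2 * i + 1)"] by (simp add: mult.assoc)
qed

lemma hankel_det_S:
  "hankel_det n (\<lambda>i. fps_diff S (2 * i + 1)) =
    (c * d) ^ (n + 2 * (\<Sum>m<n. m)) * (\<Prod>m<n. fact (2 * m) * fact (2 * m + 1))"
proof -
  have "fps_deriv (fps_deriv S) = - (C * C * S) - D * D * S"
    by (simp add: deriv_C deriv_S deriv_D algebra_simps)
  also have "\<dots> = fps_const (- (c ^ 2 + d ^ 2)) * S + fps_const 2 * S ^ 3"
    unfolding D_sqr C_sqr fps_const_neg[symmetric] fps_const_add[symmetric]
    by (simp add: algebra_simps power2_eq_square power3_eq_cube flip: numeral_fps_const del: fps_const_neg fps_const_add)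
  finally have 1: "fps_deriv (fps_deriv S) = \<dots>" .
  have "hankel_det n (\<lambda>i. fps_diff (S ^ (2 * 0 + 1)) (2 * i + 1)) =
      (\<Prod>m<n. c * d * (\<Prod>l<m. (of_nat ((2 * Suc l) * (2 * Suc l + 1)) * (c * d) ^ 2) * of_nat ((2 * l + 1) * (2 * l + 2))))"
  proof (rule hankel_det_tridiagonal_fps[where g = "\<lambda>m. S ^ (2 * m + 1)" and
        A = "\<lambda>m. of_nat ((2 * m) * (2 * m + 1)) * (c * d) ^ 2" and
        B = "\<lambda>m. of_nat ((2 * m + 1) ^ 2) * - (c ^ 2 + d ^ 2)" and
        C = "\<lambda>m. of_nat ((2 * m + 1) * (2 * m + 2))"])
    show "fps_diff (S ^ (2 * m + 1)) 1 = (if m = 0 then c * d else 0)" for m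
      using nth_S1 by (simp add: fps_diff_def nth_S)
  qed (use 1 deriv2_S_power[of "2 * m + 1" for m] in \<open>simp_all add: numeral_eq_Suc mult_ac\<close>)
  then show ?thesis
    unfolding prod_fact_odd_even power_mult[symmetric] prod_const_power by (simp add: power_add)
qed

text \<open>The second derivative of \<open>S^2\<close> contains a constant, so the even powers of
  \<open>S\<close> do not close up. Their derivatives do, as one more differentiation kills the
  constant; this is why \<open>g\<close> consists of derivatives.\<close>

lemma hankel_det_S_sqr:
  "hankel_det n (\<lambda>i. fps_diff (S * S) (2 * i + 2)) =
    (c * d) ^ (2 * n + 2 * (\<Sum>m<n. m)) * (\<Prod>m<n. fact (2 * m + 1) * fact (2 * m + 2))"
proof -
  define g where "g = (\<lambda>m. fps_deriv (S ^ (2 * m + 2)))"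
  have "hankel_det n (\<lambda>i. fps_diff (g 0) (2 * i + 1)) =
      (\<Prod>m<n. 2 * (c * d) ^ 2 * (\<Prod>l<m. (of_nat ((2 * Suc l + 1) * (2 * Suc l + 2)) * (c * d) ^ 2) * of_nat ((2 * l + 2) * (2 * l + 3))))"
  proof (rule hankel_det_tridiagonal_fps[where
        A = "\<lambda>m. of_nat ((2 * m + 1) * (2 * m + 2)) * (c * d) ^ 2" and
        B = "\<lambda>m. of_nat ((2 * m + 2) ^ 2) * - (c ^ 2 + d ^ 2)" and
        C = "\<lambda>m. of_nat ((2 * m + 2) * (2 * m + 3))"])
    show "fps_diff (g m) 1 = (if m = 0 then 2 * (c * d) ^ 2 else 0)" for m
      using arg_cong[OF deriv2_S_power[of "2 * m"], of "\<lambda>f. fps_nth f 0"]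
      by (cases m) (simp_all add: g_def fps_diff_Suc fps_diff_def nth_S)
    have 2: "fps_deriv (fps_const x * f) = fps_const x * fps_deriv f" for x and f :: "'a fps"
      by simp
    show "fps_deriv (fps_deriv (g 0)) = fps_const (of_nat ((2 * 0 + 2) ^ 2) * - (c ^ 2 + d ^ 2)) * g 0
        + fps_const (of_nat ((2 * 0 + 2) * (2 * 0 + 3))) * g 1"
      unfolding g_def deriv2_S_power fps_deriv_add 2 by (simp add: numeral_eq_Suc)
    show "fps_deriv (fps_deriv (g (Suc m))) =
        fps_const (of_nat ((2 * Suc m + 1) * (2 * Suc m + 2)) * (c * d) ^ 2) * g m
        + fps_const (of_nat ((2 * Suc m + 2) ^ 2) * - (c ^ 2 + d ^ 2)) * g (Suc m)
        + fps_const (of_nat ((2 * Suc m + 2) * (2 * Suc m + 3))) * g (Suc (Suc m))" for m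
      unfolding g_def deriv2_S_power fps_deriv_add 2 by (simp add: numeral_eq_Suc)
  qed
  moreover have "fps_diff (S * S) (2 * i + 2) = fps_diff (g 0) (2 * i + 1)" for i
    by (simp add: g_def fps_diff_Suc power2_eq_square)
  ultimately show ?thesis
    unfolding mult.commute[of 2 "(c * d) ^ 2"] mult.assoc[of "(c * d) ^ 2" 2] prod_fact_even_odd
      power_mult[symmetric] prod_const_power
    by (simp add: power_add power_mult)
qed

end

section \<open>Fourier series in a strip\<close>

definition fourier :: "(int \<Rightarrow> complex) \<Rightarrow> complex \<Rightarrow> complex" where
  "fourier c w = (\<Sum>\<^sub>\<infinity>m. c m * exp (\<i> * of_int m * w))"

text \<open>\<open>b\<close> is the half-width of a horizontal strip around the real axis. Asking
  for every \<open>y < b\<close>, but not for \<open>b\<close> itself, makes the notion stable under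
  differentiation.\<close>

definition strip_summable :: "real \<Rightarrow> (int \<Rightarrow> complex) \<Rightarrow> bool" where
  "strip_summable b c \<longleftrightarrow> (\<forall>y. 0 \<le> y \<and> y < b \<longrightarrow> (\<lambda>m. norm (c m) * exp (y * \<bar>m\<bar>)) summable_on UNIV)"

lemma strip_summableD:
  "strip_summable b c \<Longrightarrow> 0 \<le> y \<Longrightarrow> y < b \<Longrightarrow> (\<lambda>m. norm (c m) * exp (y * \<bar>m\<bar>)) summable_on UNIV"
  by (simp add: strip_summable_def)

lemma norm_fourier_term_le:
  assumes "\<bar>Im w\<bar> \<le> y"
  shows "norm (c m * exp (\<i> * of_int m * w)) \<le> norm (c m) * exp (y * \<bar>m\<bar>)"
proof -
  have "- (real_of_int m * Im w) \<le> \<bar>real_of_int m\<bar> * \<bar>Im w\<bar>"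
    by (metis abs_ge_minus_self abs_mult)
  also have "\<dots> \<le> \<bar>real_of_int m\<bar> * y"
    using assms by (intro mult_left_mono) auto
  finally show ?thesis
    by (simp add: norm_mult mult_left_mono mult.commute)
qed

lemma fourier_abs_summable:
  assumes "strip_summable b c" "\<bar>Im w\<bar> < b"
  shows "(\<lambda>m. norm (c m * exp (\<i> * of_int m * w))) summable_on UNIV"
  by (rule Infinite_Sum.abs_summable_on_comparison_test'[OF strip_summableD[OF assms(1), of "\<bar>Im w\<bar>"]])
    (use assms(2) norm_fourier_term_le in auto)

lemma fourier_has_sum:
  assumes "strip_summable b c" "\<bar>Im w\<bar> < b"
  shows "((\<lambda>m. c m * exp (\<i> * of_int m * w)) has_sum fourier c w) UNIV"
  unfolding fourier_def
  by (rule has_sum_infsum[OF abs_summable_summable[OF fourier_abs_summable[OF assms]]])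

lemma strip_summable_deriv:
  assumes "strip_summable b c"
  shows "strip_summable b (\<lambda>m. \<i> * of_int m * c m)"
  unfolding strip_summable_def
proof safe
  fix y assume y: "0 \<le> y" "y < b"
  \<comment> \<open>A slightly larger weight absorbs the factor \<open>|m|\<close>, by
    \<open>t \<le> exp t\<close> at \<open>t = (y' - y) * |m|\<close>.\<close>
  define y' where "y' = (y + b) / 2"
  have y': "y < y'" "y' < b" using y by (auto simp: y'_def)
  show "(\<lambda>m. norm (\<i> * of_int m * c m) * exp (y * \<bar>m\<bar>)) summable_on UNIV"
  proof (rule summable_on_comparison_test)
    show "(\<lambda>m. (1 / (y' - y)) * (norm (c m) * exp (y' * \<bar>m\<bar>))) summable_on UNIV"
      using strip_summableD[OF assms, of y'] y y' by (intro summable_on_cmult_right) auto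
    fix m :: int
    have "(y' - y) * \<bar>m\<bar> \<le> exp ((y' - y) * \<bar>m\<bar>)"
      using exp_ge_add_one_self[of "(y' - y) * \<bar>m\<bar>"] by linarith
    then have "(y' - y) * \<bar>m\<bar> * exp (y * \<bar>m\<bar>) \<le> exp ((y' - y) * \<bar>m\<bar>) * exp (y * \<bar>m\<bar>)"
      by (intro mult_right_mono) auto
    also have "\<dots> = exp (y' * \<bar>m\<bar>)"
      by (simp add: algebra_simps flip: exp_add)
    finally have "\<bar>m\<bar> * exp (y * \<bar>m\<bar>) \<le> exp (y' * \<bar>m\<bar>) / (y' - y)"
      using y' by (simp add: field_simps)
    then have "norm (c m) * (\<bar>m\<bar> * exp (y * \<bar>m\<bar>)) \<le> norm (c m) * (exp (y' * \<bar>m\<bar>) / (y' - y))"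
      by (intro mult_left_mono) auto
    then show "norm (\<i> * of_int m * c m) * exp (y * \<bar>m\<bar>) \<le> (1 / (y' - y)) * (norm (c m) * exp (y' * \<bar>m\<bar>))"
      by (simp add: norm_mult mult_ac)
  qed auto
qed

lemma strip_summable_cmult: "strip_summable b c \<Longrightarrow> strip_summable b (\<lambda>m. a * c m)"
  unfolding strip_summable_def norm_mult mult.assoc using summable_on_cmult_right by fast

lemma fourier_has_field_derivative:
  assumes "strip_summable b c" "\<bar>Im w\<bar> < b"
  shows "(fourier c has_field_derivative fourier (\<lambda>m. \<i> * of_int m * c m) w) (at w)"
proof -
  define y where "y = (\<bar>Im w\<bar> + b) / 2"
  have y: "\<bar>Im w\<bar> < y" "0 \<le> y" "y < b" using assms(2) by (auto simp: y_def)
  define S where "S = {z. \<bar>Im z\<bar> < y}"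
  have S_alt: "S = {z. Im z < y} \<inter> {z. Im z > - y}"
    by (auto simp: S_def)
  have "open S" "convex S"
    unfolding S_alt by (auto intro!: open_Int convex_Int open_halfspace_Im_lt open_halfspace_Im_gt
      convex_halfspace_Im_lt convex_halfspace_Im_gt)
  \<comment> \<open>Termwise differentiation is a theorem about sequences, so the integers are
    enumerated by \<open>int_decode\<close>; absolute summability makes the enumeration
    harmless.\<close>
  have fs: "fourier d z = (\<Sum>n. d (int_decode n) * exp (\<i> * of_int (int_decode n) * z))"
    "summable (\<lambda>n. d (int_decode n) * exp (\<i> * of_int (int_decode n) * z))"
    if d: "strip_summable b d" and "z \<in> S" for d z
  proof -
    have "((\<lambda>m. d m * exp (\<i> * of_int m * z)) has_sum fourier d z) UNIV"
      by (rule fourier_has_sum[OF d]) (use that y in \<open>auto simp: S_def\<close>)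
    then have "((\<lambda>n. d (int_decode n) * exp (\<i> * of_int (int_decode n) * z)) has_sum fourier d z) UNIV"
      using has_sum_reindex_bij_betw[OF bij_int_decode, of "\<lambda>m. d m * exp (\<i> * of_int m * z)"] by simp
    then have "(\<lambda>n. d (int_decode n) * exp (\<i> * of_int (int_decode n) * z)) sums fourier d z"
      by (rule has_sum_imp_sums)
    then show "fourier d z = (\<Sum>n. d (int_decode n) * exp (\<i> * of_int (int_decode n) * z))"
      "summable (\<lambda>n. d (int_decode n) * exp (\<i> * of_int (int_decode n) * z))"
      by (simp_all add: sums_iff)
  qed
  define d where "d = (\<lambda>m. \<i> * of_int m * c m)"
  have d: "strip_summable b d"
    unfolding d_def by (rule strip_summable_deriv[OF assms(1)])
  have "w \<in> S" using y by (simp add: S_def)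
  have "((\<lambda>z. \<Sum>n. c (int_decode n) * exp (\<i> * of_int (int_decode n) * z)) has_field_derivative
      (\<Sum>n. d (int_decode n) * exp (\<i> * of_int (int_decode n) * w))) (at w)"
  proof (rule has_field_derivative_series'(2)[OF \<open>convex S\<close>])
    show "((\<lambda>z. c (int_decode n) * exp (\<i> * of_int (int_decode n) * z)) has_field_derivative
        d (int_decode n) * exp (\<i> * of_int (int_decode n) * z)) (at z within S)" for n z
      by (auto intro!: derivative_eq_intros simp: d_def)
    show "uniformly_convergent_on S (\<lambda>n z. \<Sum>i<n. d (int_decode i) * exp (\<i> * of_int (int_decode i) * z))"
    proof (rule Weierstrass_m_test')
      show "norm (d (int_decode n) * exp (\<i> * of_int (int_decode n) * z))
          \<le> norm (d (int_decode n)) * exp (y * \<bar>int_decode n\<bar>)" if "z \<in> S" for n z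
        using that by (intro norm_fourier_term_le) (simp add: S_def)
      have "(\<lambda>n. norm (d (int_decode n)) * exp (y * \<bar>int_decode n\<bar>)) summable_on UNIV"
        using strip_summableD[OF d y(2,3)]
        by (subst summable_on_reindex_bij_betw[OF bij_int_decode, of "\<lambda>m. norm (d m) * exp (y * \<bar>m\<bar>)"])
      then show "summable (\<lambda>n. norm (d (int_decode n)) * exp (y * \<bar>int_decode n\<bar>))"
        by (rule summable_on_imp_summable)
    qed
    show "w \<in> S" "summable (\<lambda>n. c (int_decode n) * exp (\<i> * of_int (int_decode n) * w))"
      using fs(2)[OF assms(1)] \<open>w \<in> S\<close> by auto
    show "w \<in> interior S"
      using \<open>w \<in> S\<close> \<open>open S\<close> by (simp add: interior_open)
  qed
  then have "((\<lambda>z. \<Sum>n. c (int_decode n) * exp (\<i> * of_int (int_decode n) * z)) has_field_derivative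
      fourier d w) (at w)"
    using fs(1)[OF d \<open>w \<in> S\<close>] by simp
  then have "(fourier c has_field_derivative fourier d w) (at w)"
    by (rule has_field_derivative_transform_within_open[OF _ \<open>open S\<close> \<open>w \<in> S\<close>])
      (simp add: fs(1)[OF assms(1)])
  then show ?thesis by (simp add: d_def)
qed

lemma open_strip: "open {w. \<bar>Im w\<bar> < b}"
  by (intro open_Collect_less continuous_intros)

lemma fourier_holomorphic: "strip_summable b c \<Longrightarrow> fourier c holomorphic_on {w. \<bar>Im w\<bar> < b}"
  using fourier_has_field_derivative by (subst holomorphic_on_open[OF open_strip]) blast

lemma strip_summable_higher_deriv:
  "strip_summable b c \<Longrightarrow> strip_summable b (\<lambda>m. (\<i> * of_int m) ^ k * c m)"
proof (induction k)
  case (Suc k)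
  then show ?case using strip_summable_deriv[OF Suc.IH] by (simp add: mult_ac)
qed simp

lemma fourier_higher_deriv:
  assumes "strip_summable b c" "\<bar>Im w\<bar> < b"
  shows "(deriv ^^ k) (fourier c) w = fourier (\<lambda>m. (\<i> * of_int m) ^ k * c m) w"
  using assms(2)
proof (induction k arbitrary: w)
  case (Suc k)
  have "(deriv ^^ Suc k) (fourier c) w = deriv (fourier (\<lambda>m. (\<i> * of_int m) ^ k * c m)) w"
    unfolding funpow.simps o_def
    by (rule deriv_cong_ev) (use Suc.prems in \<open>auto intro!: eventually_mono[OF eventually_nhds_in_open[OF open_strip, of w b]] Suc.IH\<close>)
  also have "\<dots> = fourier (\<lambda>m. \<i> * of_int m * ((\<i> * of_int m) ^ k * c m)) w"
    by (rule DERIV_imp_deriv[OF fourier_has_field_derivative[OF strip_summable_higher_deriv[OF assms(1)] Suc.prems]])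
  finally show ?case by (simp add: mult_ac)
qed simp

lemma abs_summable_on_product:
  fixes f :: "'a \<Rightarrow> complex" and g :: "'b \<Rightarrow> complex"
  assumes f: "(\<lambda>x. norm (f x)) summable_on A" and g: "(\<lambda>x. norm (g x)) summable_on B"
  shows "(\<lambda>z. norm (case z of (x, y) \<Rightarrow> f x * g y)) summable_on A \<times> B"
proof -
  define G where "G = (\<Sum>\<^sub>\<infinity>y\<in>B. norm (g y))"
  have "0 \<le> G"
    unfolding G_def by (rule infsum_nonneg) simp
  have 1: "(\<Sum>\<^sub>\<infinity>y\<in>B. norm (f x * g y)) = norm (f x) * G" for x
    unfolding norm_mult G_def by (rule infsum_cmult_right')
  have 2: "(\<lambda>y. norm (f x * g y)) summable_on B" for x
    unfolding norm_mult by (rule summable_on_cmult_right[OF g])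
  have "(\<lambda>x. norm (norm (f x) * G)) summable_on A"
    using summable_on_cmult_left[OF f, of G] \<open>0 \<le> G\<close> by (simp add: abs_mult)
  then show ?thesis
    unfolding Infinite_Sum.abs_summable_on_Sigma_iff by (simp add: 1 2)
qed

text \<open>Cauchy product along the diagonals \<open>i + j = n\<close> of an absolutely summable
  double family.\<close>

lemma fourier_mult:
  assumes c: "strip_summable b c" and d: "strip_summable b d" and w: "\<bar>Im w\<bar> < b"
  shows "((\<lambda>n. (\<Sum>\<^sub>\<infinity>i. c i * d (n - i)) * exp (\<i> * of_int n * w)) has_sum (fourier c w * fourier d w)) UNIV"
proof -
  let ?e = "\<lambda>m. exp (\<i> * of_int m * w)"
  have "(\<lambda>z. norm (case z of (i, j) \<Rightarrow> (c i * ?e i) * (d j * ?e j))) summable_on UNIV \<times> UNIV"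
    using fourier_abs_summable[OF c w] fourier_abs_summable[OF d w] by (rule abs_summable_on_product)
  then have s: "(\<lambda>(i, j). (c i * ?e i) * (d j * ?e j)) summable_on UNIV \<times> UNIV"
    by (rule abs_summable_summable)
  have "fourier c w * fourier d w = (\<Sum>\<^sub>\<infinity>i. \<Sum>\<^sub>\<infinity>j. (c i * ?e i) * (d j * ?e j))"
    by (simp add: fourier_def infsum_cmult_left' infsum_cmult_right')
  also have "\<dots> = (\<Sum>\<^sub>\<infinity>(i, j)\<in>UNIV \<times> UNIV. (c i * ?e i) * (d j * ?e j))"
    by (rule infsum_Sigma'_banach[OF s])
  finally have "((\<lambda>(i, j). (c i * ?e i) * (d j * ?e j)) has_sum (fourier c w * fourier d w)) (UNIV \<times> UNIV)"
    using s by (simp add: has_sum_infsum)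
  also have "?this \<longleftrightarrow> ((\<lambda>(n, i). (c i * d (n - i)) * ?e n) has_sum (fourier c w * fourier d w)) (UNIV \<times> UNIV)"
    by (rule has_sum_reindex_bij_witness[where i = "\<lambda>(n, i). (i, n - i)" and j = "\<lambda>(i, j). (i + j, i)"])
      (auto simp: ring_distribs exp_add mult_ac)
  finally have *: "((\<lambda>(n, i). (c i * d (n - i)) * ?e n) has_sum (fourier c w * fourier d w)) (UNIV \<times> UNIV)" .
  show ?thesis
  proof (rule has_sum_SigmaD[OF *])
    fix n :: int
    have "(\<lambda>i. (c i * d (n - i)) * ?e n) summable_on UNIV"
      by (rule summable_on_SigmaD1[OF has_sum_imp_summable[OF *]]) auto
    then have "((\<lambda>i. (c i * d (n - i)) * ?e n) has_sum (\<Sum>\<^sub>\<infinity>i. (c i * d (n - i)) * ?e n)) UNIV"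
      by simp
    then show "((\<lambda>i. case (n, i) of (n, i) \<Rightarrow> (c i * d (n - i)) * ?e n) has_sum (\<Sum>\<^sub>\<infinity>i. c i * d (n - i)) * ?e n) UNIV"
      by (simp add: infsum_cmult_left')
  qed
qed

lemma summable_on_int_power:
  assumes "0 \<le> r" "r < (1 :: real)"
  shows "(\<lambda>m :: int. r ^ nat \<bar>m\<bar>) summable_on UNIV"
proof -
  have "summable (\<lambda>n. r ^ n)" using assms by (intro summable_geometric) auto
  then have g: "(\<lambda>n. r ^ n) summable_on UNIV"
    using assms by (subst summable_on_UNIV_nonneg_real_iff) auto
  have U: "(UNIV :: int set) = range int \<union> range (\<lambda>n. - int n)"
    using int_cases2 by blast
  have "(\<lambda>m :: int. r ^ nat \<bar>m\<bar>) summable_on (range int \<union> range (\<lambda>n. - int n))"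
    by (intro summable_on_union; subst summable_on_reindex) (use g in \<open>auto simp: o_def inj_on_def\<close>)
  then show ?thesis unfolding U .
qed

lemma strip_summableI:
  assumes "0 < \<rho>" "\<rho> < 1" and le: "\<And>m. norm (c m) \<le> K * \<rho> ^ nat \<bar>m\<bar>"
  shows "strip_summable (- ln \<rho>) c"
  unfolding strip_summable_def
proof safe
  fix y assume y: "0 \<le> y" "y < - ln \<rho>"
  then have "exp y < exp (- ln \<rho>)" by (simp only: exp_less_cancel_iff)
  then have r: "\<rho> * exp y < 1" using assms(1) by (simp add: exp_minus field_simps)
  show "(\<lambda>m. norm (c m) * exp (y * \<bar>m\<bar>)) summable_on UNIV"
  proof (rule summable_on_comparison_test)
    show "(\<lambda>m :: int. K * (\<rho> * exp y) ^ nat \<bar>m\<bar>) summable_on UNIV"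
      using r assms(1) by (intro summable_on_cmult_right summable_on_int_power) auto
    show "norm (c m) * exp (y * \<bar>m\<bar>) \<le> K * (\<rho> * exp y) ^ nat \<bar>m\<bar>" for m
    proof -
      have "exp (y * \<bar>m\<bar>) = exp y ^ nat \<bar>m\<bar>"
        by (simp flip: exp_of_nat2_mult)
      then show ?thesis
        using mult_right_mono[OF le[of m], of "exp (y * \<bar>m\<bar>)"] by (simp add: power_mult_distrib mult_ac)
    qed
  qed auto
qed

section \<open>The elliptic functions as Fourier series\<close>

text \<open>For fixed \<open>N\<close>, the difference between the sums for \<open>n + 2\<close> and
  \<open>n\<close> telescopes in \<open>r\<close>: oddness cancels the lower ends, and two upper
  ends remain, each tending to 1. So the limit grows by 2, starting from the values 0 and 1.\<close>

lemma telescoping_odd_limit: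
  fixes \<psi> :: "int \<Rightarrow> complex"
  assumes odd: "\<And>m. \<psi> (- m) = - \<psi> m" and lim: "(\<lambda>N. \<psi> (int N)) \<longlonglongrightarrow> 1"
  shows "(\<lambda>N. \<Sum>r<N. \<psi> (2 * int r + 1 + n) - \<psi> (2 * int r + 1 - n)) \<longlonglongrightarrow> of_int n"
proof -
  have shift: "(\<lambda>N. \<psi> (2 * int N + k)) \<longlonglongrightarrow> 1" for k
  proof -
    have "filterlim (\<lambda>N. nat (2 * int N + k)) at_top sequentially"
      unfolding filterlim_at_top
    proof
      show "eventually (\<lambda>N. Z \<le> nat (2 * int N + k)) sequentially" for Z
        using eventually_ge_at_top[of "Z + nat \<bar>k\<bar>"] by eventually_elim linarith
    qed
    then have "(\<lambda>N. \<psi> (int (nat (2 * int N + k)))) \<longlonglongrightarrow> 1"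
      by (rule filterlim_compose[OF lim])
    moreover have "eventually (\<lambda>N. \<psi> (int (nat (2 * int N + k))) = \<psi> (2 * int N + k)) sequentially"
      using eventually_ge_at_top[of "nat \<bar>k\<bar>"]
    proof eventually_elim
      case (elim N)
      then have "0 \<le> 2 * int N + k" by linarith
      then show ?case by simp
    qed
    ultimately show ?thesis
      by (rule Lim_transform_eventually)
  qed
  define E where "E = (\<lambda>n N. \<Sum>r<N. \<psi> (2 * int r + 1 + n) - \<psi> (2 * int r + 1 - n))"
  have step: "E (n + 2) N = E n N + (\<psi> (2 * int N + (1 + n)) + \<psi> (2 * int N + (- 1 - n)))" for n N
  proof (induction N)
    case 0
    then show ?case using odd[of "1 + n"] by (simp add: E_def)
  next
    case (Suc N)
    then show ?case by (simp add: E_def algebra_simps)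
  qed
  have "E (int k) \<longlonglongrightarrow> of_int (int k)" for k
  proof (induction k rule: less_induct)
    case (less k)
    consider "k = 0" | "k = 1" | k' where "k = k' + 2"
      by (metis One_nat_def Suc_1 add_2_eq_Suc' not0_implies_Suc)
    then show ?case
    proof cases
      case 1
      then show ?thesis by (simp add: E_def)
    next
      case 2
      have "E 1 N = \<psi> (2 * int N + 0) - \<psi> 0" for N
        by (induction N) (simp_all add: E_def algebra_simps)
      moreover have "\<psi> 0 = 0" using odd[of 0] by simp
      ultimately show ?thesis using 2 shift[of 0] by simp
    next
      case 3
      have "E (int k' + 2) \<longlonglongrightarrow> of_int (int k') + (1 + 1)"
        unfolding step using less.IH[of k'] 3 by (intro tendsto_intros shift) auto
      then show ?thesis using 3 by (simp add: add.commute)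
    qed
  qed
  note pos = this
  show ?thesis
  proof (cases "n \<ge> 0")
    case True
    then show ?thesis using pos[of "nat n"] by (simp add: E_def)
  next
    case False
    have "E n N = - E (int (nat (- n))) N" for N
      using False by (simp add: E_def sum_negf[symmetric])
    moreover have "(\<lambda>N. - E (int (nat (- n))) N) \<longlonglongrightarrow> - of_int (int (nat (- n)))"
      by (intro tendsto_minus pos)
    ultimately show ?thesis using False by (simp add: E_def)
  qed
qed

text \<open>The windows end at even integers, so each step adds one odd and one even pair of
  opposite indices.\<close>

lemma has_sum_imp_symmetric_limit:
  fixes f :: "int \<Rightarrow> complex"
  assumes "(f has_sum s) UNIV"
  shows "(\<lambda>N. \<Sum>m\<in>{- 2 * int N..2 * int N}. f m) \<longlonglongrightarrow> s"
proof -
  have "filterlim (\<lambda>N. {- 2 * int N..2 * int N}) (finite_subsets_at_top UNIV) sequentially"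
    unfolding filterlim_finite_subsets_at_top
  proof safe
    fix X :: "int set" assume X: "finite X"
    have "eventually (\<lambda>N. \<forall>x\<in>X. x \<in> {- 2 * int N..2 * int N}) sequentially"
      unfolding eventually_ball_finite_distrib[OF X]
    proof
      fix x assume "x \<in> X"
      show "eventually (\<lambda>N. x \<in> {- 2 * int N..2 * int N}) sequentially"
        using eventually_ge_at_top[of "nat \<bar>x\<bar>"] by eventually_elim auto
    qed
    then show "eventually (\<lambda>N. finite {- 2 * int N..2 * int N} \<and> X \<subseteq> {- 2 * int N..2 * int N}
        \<and> {- 2 * int N..2 * int N} \<subseteq> UNIV) sequentially"
      by eventually_elim auto
  qed
  then show ?thesis
    using assms unfolding has_sum_def by (rule filterlim_compose[rotated])
qed

text \<open>Adding the terms at \<open>i\<close> and \<open>- i\<close> removes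
  \<open>\<phi>\<close> and turns the rest into \<open>\<psi> (i + n) - \<psi> (i - n)\<close>. Two
  functions are allowed because a product of csch and sech has \<open>coth\<close> as
  \<open>\<phi>\<close> and \<open>tanh\<close> as \<open>\<psi>\<close>.\<close>

lemma infsum_telescoping_odd:
  fixes \<phi> \<psi> :: "int \<Rightarrow> complex"
  assumes \<phi>: "\<And>m. \<phi> (- m) = - \<phi> m"
    and \<psi>: "\<And>m. \<psi> (- m) = - \<psi> m" "(\<lambda>N. \<psi> (int N)) \<longlonglongrightarrow> 1"
    and f: "f summable_on UNIV" "\<And>i. f i = (if odd i then \<phi> i - \<psi> (i - n) else 0)"
  shows "infsum f UNIV = of_int n"
proof -
  have "(\<Sum>m\<in>{- 2 * int N..2 * int N}. f m) = (\<Sum>r<N. \<psi> (2 * int r + 1 + n) - \<psi> (2 * int r + 1 - n))" for N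
  proof (induction N)
    case 0
    then show ?case by (simp add: f(2))
  next
    case (Suc N)
    define M where "M = int N"
    have "{- 2 * int (Suc N)..2 * int (Suc N)} =
        insert (2 * M + 1) (insert (2 * M + 2) (insert (- (2 * M + 1)) (insert (- (2 * M + 2)) {- 2 * M..2 * M})))"
      by (auto simp: M_def)
    moreover have "\<psi> (- (2 * M + 1) - n) = - \<psi> (2 * M + 1 + n)"
      using \<psi>(1)[of "2 * M + 1 + n"] by (simp add: algebra_simps)
    ultimately show ?case
      using Suc.IH \<phi>[of "2 * M + 1"] by (simp add: f(2) M_def)
  qed
  then have "(\<lambda>N. \<Sum>r<N. \<psi> (2 * int r + 1 + n) - \<psi> (2 * int r + 1 - n)) \<longlonglongrightarrow> infsum f UNIV"
    using has_sum_imp_symmetric_limit[OF has_sum_infsum[OF f(1)]] by simp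
  then show ?thesis
    using telescoping_odd_limit[OF \<psi>, of n] by (rule LIMSEQ_unique)
qed

lemma strip_summable_conv_summable:
  assumes "strip_summable b c" "strip_summable b d" "b > 0"
  shows "(\<lambda>i. c i * d (n - i)) summable_on UNIV"
proof -
  have c: "(\<lambda>i. norm (c i)) summable_on UNIV" and d: "(\<lambda>i. norm (d i)) summable_on UNIV"
    using strip_summableD[OF assms(1), of 0] strip_summableD[OF assms(2), of 0] assms(3) by auto
  define M where "M = (\<Sum>\<^sub>\<infinity>i. norm (d i))"
  have "norm (d j) \<le> M" for j
    using finite_sum_le_infsum[OF d, of "{j}"] by (simp add: M_def)
  then have "norm (c i * d (n - i)) \<le> norm (c i) * M" for i
    by (simp add: norm_mult mult_left_mono)
  then have "(\<lambda>i. norm (c i * d (n - i))) summable_on UNIV"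
    by (intro Infinite_Sum.abs_summable_on_comparison_test'[OF summable_on_cmult_left[OF c, of M]]) auto
  then show ?thesis by (rule abs_summable_summable)
qed

section \<open>Hyperbolic Fourier coefficients and their convolutions\<close>

definition sech_coeff :: "complex \<Rightarrow> int \<Rightarrow> complex" where
  "sech_coeff Q m = 2 / (Q powi m + Q powi (- m))"

definition csch_coeff :: "complex \<Rightarrow> int \<Rightarrow> complex" where
  "csch_coeff Q m = 2 / (Q powi (- m) - Q powi m)"

text \<open>With \<open>Q^2\<close> as nome these are the classical Fourier coefficients of Jacobi's
  functions: \<open>cn\<close> and \<open>sn\<close> carry the odd frequencies, \<open>dn\<close>
  the even ones with mean value \<open>sech_coeff Q 0 = 1\<close>.\<close>

definition coeff_C :: "complex \<Rightarrow> int \<Rightarrow> complex" where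
  "coeff_C Q m = (if odd m then sech_coeff Q m else 0)"

definition coeff_D :: "complex \<Rightarrow> int \<Rightarrow> complex" where
  "coeff_D Q m = (if even m then sech_coeff Q m else 0)"

definition coeff_S :: "complex \<Rightarrow> int \<Rightarrow> complex" where
  "coeff_S Q m = (if odd m then - \<i> * csch_coeff Q m else 0)"

lemma sech_coeff_minus: "sech_coeff Q (- m) = sech_coeff Q m"
  by (simp add: sech_coeff_def add.commute)

lemma csch_coeff_minus: "csch_coeff Q (- m) = - csch_coeff Q m"
  unfolding csch_coeff_def minus_divide_right by simp

lemma imaginary_unit_mult: "\<i> * (\<i> * x) = - x"
  by (simp flip: mult.assoc)

text \<open>\<open>Q\<close> is a square root of the nome; it is complex so that
  \<open>\<i> * sqrt q\<close>, with nome \<open>- q\<close>, is admissible.\<close>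

locale nome =
  fixes Q :: complex
  assumes Q_nz: "Q \<noteq> 0" and Q_lt_1: "norm Q < 1"
begin

lemma norm_power_lt_1: "k > 0 \<Longrightarrow> norm (Q ^ k) < 1"
  using Q_lt_1 Q_nz by (simp add: norm_power power_less_one_iff)

lemma one_plus_power_nz: "k > 0 \<Longrightarrow> 1 + Q ^ k \<noteq> 0"
  using norm_power_lt_1[of k] by (metis add_eq_0_iff norm_minus_cancel norm_one less_irrefl)

lemma one_minus_power_nz: "k > 0 \<Longrightarrow> 1 - Q ^ k \<noteq> 0"
  using norm_power_lt_1[of k] by auto

lemma cosh_den: "Q powi m + Q powi (- m) = (1 + Q powi m * Q powi m) / Q powi m"
  and sinh_den: "Q powi (- m) - Q powi m = (1 - Q powi m * Q powi m) / Q powi m"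
  using Q_nz by (simp_all add: power_int_minus field_simps)

lemma sech_coeff_eq: "sech_coeff Q m = 2 * Q powi m / (1 + Q powi m * Q powi m)"
  unfolding sech_coeff_def cosh_den by simp

lemma csch_coeff_eq: "csch_coeff Q m = 2 * Q powi m / (1 - Q powi m * Q powi m)"
  unfolding csch_coeff_def sinh_den by simp

lemma sech_coeff_nat: "sech_coeff Q (int k) = 2 * Q ^ k / (1 + Q ^ (2 * k))"
  unfolding sech_coeff_eq mult_2 power_add by simp

lemma csch_coeff_nat: "csch_coeff Q (int k) = 2 * Q ^ k / (1 - Q ^ (2 * k))"
  unfolding csch_coeff_eq mult_2 power_add by simp

lemma one_plus_powi_nz: "1 + Q powi m * Q powi m \<noteq> 0"
proof (cases m rule: int_cases2)
  case (nonneg k)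
  then show ?thesis
    using one_plus_power_nz[of "2 * k"] by (cases "k = 0") (simp_all add: mult_2 power_add)
next
  case (nonpos k)
  have "1 + Q ^ k * Q ^ k \<noteq> 0"
    using one_plus_power_nz[of "2 * k"] by (cases "k = 0") (simp_all add: mult_2 power_add)
  then show ?thesis
    using nonpos Q_nz by (simp add: power_int_minus field_simps)
qed

lemma one_minus_powi_nz: "m \<noteq> 0 \<Longrightarrow> 1 - Q powi m * Q powi m \<noteq> 0"
proof (cases m rule: int_cases2)
  case (nonneg k)
  assume "m \<noteq> 0"
  then show ?thesis
    using nonneg one_minus_power_nz[of "2 * k"] by (simp add: mult_2 power_add)
next
  case (nonpos k)
  assume "m \<noteq> 0"
  then have "1 - Q ^ k * Q ^ k \<noteq> 0"
    using nonpos one_minus_power_nz[of "2 * k"] by (simp add: mult_2 power_add)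
  then show ?thesis
    using nonpos Q_nz by (simp add: power_int_minus field_simps)
qed

definition tanh_coeff :: "int \<Rightarrow> complex" where
  "tanh_coeff m = (1 - Q powi m * Q powi m) / (1 + Q powi m * Q powi m)"

definition coth_coeff :: "int \<Rightarrow> complex" where
  "coth_coeff m = (1 + Q powi m * Q powi m) / (1 - Q powi m * Q powi m)"

lemma tanh_coeff_minus: "tanh_coeff (- m) = - tanh_coeff m"
proof -
  have *: "(1 - 1 / u) / (1 + 1 / u) = - ((1 - u) / (1 + u))" if "u \<noteq> 0" for u :: complex
  proof -
    have "1 - 1 / u = (u - 1) / u" "1 + 1 / u = (1 + u) / u"
      using that by (simp_all add: field_simps)
    then show ?thesis using that by (simp add: minus_divide_left)
  qed
  have "Q powi (- m) * Q powi (- m) = 1 / (Q powi m * Q powi m)"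
    by (simp add: power_int_minus field_simps)
  then show ?thesis
    unfolding tanh_coeff_def using *[of "Q powi m * Q powi m"] Q_nz by simp
qed

lemma coth_coeff_minus: "coth_coeff (- m) = - coth_coeff m"
proof (cases "m = 0")
  case False
  then show ?thesis
    using Q_nz one_minus_powi_nz[of m] by (simp add: coth_coeff_def power_int_minus field_simps)
qed (simp add: coth_coeff_def)

lemma power_Q_sqr_tendsto: "(\<lambda>N. Q ^ N * Q ^ N) \<longlonglongrightarrow> 0"
proof -
  have "(\<lambda>N. Q ^ N) \<longlonglongrightarrow> 0"
    using Q_lt_1 by (intro LIMSEQ_power_zero)
  from tendsto_mult[OF this this] show ?thesis by simp
qed

lemma tanh_coeff_tendsto: "(\<lambda>N. tanh_coeff (int N)) \<longlonglongrightarrow> 1"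
proof -
  have "(\<lambda>N. (1 - Q ^ N * Q ^ N) / (1 + Q ^ N * Q ^ N)) \<longlonglongrightarrow> (1 - 0) / (1 + 0)"
    by (intro tendsto_intros power_Q_sqr_tendsto) auto
  then show ?thesis by (simp add: tanh_coeff_def)
qed

text \<open>The addition theorem \<open>sech a sech b = (tanh a + tanh b) / sinh (a + b)\<close>, for \<open>Q\<^sup>m = e\<^sup>-\<^sup>a\<close>.\<close>

lemma sech_sech:
  assumes "n \<noteq> 0"
  shows "sech_coeff Q i * sech_coeff Q (n - i) = (tanh_coeff i - tanh_coeff (i - n)) * csch_coeff Q n"
proof -
  define x y where "x = Q powi i" and "y = Q powi (n - i)"
  have n: "Q powi n = x * y"
    using Q_nz by (simp add: x_def y_def flip: power_int_add)
  have d: "1 + x * x \<noteq> 0" "1 + y * y \<noteq> 0" "1 - (x * y) * (x * y) \<noteq> 0"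
    using one_plus_powi_nz[of i] one_plus_powi_nz[of "n - i"] one_minus_powi_nz[OF assms]
    unfolding n by (simp_all add: x_def y_def)
  have "tanh_coeff (i - n) = - ((1 - y * y) / (1 + y * y))"
    using tanh_coeff_minus[of "n - i"] by (simp add: tanh_coeff_def y_def)
  note T = this
  show ?thesis
    unfolding T sech_coeff_eq csch_coeff_eq n tanh_coeff_def[of i] x_def[symmetric] y_def[symmetric]
    using d by (simp add: divide_simps) (simp add: algebra_simps)
qed

text \<open>The companion addition theorem
  \<open>csch a sech b = (coth a + tanh b) / cosh (a + b)\<close>.\<close>

lemma csch_sech:
  assumes "i \<noteq> 0"
  shows "csch_coeff Q i * sech_coeff Q (n - i) = (coth_coeff i - tanh_coeff (i - n)) * sech_coeff Q n"
proof -
  define x y where "x = Q powi i" and "y = Q powi (n - i)"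
  have n: "Q powi n = x * y"
    using Q_nz by (simp add: x_def y_def flip: power_int_add)
  have d: "1 - x * x \<noteq> 0" "1 + y * y \<noteq> 0" "1 + (x * y) * (x * y) \<noteq> 0"
    using one_minus_powi_nz[OF assms] one_plus_powi_nz[of "n - i"] one_plus_powi_nz[of n]
    unfolding n by (simp_all add: x_def y_def)
  have "tanh_coeff (i - n) = - ((1 - y * y) / (1 + y * y))"
    using tanh_coeff_minus[of "n - i"] by (simp add: tanh_coeff_def y_def)
  note T = this
  show ?thesis
    unfolding T sech_coeff_eq csch_coeff_eq n coth_coeff_def[of i] x_def[symmetric] y_def[symmetric]
    using d by (simp add: divide_simps) (simp add: algebra_simps)
qed

text \<open>The height of the first pole. If \<open>Q\<close> is the positive square root of the
  nome of a modulus, this is \<open>pi K' / (2 K)\<close>.\<close>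

definition b :: real where "b = - ln (norm Q)"

lemma b_pos: "b > 0"
  using Q_nz Q_lt_1 by (simp add: b_def)

lemma norm_sech_le: "norm (sech_coeff Q m) \<le> 2 / (1 - norm Q) * norm Q ^ nat \<bar>m\<bar>"
  and norm_csch_le: "norm (csch_coeff Q m) \<le> 2 / (1 - norm Q) * norm Q ^ nat \<bar>m\<bar>"
proof -
  have *: "norm (sech_coeff Q (int k)) \<le> 2 / (1 - norm Q) * norm Q ^ k"
    "norm (csch_coeff Q (int k)) \<le> 2 / (1 - norm Q) * norm Q ^ k" for k
  proof -
    have "norm Q ^ (2 * k) \<le> norm Q ^ 1" if "k > 0"
      using Q_lt_1 that by (intro power_decreasing) auto
    moreover have "1 - norm Q ^ (2 * k) \<le> norm (1 - Q ^ (2 * k))" "1 - norm Q ^ (2 * k) \<le> norm (1 + Q ^ (2 * k))"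
      using norm_triangle_ineq2[of 1 "Q ^ (2 * k)"] norm_triangle_ineq2[of 1 "- (Q ^ (2 * k))"]
      by (simp_all add: norm_power)
    ultimately have "1 - norm Q \<le> norm (1 - Q ^ (2 * k))" "1 - norm Q \<le> norm (1 + Q ^ (2 * k))" if "k > 0"
      using that by auto
    then have "norm (2 * Q ^ k / (1 + Q ^ (2 * k))) \<le> 2 * norm Q ^ k / (1 - norm Q)"
      "norm (2 * Q ^ k / (1 - Q ^ (2 * k))) \<le> 2 * norm Q ^ k / (1 - norm Q)" if "k > 0"
      using that Q_lt_1 by (auto simp: norm_divide norm_mult norm_power intro!: divide_left_mono mult_pos_pos)
    then show "norm (sech_coeff Q (int k)) \<le> 2 / (1 - norm Q) * norm Q ^ k"
      "norm (csch_coeff Q (int k)) \<le> 2 / (1 - norm Q) * norm Q ^ k"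
      unfolding sech_coeff_nat csch_coeff_nat using Q_lt_1 Q_nz
      by (cases "k = 0"; simp add: field_simps)+
  qed
  show "norm (sech_coeff Q m) \<le> 2 / (1 - norm Q) * norm Q ^ nat \<bar>m\<bar>"
    "norm (csch_coeff Q m) \<le> 2 / (1 - norm Q) * norm Q ^ nat \<bar>m\<bar>"
    by (cases m rule: int_cases2; use * in \<open>simp add: sech_coeff_minus csch_coeff_minus\<close>)+
qed

lemma strip_summable_C: "strip_summable b (coeff_C Q)"
  and strip_summable_D: "strip_summable b (coeff_D Q)"
  and strip_summable_S: "strip_summable b (coeff_S Q)"
  unfolding b_def using Q_nz Q_lt_1 norm_sech_le norm_csch_le
  by (auto intro!: strip_summableI[where K = "2 / (1 - norm Q)"] simp: coeff_C_def coeff_D_def coeff_S_def norm_mult)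

text \<open>\<open>f\<close> is left abstract because the same sum is the convolution of
  \<open>coeff_C\<close> with \<open>coeff_D\<close> for odd \<open>n\<close>, and of
  \<open>coeff_C\<close> with itself for even \<open>n\<close>.\<close>

lemma infsum_sech_sech:
  assumes "n \<noteq> 0" and f: "f summable_on UNIV" "\<And>i. f i = (if odd i then sech_coeff Q i * sech_coeff Q (n - i) else 0)"
  shows "infsum f UNIV = of_int n * csch_coeff Q n"
proof -
  have nz: "csch_coeff Q n \<noteq> 0"
    unfolding csch_coeff_eq using one_minus_powi_nz[OF assms(1)] Q_nz by simp
  have "(\<Sum>\<^sub>\<infinity>i. f i * (1 / csch_coeff Q n)) = of_int n"
  proof (rule infsum_telescoping_odd[where \<phi> = tanh_coeff and \<psi> = tanh_coeff, OF tanh_coeff_minus tanh_coeff_minus tanh_coeff_tendsto])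
    show "(\<lambda>i. f i * (1 / csch_coeff Q n)) summable_on UNIV"
      by (rule summable_on_cmult_left[OF f(1)])
    show "f i * (1 / csch_coeff Q n) = (if odd i then tanh_coeff i - tanh_coeff (i - n) else 0)" for i
      using nz by (simp add: f(2) sech_sech[OF assms(1)])
  qed
  then show ?thesis
    unfolding infsum_cmult_left' using nz by (simp add: field_simps)
qed

lemma infsum_csch_sech:
  assumes f: "f summable_on UNIV" "\<And>i. f i = (if odd i then csch_coeff Q i * sech_coeff Q (n - i) else 0)"
  shows "infsum f UNIV = of_int n * sech_coeff Q n"
proof -
  have nz: "sech_coeff Q n \<noteq> 0"
    unfolding sech_coeff_eq using one_plus_powi_nz[of n] Q_nz by simp
  have "(\<Sum>\<^sub>\<infinity>i. f i * (1 / sech_coeff Q n)) = of_int n"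
  proof (rule infsum_telescoping_odd[where \<phi> = coth_coeff and \<psi> = tanh_coeff, OF coth_coeff_minus tanh_coeff_minus tanh_coeff_tendsto])
    show "(\<lambda>i. f i * (1 / sech_coeff Q n)) summable_on UNIV"
      by (rule summable_on_cmult_left[OF f(1)])
    show "f i * (1 / sech_coeff Q n) = (if odd i then coth_coeff i - tanh_coeff (i - n) else 0)" for i
    proof (cases "odd i")
      case True
      then have "i \<noteq> 0" by auto
      then show ?thesis using True nz csch_sech[of i n] by (simp add: f(2))
    qed (simp add: f(2))
  qed
  then show ?thesis
    unfolding infsum_cmult_left' using nz by (simp add: field_simps)
qed

lemma conv_C_D: "(\<Sum>\<^sub>\<infinity>i. coeff_C Q i * coeff_D Q (n - i)) = \<i> * of_int n * coeff_S Q n"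
proof (cases "odd n")
  case True
  have "(\<Sum>\<^sub>\<infinity>i. coeff_C Q i * coeff_D Q (n - i)) = of_int n * csch_coeff Q n"
    by (rule infsum_sech_sech[OF _ strip_summable_conv_summable[OF strip_summable_C strip_summable_D b_pos]])
      (use True in \<open>auto simp: coeff_C_def coeff_D_def\<close>)
  then show ?thesis using True by (simp add: coeff_S_def mult_ac imaginary_unit_mult)
next
  case False
  then have "(\<lambda>i. coeff_C Q i * coeff_D Q (n - i)) = (\<lambda>_. 0)"
    by (auto simp: coeff_C_def coeff_D_def)
  then show ?thesis using False by (simp add: coeff_S_def)
qed

lemma conv_S_D: "(\<Sum>\<^sub>\<infinity>i. coeff_S Q i * coeff_D Q (n - i)) = - (\<i> * of_int n * coeff_C Q n)"
proof (cases "odd n")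
  case True
  have "(\<lambda>i. \<i> * (coeff_S Q i * coeff_D Q (n - i))) summable_on UNIV"
    by (intro summable_on_cmult_right strip_summable_conv_summable[OF strip_summable_S strip_summable_D b_pos])
  then have "(\<Sum>\<^sub>\<infinity>i. \<i> * (coeff_S Q i * coeff_D Q (n - i))) = of_int n * sech_coeff Q n"
    by (rule infsum_csch_sech) (use True in \<open>auto simp: coeff_S_def coeff_D_def mult.assoc imaginary_unit_mult\<close>)
  then show ?thesis
    unfolding infsum_cmult_right' using True by (simp add: coeff_C_def field_simps complex_eq_iff)
next
  case False
  then have "(\<lambda>i. coeff_S Q i * coeff_D Q (n - i)) = (\<lambda>_. 0)"
    by (auto simp: coeff_S_def coeff_D_def)
  then show ?thesis using False by (simp add: coeff_C_def)
qed

lemma conv_S_C: "(\<Sum>\<^sub>\<infinity>i. coeff_S Q i * coeff_C Q (n - i)) = - (\<i> * of_int n * coeff_D Q n)"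
proof (cases "even n")
  case True
  have "(\<lambda>i. \<i> * (coeff_S Q i * coeff_C Q (n - i))) summable_on UNIV"
    by (intro summable_on_cmult_right strip_summable_conv_summable[OF strip_summable_S strip_summable_C b_pos])
  then have "(\<Sum>\<^sub>\<infinity>i. \<i> * (coeff_S Q i * coeff_C Q (n - i))) = of_int n * sech_coeff Q n"
    by (rule infsum_csch_sech) (use True in \<open>auto simp: coeff_S_def coeff_C_def mult.assoc imaginary_unit_mult\<close>)
  then show ?thesis
    unfolding infsum_cmult_right' using True by (simp add: coeff_D_def field_simps complex_eq_iff)
next
  case False
  then have "(\<lambda>i. coeff_S Q i * coeff_C Q (n - i)) = (\<lambda>_. 0)"
    by (auto simp: coeff_S_def coeff_C_def)
  then show ?thesis using False by (simp add: coeff_D_def)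
qed

text \<open>At \<open>n = 0\<close> the addition theorem degenerates. That coefficient stays an
  unspecified constant in \<open>CC_sqr\<close> and is removed later by differentiation.\<close>

lemma conv_C_C:
  assumes "n \<noteq> 0"
  shows "(\<Sum>\<^sub>\<infinity>i. coeff_C Q i * coeff_C Q (n - i)) = (if even n then of_int n * csch_coeff Q n else 0)"
proof (cases "even n")
  case True
  have "(\<Sum>\<^sub>\<infinity>i. coeff_C Q i * coeff_C Q (n - i)) = of_int n * csch_coeff Q n"
    by (rule infsum_sech_sech[OF assms strip_summable_conv_summable[OF strip_summable_C strip_summable_C b_pos]])
      (use True in \<open>auto simp: coeff_C_def\<close>)
  then show ?thesis using True by simp
next
  case False
  then have "(\<lambda>i. coeff_C Q i * coeff_C Q (n - i)) = (\<lambda>_. 0)"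
    by (auto simp: coeff_C_def)
  then show ?thesis using False by simp
qed

section \<open>The functions and their differential equations\<close>

definition SS :: "complex \<Rightarrow> complex" where "SS = fourier (coeff_S Q)"
definition CC :: "complex \<Rightarrow> complex" where "CC = fourier (coeff_C Q)"
definition DD :: "complex \<Rightarrow> complex" where "DD = fourier (coeff_D Q)"

text \<open>Termwise differentiation multiplies the m-th coefficient by \<open>\<i> * m\<close>, and
  this is exactly what the convolution of the two other coefficient sequences produces.\<close>

lemma DERIV_SS: "\<bar>Im w\<bar> < b \<Longrightarrow> (SS has_field_derivative CC w * DD w) (at w)"
  using fourier_has_field_derivative[OF strip_summable_S, of w]
    fourier_mult[OF strip_summable_C strip_summable_D, of w]
  by (simp add: SS_def CC_def DD_def conv_C_D fourier_def infsumI)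

lemma DERIV_CC: "\<bar>Im w\<bar> < b \<Longrightarrow> (CC has_field_derivative - (SS w * DD w)) (at w)"
  using fourier_has_field_derivative[OF strip_summable_C, of w]
    infsumI[OF has_sum_uminusI[OF fourier_mult[OF strip_summable_S strip_summable_D, of w]]]
  by (simp add: SS_def CC_def DD_def conv_S_D fourier_def)

lemma DERIV_DD: "\<bar>Im w\<bar> < b \<Longrightarrow> (DD has_field_derivative - (SS w * CC w)) (at w)"
  using fourier_has_field_derivative[OF strip_summable_D, of w]
    infsumI[OF has_sum_uminusI[OF fourier_mult[OF strip_summable_S strip_summable_C, of w]]]
  by (simp add: SS_def CC_def DD_def conv_S_C fourier_def)

end

section \<open>Lambert series as Taylor coefficients\<close>

lemma sums_odd_int:
  fixes f :: "int \<Rightarrow> complex"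
  assumes "(f has_sum s) UNIV" and "\<And>m. even m \<Longrightarrow> f m = 0"
  shows "(\<lambda>i. f (2 * int i + 1) + f (- (2 * int i + 1))) sums s"
proof -
  have "(\<Sum>i<N. f (2 * int i + 1) + f (- (2 * int i + 1))) = (\<Sum>m\<in>{- 2 * int N..2 * int N}. f m)" for N
  proof (induction N)
    case 0
    then show ?case by (simp add: assms(2))
  next
    case (Suc N)
    define M where "M = int N"
    have "{- 2 * int (Suc N)..2 * int (Suc N)} =
        insert (2 * M + 1) (insert (2 * M + 2) (insert (- (2 * M + 1)) (insert (- (2 * M + 2)) {- 2 * M..2 * M})))"
      by (auto simp: M_def)
    then show ?case
      using Suc.IH by (simp add: assms(2) M_def)
  qed
  then show ?thesis
    using has_sum_imp_symmetric_limit[OF assms(1)] by (simp add: sums_def)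
qed

lemma sums_even_int:
  fixes f :: "int \<Rightarrow> complex"
  assumes "(f has_sum s) UNIV" and "\<And>m. odd m \<Longrightarrow> f m = 0"
  shows "(\<lambda>i. f (2 * int (Suc i)) + f (- (2 * int (Suc i)))) sums (s - f 0)"
proof -
  have "(\<Sum>i<N. f (2 * int (Suc i)) + f (- (2 * int (Suc i)))) = (\<Sum>m\<in>{- 2 * int N..2 * int N}. f m) - f 0" for N
  proof (induction N)
    case (Suc N)
    define M where "M = int N"
    have "{- 2 * int (Suc N)..2 * int (Suc N)} =
        insert (2 * M + 1) (insert (2 * M + 2) (insert (- (2 * M + 1)) (insert (- (2 * M + 2)) {- 2 * M..2 * M})))"
      by (auto simp: M_def)
    then show ?case
      using Suc.IH by (simp add: assms(2) M_def algebra_simps)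
  qed simp
  moreover have "(\<lambda>N. (\<Sum>m\<in>{- 2 * int N..2 * int N}. f m) - f 0) \<longlonglongrightarrow> s - f 0"
    by (intro tendsto_intros has_sum_imp_symmetric_limit[OF assms(1)])
  ultimately show ?thesis by (simp add: sums_def)
qed

text \<open>The argument is a square root of the argument of \<open>lambert_T\<close>: half-integer
  powers become odd integer powers and no branch has to be chosen for complex arguments.\<close>

definition clambert_T :: "nat \<Rightarrow> complex \<Rightarrow> complex" where
  "clambert_T s x = (\<Sum>i. of_nat (2 * i + 1) ^ s * x ^ (2 * i + 1) / (1 + x ^ (2 * (2 * i + 1))))"

definition clambert_C :: "nat \<Rightarrow> complex \<Rightarrow> complex" where
  "clambert_C s x = (\<Sum>i. of_nat (2 * i + 1) ^ s * x ^ (2 * i + 1) / (1 - x ^ (2 * (2 * i + 1))))"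

definition clambert_N :: "nat \<Rightarrow> complex \<Rightarrow> complex" where
  "clambert_N s x = (\<Sum>i. of_nat (Suc i) ^ s * x ^ Suc i / (1 + x ^ (2 * Suc i)))"

definition clambert_D :: "nat \<Rightarrow> complex \<Rightarrow> complex" where
  "clambert_D s x = (\<Sum>i. of_nat (Suc i) ^ s * x ^ Suc i / (1 - x ^ (2 * Suc i)))"

lemma strip_summable_has_sum:
  assumes "strip_summable b c" "b > 0"
  shows "(c has_sum fourier c 0) UNIV"
  using fourier_has_sum[OF assms(1), of 0] assms(2) by simp

lemma fourier_minus: "fourier c (- w) = fourier (\<lambda>m. c (- m)) w"
  unfolding fourier_def
  by (rule infsum_reindex_bij_witness[where i = uminus and j = uminus]) auto

lemma higher_deriv_fourier_odd:
  assumes c: "strip_summable b c" "b > 0"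
    and odd: "\<And>m. even m \<Longrightarrow> c m = 0" and sym: "\<And>m. c (- m) = (-1) ^ k * c m"
  shows "(\<lambda>i. 2 * \<i> ^ k * (of_nat (2 * i + 1) ^ k * c (int (2 * i + 1)))) sums (deriv ^^ k) (fourier c) 0"
proof -
  define d where "d = (\<lambda>m. (\<i> * of_int m) ^ k * c m)"
  have "(d has_sum fourier d 0) UNIV"
    unfolding d_def by (rule strip_summable_has_sum[OF strip_summable_higher_deriv[OF c(1)] c(2)])
  then have "(\<lambda>i. d (2 * int i + 1) + d (- (2 * int i + 1))) sums fourier d 0"
    by (rule sums_odd_int) (simp add: d_def odd)
  moreover have "d (int m) + d (- int m) = 2 * \<i> ^ k * (of_nat m ^ k * c (int m))" for m
  proof -
    have "d (- int m) = d (int m)"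
      by (simp add: d_def sym flip: power_mult_distrib mult.assoc)
    then show ?thesis by (simp add: d_def power_mult_distrib)
  qed
  note this[of "2 * i + 1" for i]
  moreover have "fourier d 0 = (deriv ^^ k) (fourier c) 0"
    unfolding d_def by (rule fourier_higher_deriv[OF c(1), symmetric]) (simp add: c(2))
  ultimately show ?thesis by (simp add: add_ac)
qed

lemma higher_deriv_fourier_even:
  assumes c: "strip_summable b c" "b > 0"
    and even: "\<And>m. odd m \<Longrightarrow> c m = 0" and sym: "\<And>m. c (- m) = (-1) ^ k * c m"
  shows "(\<lambda>i. 2 * \<i> ^ k * (of_nat (2 * Suc i) ^ k * c (int (2 * Suc i)))) sums
    ((deriv ^^ k) (fourier c) 0 - (if k = 0 then c 0 else 0))"
proof -
  define d where "d = (\<lambda>m. (\<i> * of_int m) ^ k * c m)"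
  have "(d has_sum fourier d 0) UNIV"
    unfolding d_def by (rule strip_summable_has_sum[OF strip_summable_higher_deriv[OF c(1)] c(2)])
  then have "(\<lambda>i. d (2 * int (Suc i)) + d (- (2 * int (Suc i)))) sums (fourier d 0 - d 0)"
    by (rule sums_even_int) (simp add: d_def even)
  moreover have "d (int m) + d (- int m) = 2 * \<i> ^ k * (of_nat m ^ k * c (int m))" for m
  proof -
    have "d (- int m) = d (int m)"
      by (simp add: d_def sym flip: power_mult_distrib mult.assoc)
    then show ?thesis by (simp add: d_def power_mult_distrib)
  qed
  note this[of "2 * Suc i" for i]
  moreover have "fourier d 0 = (deriv ^^ k) (fourier c) 0"
    unfolding d_def by (rule fourier_higher_deriv[OF c(1), symmetric]) (simp add: c(2))
  moreover have "d 0 = (if k = 0 then c 0 else 0)"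
    by (simp add: d_def power_0_left)
  ultimately show ?thesis by simp
qed

lemma sums_cmult_suminf:
  fixes a :: complex
  assumes "(\<lambda>i. a * g i) sums s" "a \<noteq> 0"
  shows "s = a * (\<Sum>i. g i)"
proof -
  have "g sums (1 / a * s)"
    using sums_mult[OF assms(1), of "1 / a"] assms(2) by simp
  then show ?thesis using assms(2) by (simp add: sums_unique[symmetric])
qed

lemma imaginary_unit_power_even: "\<i> ^ (2 * k) = (-1) ^ k"
  by (simp add: power_mult)

lemma minus_4_power: "(-4 :: complex) ^ k = (-1) ^ k * 2 ^ (2 * k)"
  by (simp add: power_mult flip: power_mult_distrib)

section \<open>Taylor coefficients at the origin\<close>

context nome
begin

lemma higher_deriv_CC: "(deriv ^^ (2 * k)) CC 0 = 4 * (-1) ^ k * clambert_T (2 * k) Q"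
proof -
  have "(\<lambda>i. 2 * \<i> ^ (2 * k) * (of_nat (2 * i + 1) ^ (2 * k) * coeff_C Q (int (2 * i + 1)))) sums (deriv ^^ (2 * k)) CC 0"
    unfolding CC_def by (rule higher_deriv_fourier_odd[OF strip_summable_C b_pos])
      (auto simp: coeff_C_def sech_coeff_minus)
  also have "(\<lambda>i. 2 * \<i> ^ (2 * k) * (of_nat (2 * i + 1) ^ (2 * k) * coeff_C Q (int (2 * i + 1)))) =
      (\<lambda>i. 4 * (-1) ^ k * (of_nat (2 * i + 1) ^ (2 * k) * Q ^ (2 * i + 1) / (1 + Q ^ (2 * (2 * i + 1)))))"
    unfolding imaginary_unit_power_even coeff_C_def by (subst sech_coeff_nat) (auto simp: mult_ac)
  finally show ?thesis
    unfolding clambert_T_def by (rule sums_cmult_suminf) simp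
qed

lemma higher_deriv_SS: "(deriv ^^ (2 * k + 1)) SS 0 = 4 * (-1) ^ k * clambert_C (2 * k + 1) Q"
proof -
  have "(\<lambda>i. 2 * \<i> ^ (2 * k + 1) * (of_nat (2 * i + 1) ^ (2 * k + 1) * coeff_S Q (int (2 * i + 1)))) sums (deriv ^^ (2 * k + 1)) SS 0"
    unfolding SS_def by (rule higher_deriv_fourier_odd[OF strip_summable_S b_pos])
      (auto simp: coeff_S_def csch_coeff_minus)
  also have "(\<lambda>i. 2 * \<i> ^ (2 * k + 1) * (of_nat (2 * i + 1) ^ (2 * k + 1) * coeff_S Q (int (2 * i + 1)))) =
      (\<lambda>i. 4 * (-1) ^ k * (of_nat (2 * i + 1) ^ (2 * k + 1) * Q ^ (2 * i + 1) / (1 - Q ^ (2 * (2 * i + 1)))))"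
    unfolding imaginary_unit_power_even power_add[of \<i>] coeff_S_def
    by (subst csch_coeff_nat) (auto simp: mult_ac imaginary_unit_mult)
  finally show ?thesis
    unfolding clambert_C_def by (rule sums_cmult_suminf) simp
qed

text \<open>The summand 1 at \<open>k = 0\<close> is the mean value of \<open>DD\<close>. It
  perturbs a single entry of the Hankel matrix and so causes the second determinant in the
  identities for \<open>N\<close> that start at index 0.\<close>

lemma higher_deriv_DD:
  "(deriv ^^ (2 * k)) DD 0 = (if k = 0 then 1 else 0) + 4 * (-4) ^ k * clambert_N (2 * k) (Q ^ 2)"
proof -
  have "(\<lambda>i. 2 * \<i> ^ (2 * k) * (of_nat (2 * Suc i) ^ (2 * k) * coeff_D Q (int (2 * Suc i)))) sums
      ((deriv ^^ (2 * k)) DD 0 - (if 2 * k = 0 then coeff_D Q 0 else 0))"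
    unfolding DD_def by (rule higher_deriv_fourier_even[OF strip_summable_D b_pos])
      (auto simp: coeff_D_def sech_coeff_minus)
  also have "(\<lambda>i. 2 * \<i> ^ (2 * k) * (of_nat (2 * Suc i) ^ (2 * k) * coeff_D Q (int (2 * Suc i)))) =
      (\<lambda>i. 4 * (-4) ^ k * (of_nat (Suc i) ^ (2 * k) * (Q ^ 2) ^ Suc i / (1 + (Q ^ 2) ^ (2 * Suc i))))"
  proof
    fix i
    have "2 * \<i> ^ (2 * k) * (of_nat (2 * n) ^ (2 * k) * coeff_D Q (int (2 * n))) =
        4 * (-4) ^ k * (of_nat n ^ (2 * k) * (Q ^ 2) ^ n / (1 + (Q ^ 2) ^ (2 * n)))" for n
      unfolding imaginary_unit_power_even coeff_D_def power_mult[symmetric] minus_4_power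
      by (subst sech_coeff_nat) (simp add: power_mult_distrib)
    from this[of "Suc i"] show "2 * \<i> ^ (2 * k) * (of_nat (2 * Suc i) ^ (2 * k) * coeff_D Q (int (2 * Suc i))) =
        4 * (-4) ^ k * (of_nat (Suc i) ^ (2 * k) * (Q ^ 2) ^ Suc i / (1 + (Q ^ 2) ^ (2 * Suc i)))" .
  qed
  finally have "(deriv ^^ (2 * k)) DD 0 - (if 2 * k = 0 then coeff_D Q 0 else 0) =
      4 * (-4) ^ k * clambert_N (2 * k) (Q ^ 2)"
    unfolding clambert_N_def by (rule sums_cmult_suminf) simp
  moreover have "coeff_D Q 0 = 1"
    by (simp add: coeff_D_def sech_coeff_def)
  ultimately show ?thesis by (simp add: algebra_simps split: if_splits)
qed

text \<open>Coefficients of \<open>CC^2\<close> at all frequencies except 0, where the unknown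
  constant term is replaced by 0.\<close>

definition coeff_CC :: "int \<Rightarrow> complex" where
  "coeff_CC m = (if even m then of_int m * csch_coeff Q m else 0)"

lemma strip_summable_coeff_CC: "strip_summable b coeff_CC"
proof -
  have "strip_summable b (\<lambda>m. if even m then csch_coeff Q m else 0)"
    unfolding b_def using Q_nz Q_lt_1 norm_csch_le
    by (auto intro!: strip_summableI[where K = "2 / (1 - norm Q)"])
  from strip_summable_cmult[OF strip_summable_deriv[OF this], of "- \<i>"]
  show ?thesis
    by (rule back_subst[of "strip_summable b"]) (auto simp: coeff_CC_def fun_eq_iff mult.assoc imaginary_unit_mult)
qed

lemma CC_sqr: "\<exists>K. \<forall>w. \<bar>Im w\<bar> < b \<longrightarrow> CC w * CC w = K + fourier coeff_CC w"
proof -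
  define K where "K = (\<Sum>\<^sub>\<infinity>i. coeff_C Q i * coeff_C Q (0 - i))"
  have "CC w * CC w = K + fourier coeff_CC w" if w: "\<bar>Im w\<bar> < b" for w
  proof -
    have "((\<lambda>m. if m = 0 then K else 0) has_sum K) {0 :: int}"
      by (simp add: has_sum_finite_iff)
    then have "((\<lambda>m. if m = 0 then K else 0) has_sum K) (UNIV :: int set)"
      by (rule iffD1[OF has_sum_cong_neutral, rotated -1]) auto
    from has_sum_add[OF this fourier_has_sum[OF strip_summable_coeff_CC w]]
    have "((\<lambda>m. (if m = 0 then K else 0) + coeff_CC m * exp (\<i> * of_int m * w)) has_sum (K + fourier coeff_CC w)) UNIV" .
    moreover have "(if m = 0 then K else 0) + coeff_CC m * exp (\<i> * of_int m * w) =
        (\<Sum>\<^sub>\<infinity>i. coeff_C Q i * coeff_C Q (m - i)) * exp (\<i> * of_int m * w)" for m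
      by (cases "m = 0") (simp_all add: K_def coeff_CC_def conv_C_C)
    ultimately have "((\<lambda>m. (\<Sum>\<^sub>\<infinity>i. coeff_C Q i * coeff_C Q (m - i)) * exp (\<i> * of_int m * w)) has_sum (K + fourier coeff_CC w)) UNIV"
      by simp
    then show ?thesis
      unfolding CC_def by (rule has_sum_unique[OF fourier_mult[OF strip_summable_C strip_summable_C w]])
  qed
  then show ?thesis by blast
qed

lemma higher_deriv_coeff_CC:
  assumes "k > 0"
  shows "(deriv ^^ (2 * k)) (fourier coeff_CC) 0 = 8 * (-4) ^ k * clambert_D (2 * k + 1) (Q ^ 2)"
proof -
  have "(\<lambda>i. 2 * \<i> ^ (2 * k) * (of_nat (2 * Suc i) ^ (2 * k) * coeff_CC (int (2 * Suc i)))) sums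
      ((deriv ^^ (2 * k)) (fourier coeff_CC) 0 - (if 2 * k = 0 then coeff_CC 0 else 0))"
    by (rule higher_deriv_fourier_even[OF strip_summable_coeff_CC b_pos])
      (auto simp: coeff_CC_def csch_coeff_minus)
  also have "(\<lambda>i. 2 * \<i> ^ (2 * k) * (of_nat (2 * Suc i) ^ (2 * k) * coeff_CC (int (2 * Suc i)))) =
      (\<lambda>i. 8 * (-4) ^ k * (of_nat (Suc i) ^ (2 * k + 1) * (Q ^ 2) ^ Suc i / (1 - (Q ^ 2) ^ (2 * Suc i))))"
  proof
    fix i
    have "2 * \<i> ^ (2 * k) * (of_nat (2 * n) ^ (2 * k) * coeff_CC (int (2 * n))) =
        8 * (-4) ^ k * (of_nat n ^ (2 * k + 1) * (Q ^ 2) ^ n / (1 - (Q ^ 2) ^ (2 * n)))" for n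
      unfolding imaginary_unit_power_even coeff_CC_def power_mult[symmetric] minus_4_power
      by (subst csch_coeff_nat) (simp add: power_mult_distrib)
    from this[of "Suc i"] show "2 * \<i> ^ (2 * k) * (of_nat (2 * Suc i) ^ (2 * k) * coeff_CC (int (2 * Suc i))) =
        8 * (-4) ^ k * (of_nat (Suc i) ^ (2 * k + 1) * (Q ^ 2) ^ Suc i / (1 - (Q ^ 2) ^ (2 * Suc i)))" .
  qed
  finally have "(deriv ^^ (2 * k)) (fourier coeff_CC) 0 - (if 2 * k = 0 then coeff_CC 0 else 0) =
      8 * (-4) ^ k * clambert_D (2 * k + 1) (Q ^ 2)"
    unfolding clambert_D_def by (rule sums_cmult_suminf) simp
  then show ?thesis using assms by simp
qed

end

lemma jacobi_system_fps_expansion: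
  assumes A: "open A" "0 \<in> A"
    and S: "\<And>w. w \<in> A \<Longrightarrow> (S has_field_derivative C w * D w) (at w)"
    and C: "\<And>w. w \<in> A \<Longrightarrow> (C has_field_derivative - (S w * D w)) (at w)"
    and D: "\<And>w. w \<in> A \<Longrightarrow> (D has_field_derivative - (S w * C w)) (at w)"
    and S0: "S 0 = 0"
  shows "jacobi_system (fps_expansion S 0) (fps_expansion C 0) (fps_expansion D 0) (C 0) (D 0)"
proof -
  have exp: "S has_fps_expansion fps_expansion S 0" "C has_fps_expansion fps_expansion C 0"
    "D has_fps_expansion fps_expansion D 0"
    by (rule has_fps_expansion_fps_expansion[OF A], unfold holomorphic_on_open[OF A(1)],
      intro ballI exI, erule S C D)+
  have ev: "eventually (\<lambda>w. w \<in> A) (nhds 0)"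
    using A by (rule eventually_nhds_in_open)
  have deriv: "fps_deriv F = G"
    if "f has_fps_expansion F" "g has_fps_expansion G" "\<And>w. w \<in> A \<Longrightarrow> (f has_field_derivative g w) (at w)" for f g F G
  proof -
    have "deriv f has_fps_expansion fps_deriv F"
      by (rule has_fps_expansion_deriv[OF that(1)])
    moreover have "eventually (\<lambda>w. deriv f w = g w) (nhds 0)"
      using ev by eventually_elim (use that(3) in \<open>auto intro: DERIV_imp_deriv\<close>)
    ultimately have "g has_fps_expansion fps_deriv F"
      using has_fps_expansion_cong by blast
    then show ?thesis
      using that(2) by (rule fps_expansion_unique_complex)
  qed
  show ?thesis
  proof
    show "fps_deriv (fps_expansion S 0) = fps_expansion C 0 * fps_expansion D 0"
      by (rule deriv[OF exp(1) has_fps_expansion_mult[OF exp(2,3)] S])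
    show "fps_deriv (fps_expansion C 0) = - (fps_expansion S 0 * fps_expansion D 0)"
      by (rule deriv[OF exp(2) has_fps_expansion_minus[OF has_fps_expansion_mult[OF exp(1,3)]] C])
    show "fps_deriv (fps_expansion D 0) = - (fps_expansion S 0 * fps_expansion C 0)"
      by (rule deriv[OF exp(3) has_fps_expansion_minus[OF has_fps_expansion_mult[OF exp(1,2)]] D])
  qed (simp_all add: fps_expansion_def S0)
qed

context nome
begin

lemma SS_0: "SS 0 = 0"
proof -
  have "SS 0 = SS (- 0)" by simp
  also have "\<dots> = fourier (\<lambda>m. - coeff_S Q m) 0"
    unfolding SS_def fourier_minus by (simp add: coeff_S_def csch_coeff_minus if_distrib cong: if_cong)
  also have "\<dots> = - SS 0"
    by (simp add: SS_def fourier_def infsum_uminus)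
  finally show ?thesis by simp
qed

lemma jacobi_system_SCD:
  "jacobi_system (fps_expansion SS 0) (fps_expansion CC 0) (fps_expansion DD 0) (CC 0) (DD 0)"
proof (rule jacobi_system_fps_expansion)
  show "open {w. \<bar>Im w\<bar> < b}"
    by (rule open_strip)
qed (simp_all add: b_pos DERIV_SS DERIV_CC DERIV_DD SS_0)

end

section \<open>Translation by a half period\<close>

text \<open>These four sequences are the remainders left after splitting off a secant or tangent;
  \<open>coeff_E\<close> belongs to \<open>CC^2\<close>. They decay at twice the exponential rate of
  the original coefficients. For odd \<open>m\<close> the power \<open>\<i>^(|m| - 1)\<close> is
  just a sign.\<close>

definition coeff_G :: "complex \<Rightarrow> int \<Rightarrow> complex" where
  "coeff_G q m = (if odd m then - 2 * \<i> ^ (nat \<bar>m\<bar> - 1) * (q ^ nat \<bar>m\<bar> / (1 + q ^ nat \<bar>m\<bar>)) else 0)"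

definition coeff_H :: "complex \<Rightarrow> int \<Rightarrow> complex" where
  "coeff_H q m = (if odd m then 2 * \<i> ^ (nat \<bar>m\<bar> - 1) * (q ^ nat \<bar>m\<bar> / (1 - q ^ nat \<bar>m\<bar>)) else 0)"

definition coeff_T :: "complex \<Rightarrow> int \<Rightarrow> complex" where
  "coeff_T q m = (if even m then - 2 * \<i> * of_int (sgn m) * \<i> ^ nat \<bar>m\<bar> * (q ^ nat \<bar>m\<bar> / (1 + q ^ nat \<bar>m\<bar>)) else 0)"

definition coeff_E :: "complex \<Rightarrow> int \<Rightarrow> complex" where
  "coeff_E q m = (if even m then - 2 * of_int \<bar>m\<bar> * \<i> ^ nat \<bar>m\<bar> * (q ^ nat \<bar>m\<bar> / (1 - q ^ nat \<bar>m\<bar>)) else 0)"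

section \<open>Expansions of secant and tangent in the upper half plane\<close>

lemma has_sum_int_of_nat:
  fixes f :: "int \<Rightarrow> complex" and h :: "nat \<Rightarrow> int"
  assumes "(g has_sum s) UNIV" "inj h" "\<And>k. f (h k) = g k" "\<And>m. m \<notin> range h \<Longrightarrow> f m = 0"
  shows "(f has_sum s) UNIV"
proof -
  have "(f has_sum s) (range h)"
    using assms(1,2,3) by (subst has_sum_reindex) (simp_all add: o_def)
  then show ?thesis
    by (rule iffD1[OF has_sum_cong_neutral, rotated -1]) (use assms(4) in auto)
qed

lemma one_plus_nonzero: "norm y < 1 \<Longrightarrow> 1 + y \<noteq> 0" for y :: complex
proof
  assume "norm y < 1" "1 + y = 0"
  then have "y = - 1" by (simp add: add_eq_0_iff)
  with \<open>norm y < 1\<close> show False by simp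
qed

lemma has_sum_geometric: "norm y < 1 \<Longrightarrow> ((\<lambda>k. y ^ k) has_sum (1 / (1 - y))) UNIV" for y :: complex
  by (rule norm_summable_imp_has_sum) (simp_all add: norm_power summable_geometric geometric_sums)

lemma has_sum_geometric_deriv:
  "norm y < 1 \<Longrightarrow> ((\<lambda>k. of_nat (Suc k) * y ^ k) has_sum (1 / (1 - y)\<^sup>2)) UNIV" for y :: complex
proof (rule norm_summable_imp_has_sum)
  assume y: "norm y < 1"
  show "summable (\<lambda>k. norm (of_nat (Suc k) * y ^ k))"
    using geometric_deriv_sums[of "norm y"] y by (simp add: norm_mult norm_power sums_iff del: of_nat_Suc)
  show "(\<lambda>k. of_nat (Suc k) * y ^ k) sums (1 / (1 - y)\<^sup>2)"
    using geometric_deriv_sums[of y] y by simp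
qed

lemma powi_odd_nat: "y powi (2 * int k + 1) = y * (y ^ 2) ^ k" for y :: complex
proof -
  have "2 * int k + 1 = int (2 * k + 1)" by simp
  then show ?thesis by (simp only: power_int_of_nat) (simp add: power_mult)
qed

lemma powi_even_nat: "y powi (2 * int k) = (y ^ 2) ^ k" for y :: complex
proof -
  have "2 * int k = int (2 * k)" by simp
  then show ?thesis by (simp only: power_int_of_nat) (simp add: power_mult)
qed

text \<open>At \<open>x = exp (\<i> * v)\<close> with \<open>0 < Im v\<close> the value is
  \<open>\<i> / cos v\<close>.\<close>

lemma has_sum_sec:
  assumes "norm x < 1"
  shows "((\<lambda>m. (if odd m \<and> m > 0 then 2 * \<i> powi m else 0) * x powi m) has_sum (\<i> * (2 * x / (1 + x\<^sup>2)))) UNIV"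
proof (rule has_sum_int_of_nat)
  have "norm (- (x\<^sup>2)) < 1"
    using assms by (simp add: norm_power power_less_one_iff)
  from has_sum_cmult_right[OF has_sum_geometric[OF this], of "2 * \<i> * x"]
  show "((\<lambda>k. 2 * \<i> * x * (- (x\<^sup>2)) ^ k) has_sum (\<i> * (2 * x / (1 + x\<^sup>2)))) UNIV"
    by (simp add: mult_ac)
  show "(if odd (2 * int k + 1) \<and> 2 * int k + 1 > 0 then 2 * \<i> powi (2 * int k + 1) else 0) * x powi (2 * int k + 1) =
      2 * \<i> * x * (- (x\<^sup>2)) ^ k" for k
    unfolding powi_odd_nat by (simp add: power_minus[of "x\<^sup>2"] mult_ac)
  show "(if odd m \<and> m > 0 then 2 * \<i> powi m else 0) * x powi m = 0" if "m \<notin> range (\<lambda>k. 2 * int k + 1)" for m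
  proof -
    have "\<not> (odd m \<and> m > 0)"
    proof
      assume m: "odd m \<and> m > 0"
      then obtain l where "m = 2 * l + 1" by (elim conjE oddE)
      then have "m = 2 * int (nat l) + 1" using m by auto
      then show False using that by blast
    qed
    then show ?thesis by auto
  qed
qed (auto intro: injI)

text \<open>At \<open>x = exp (\<i> * v)\<close> the value is \<open>- \<i> * tan v\<close>. The
  constant term has weight 1 instead of 2, in accordance with the zero frequency of
  \<open>DD\<close>.\<close>

lemma has_sum_tan:
  assumes "norm x < 1"
  shows "((\<lambda>m. (if even m \<and> m \<ge> 0 then (if m = 0 then 1 else 2) * \<i> powi m else 0) * x powi m) has_sum ((1 - x\<^sup>2) / (1 + x\<^sup>2))) UNIV"
proof (rule has_sum_int_of_nat)
  have n: "norm (- (x\<^sup>2)) < 1"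
    using assms by (simp add: norm_power power_less_one_iff)
  then have nz: "1 + x\<^sup>2 \<noteq> 0"
    using one_plus_nonzero[of "x\<^sup>2"] by simp
  have "((\<lambda>k. if k = 0 then - 1 else 0) has_sum (- 1 :: complex)) {0 :: nat}"
    by (simp add: has_sum_finite_iff)
  then have "((\<lambda>k. if k = 0 then - 1 else 0) has_sum (- 1 :: complex)) (UNIV :: nat set)"
    by (rule iffD1[OF has_sum_cong_neutral, rotated -1]) auto
  from has_sum_add[OF this has_sum_cmult_right[OF has_sum_geometric[OF n], of 2]]
  show "((\<lambda>k. (if k = 0 then - 1 else 0) + 2 * (- (x\<^sup>2)) ^ k) has_sum ((1 - x\<^sup>2) / (1 + x\<^sup>2))) UNIV"
    using nz by (simp add: field_simps)
  show "(if even (2 * int k) \<and> 2 * int k \<ge> 0 then (if 2 * int k = 0 then 1 else 2) * \<i> powi (2 * int k) else 0) * x powi (2 * int k) =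
      (if k = 0 then - 1 else 0) + 2 * (- (x\<^sup>2)) ^ k" for k
    unfolding powi_even_nat by (simp add: power_minus[of "x\<^sup>2"] mult_ac)
  show "(if even m \<and> m \<ge> 0 then (if m = 0 then 1 else 2) * \<i> powi m else 0) * x powi m = 0" if "m \<notin> range (\<lambda>k. 2 * int k)" for m
  proof -
    have "\<not> (even m \<and> m \<ge> 0)"
    proof
      assume m: "even m \<and> m \<ge> 0"
      then obtain l where "m = 2 * l" by (elim conjE evenE)
      then have "m = 2 * int (nat l)" using m by auto
      then show False using that by blast
    qed
    then show ?thesis by auto
  qed
qed (auto intro: injI)

lemma has_sum_sec_sqr:
  assumes "norm x < 1"
  shows "((\<lambda>m. (if even m \<and> m > 0 then 2 * of_int m * \<i> powi m else 0) * x powi m) has_sum (- ((2 * x / (1 + x\<^sup>2))\<^sup>2))) UNIV"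
proof (rule has_sum_int_of_nat)
  have n: "norm (- (x\<^sup>2)) < 1"
    using assms by (simp add: norm_power power_less_one_iff)
  from has_sum_cmult_right[OF has_sum_geometric_deriv[OF this], of "- 4 * x\<^sup>2"]
  show "((\<lambda>k. - 4 * x\<^sup>2 * (of_nat (Suc k) * (- (x\<^sup>2)) ^ k)) has_sum (- ((2 * x / (1 + x\<^sup>2))\<^sup>2))) UNIV"
    by (simp add: power_divide power_mult_distrib)
  show "(if even (2 * int (Suc k)) \<and> 2 * int (Suc k) > 0 then 2 * of_int (2 * int (Suc k)) * \<i> powi (2 * int (Suc k)) else 0) * x powi (2 * int (Suc k)) =
      - 4 * x\<^sup>2 * (of_nat (Suc k) * (- (x\<^sup>2)) ^ k)" for k
    unfolding powi_even_nat by (simp add: power_minus[of "x\<^sup>2"] mult_ac)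
  show "(if even m \<and> m > 0 then 2 * of_int m * \<i> powi m else 0) * x powi m = 0" if "m \<notin> range (\<lambda>k. 2 * int (Suc k))" for m
  proof -
    have "\<not> (even m \<and> m > 0)"
    proof
      assume m: "even m \<and> m > 0"
      then obtain l where "m = 2 * l" by (elim conjE evenE)
      then have "m = 2 * int (Suc (nat (l - 1)))" using m by auto
      then show False using that by blast
    qed
    then show ?thesis by auto
  qed
qed (auto intro: injI)

lemma sec_eq_exp:
  assumes "norm (exp (\<i> * v)) < 1"
  shows "1 / cos v = 2 * exp (\<i> * v) / (1 + (exp (\<i> * v))\<^sup>2)"
    "(1 - (exp (\<i> * v))\<^sup>2) / (1 + (exp (\<i> * v))\<^sup>2) = - \<i> * tan v"
proof -
  define x where "x = exp (\<i> * v)"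
  have x: "x \<noteq> 0" "exp (- (\<i> * v)) = 1 / x"
    by (simp_all add: x_def exp_minus inverse_eq_divide)
  have "norm (x\<^sup>2) < 1"
    using assms by (simp add: x_def norm_power power_less_one_iff)
  then have nz: "1 + x\<^sup>2 \<noteq> 0"
    by (rule one_plus_nonzero)
  have c: "cos v = (1 + x\<^sup>2) / (2 * x)"
    unfolding cos_exp_eq x_def[symmetric] x(2) using x(1) by (simp add: field_simps power2_eq_square)
  have s: "\<i> * sin v = (x\<^sup>2 - 1) / (2 * x)"
    unfolding sin_exp_eq x_def[symmetric] x(2) using x(1) by (simp add: field_simps power2_eq_square)
  show "1 / cos v = 2 * exp (\<i> * v) / (1 + (exp (\<i> * v))\<^sup>2)"
    unfolding c x_def[symmetric] by simp
  have "\<i> * tan v = (x\<^sup>2 - 1) / (1 + x\<^sup>2)"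
    unfolding tan_def times_divide_eq_right s c using x(1) by simp
  then have "- \<i> * tan v = - ((x\<^sup>2 - 1) / (1 + x\<^sup>2))"
    by simp
  also have "\<dots> = (1 - x\<^sup>2) / (1 + x\<^sup>2)"
    by (rule minus_divide_left[THEN trans]) simp
  finally show "(1 - (exp (\<i> * v))\<^sup>2) / (1 + (exp (\<i> * v))\<^sup>2) = - \<i> * tan v"
    unfolding x_def by simp
qed

context nome
begin

abbreviation q where "q \<equiv> Q\<^sup>2"

lemma norm_q: "norm q < 1" "0 < norm q"
  using Q_nz Q_lt_1 by (simp_all add: norm_power power_less_one_iff)

lemma q_power_nz: "n > 0 \<Longrightarrow> 1 + q ^ n \<noteq> 0" "n > 0 \<Longrightarrow> 1 - q ^ n \<noteq> 0"
  unfolding power_mult[symmetric] using one_plus_power_nz[of "2 * n"] one_minus_power_nz[of "2 * n"] by simp_all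

lemma ln_norm_q: "- ln (norm q) = 2 * b"
  using Q_nz by (simp add: b_def norm_power ln_realpow)

lemma norm_lambert_le:
  assumes "n > 0"
  shows "norm (q ^ n / (1 + q ^ n)) \<le> 1 / (1 - norm q) * norm q ^ n"
    "norm (q ^ n / (1 - q ^ n)) \<le> 1 / (1 - norm q) * norm q ^ n"
proof -
  have "norm q ^ n \<le> norm q ^ 1"
    using norm_q assms by (intro power_decreasing) auto
  moreover have "1 - norm q ^ n \<le> norm (1 - q ^ n)" "1 - norm q ^ n \<le> norm (1 + q ^ n)"
    using norm_triangle_ineq2[of 1 "q ^ n"] norm_triangle_ineq2[of 1 "- (q ^ n)"]
    by (simp_all add: norm_power)
  ultimately have "1 - norm q \<le> norm (1 - q ^ n)" "1 - norm q \<le> norm (1 + q ^ n)"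
    by auto
  then have "norm q ^ n / norm (1 + q ^ n) \<le> norm q ^ n / (1 - norm q)"
    "norm q ^ n / norm (1 - q ^ n) \<le> norm q ^ n / (1 - norm q)"
    using norm_q by (auto intro!: divide_left_mono mult_pos_pos)
  then show "norm (q ^ n / (1 + q ^ n)) \<le> 1 / (1 - norm q) * norm q ^ n"
    "norm (q ^ n / (1 - q ^ n)) \<le> 1 / (1 - norm q) * norm q ^ n"
    by (simp_all add: norm_divide norm_power)
qed

lemma strip_summable_lambert:
  assumes "\<And>m. norm (d m) \<le> 2" "d 0 = 0"
  shows "strip_summable (2 * b) (\<lambda>m. d m * (q ^ nat \<bar>m\<bar> / (1 + q ^ nat \<bar>m\<bar>)))"
    "strip_summable (2 * b) (\<lambda>m. d m * (q ^ nat \<bar>m\<bar> / (1 - q ^ nat \<bar>m\<bar>)))"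
proof -
  have *: "norm (d m * x) \<le> 2 / (1 - norm q) * norm q ^ nat \<bar>m\<bar>"
    if "m \<noteq> 0 \<Longrightarrow> norm x \<le> 1 / (1 - norm q) * norm q ^ nat \<bar>m\<bar>" for m x
  proof (cases "m = 0")
    case True
    then show ?thesis using assms(2) norm_q by simp
  next
    case False
    then show ?thesis
      using mult_mono[OF assms(1)[of m] that] by (simp add: norm_mult)
  qed
  show "strip_summable (2 * b) (\<lambda>m. d m * (q ^ nat \<bar>m\<bar> / (1 + q ^ nat \<bar>m\<bar>)))"
    unfolding ln_norm_q[symmetric] by (rule strip_summableI[OF norm_q(2,1) *]) (rule norm_lambert_le(1), simp)
  show "strip_summable (2 * b) (\<lambda>m. d m * (q ^ nat \<bar>m\<bar> / (1 - q ^ nat \<bar>m\<bar>)))"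
    unfolding ln_norm_q[symmetric] by (rule strip_summableI[OF norm_q(2,1) *]) (rule norm_lambert_le(2), simp)
qed

lemma strip_summable_G: "strip_summable (2 * b) (coeff_G q)"
proof -
  have "coeff_G q = (\<lambda>m. (if odd m then - 2 * \<i> ^ (nat \<bar>m\<bar> - 1) else 0) * (q ^ nat \<bar>m\<bar> / (1 + q ^ nat \<bar>m\<bar>)))"
    by (simp add: coeff_G_def fun_eq_iff)
  then show ?thesis
    by (simp only:) (rule strip_summable_lambert, simp_all add: norm_mult norm_power)
qed

lemma strip_summable_H: "strip_summable (2 * b) (coeff_H q)"
proof -
  have "coeff_H q = (\<lambda>m. (if odd m then 2 * \<i> ^ (nat \<bar>m\<bar> - 1) else 0) * (q ^ nat \<bar>m\<bar> / (1 - q ^ nat \<bar>m\<bar>)))"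
    by (simp add: coeff_H_def fun_eq_iff)
  then show ?thesis
    by (simp only:) (rule strip_summable_lambert, simp_all add: norm_mult norm_power)
qed

lemma strip_summable_T: "strip_summable (2 * b) (coeff_T q)"
proof -
  have "coeff_T q = (\<lambda>m. (if even m then - 2 * \<i> * of_int (sgn m) * \<i> ^ nat \<bar>m\<bar> else 0) * (q ^ nat \<bar>m\<bar> / (1 + q ^ nat \<bar>m\<bar>)))"
    by (simp add: coeff_T_def fun_eq_iff)
  then show ?thesis
    by (simp only:) (rule strip_summable_lambert, simp_all add: norm_mult norm_power sgn_if)
qed

lemma strip_summable_E: "strip_summable (2 * b) (coeff_E q)"
proof -
  have "strip_summable (2 * b) (\<lambda>m. (if even m then 2 * \<i> * of_int (sgn m) * \<i> ^ nat \<bar>m\<bar> else 0) * (q ^ nat \<bar>m\<bar> / (1 - q ^ nat \<bar>m\<bar>)))"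
    by (rule strip_summable_lambert) (simp_all add: norm_mult norm_power sgn_if)
  note d = strip_summable_deriv[OF this]
  have *: "\<i> * of_int m * (2 * \<i> * of_int (sgn m) * x * y) = - 2 * of_int \<bar>m\<bar> * x * y" for m x y
  proof -
    have "\<i> * of_int m * (2 * \<i> * of_int (sgn m) * x * y) = (\<i> * \<i>) * of_int (m * sgn m) * 2 * x * y"
      by (simp only: mult_ac of_int_mult)
    then show ?thesis by (simp only: abs_sgn i_squared) simp
  qed
  have "\<i> * of_int m * ((if even m then 2 * \<i> * of_int (sgn m) * \<i> ^ nat \<bar>m\<bar> else 0) * (q ^ nat \<bar>m\<bar> / (1 - q ^ nat \<bar>m\<bar>))) =
      coeff_E q m" for m
    using * by (cases "even m") (simp_all only: coeff_E_def if_True if_False simp_thms mult_zero_left mult_zero_right)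
  with d show ?thesis by (simp only:)
qed

text \<open>Chosen so that translation multiplies the m-th Fourier coefficient by
  \<open>(\<i> / Q)^m\<close>. For positive real \<open>Q\<close> it equals
  \<open>pi / 2 - \<i> * b\<close>, which is \<open>K - \<i> K'\<close> in Jacobi's
  variable.\<close>

definition half_period :: complex where "half_period = - \<i> * Ln (\<i> / Q)"

lemma exp_half_period: "exp (\<i> * half_period) = \<i> / Q"
  using Q_nz by (simp add: half_period_def mult.assoc[symmetric])

lemma Im_half_period: "Im half_period = - b"
  using Q_nz by (simp add: half_period_def b_def norm_divide ln_div)

text \<open>\<open>p\<close> is the part of the translated coefficients that is summed in closed
  form to \<open>P\<close>, and \<open>a * e\<close> is the remainder. The condition on
  \<open>Im v\<close> says that \<open>v + half_period\<close> is inside the strip of the original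
  series.\<close>

lemma fourier_shift:
  assumes c: "strip_summable b c" and e: "strip_summable (2 * b) e" and v: "0 < Im v" "Im v < 2 * b"
    and ce: "\<And>m. c m * (\<i> / Q) powi m = p m + a * e m"
    and P: "((\<lambda>m. p m * exp (\<i> * v) powi m) has_sum P) UNIV"
  shows "fourier c (v + half_period) = P + a * fourier e v"
proof -
  have pw: "exp (\<i> * of_int m * w) = exp (\<i> * w) powi m" for m w
    by (simp add: exp_power_int mult_ac)
  have 1: "((\<lambda>m. c m * exp (\<i> * of_int m * (v + half_period))) has_sum fourier c (v + half_period)) UNIV"
    by (rule fourier_has_sum[OF c]) (use v Im_half_period in auto)
  have 2: "((\<lambda>m. p m * exp (\<i> * v) powi m + a * (e m * exp (\<i> * of_int m * v))) has_sum (P + a * fourier e v)) UNIV"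
    by (intro has_sum_add P has_sum_cmult_right fourier_has_sum[OF e]) (use v in auto)
  have 3: "c m * exp (\<i> * of_int m * (v + half_period)) = p m * exp (\<i> * v) powi m + a * (e m * exp (\<i> * of_int m * v))" for m
  proof -
    have "exp (\<i> * of_int m * (v + half_period)) = (\<i> / Q) powi m * exp (\<i> * v) powi m"
      unfolding pw ring_distribs exp_add exp_half_period power_int_mult_distrib by (rule mult.commute)
    then have "c m * exp (\<i> * of_int m * (v + half_period)) = (c m * (\<i> / Q) powi m) * exp (\<i> * v) powi m"
      by (simp only: mult.assoc)
    then show ?thesis
      unfolding ce pw by (simp only: distrib_right mult.assoc)
  qed
  show ?thesis
    by (rule has_sum_unique[OF 1[unfolded 3] 2])
qed

lemma i_power_odd: "odd n \<Longrightarrow> \<i> powi (- int n) = - (\<i> ^ n)" "odd n \<Longrightarrow> \<i> ^ n = \<i> * \<i> ^ (n - 1)"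
proof -
  assume "odd n"
  then obtain k where n: "n = Suc (2 * k)" by (auto elim: oddE)
  have sq: "\<i> ^ n * \<i> ^ n = - 1"
    unfolding power_mult_distrib[symmetric] i_squared using \<open>odd n\<close> by (simp add: minus_one_power_iff)
  then have "inverse (\<i> ^ n) = - (\<i> ^ n)"
    by (intro inverse_unique) simp
  then show "\<i> powi (- int n) = - (\<i> ^ n)"
    by (simp add: power_int_minus)
  show "\<i> ^ n = \<i> * \<i> ^ (n - 1)"
    using n by simp
qed

lemma i_power_even: "even n \<Longrightarrow> \<i> powi (- int n) = \<i> ^ n"
proof -
  assume "even n"
  then obtain k where n: "n = 2 * k" by (auto elim: evenE)
  have "inverse (\<i> ^ n) = \<i> ^ n"
    using n by (intro inverse_unique) (simp add: power_mult flip: power_mult_distrib)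
  then show "\<i> powi (- int n) = \<i> ^ n"
    by (simp add: power_int_minus)
qed

lemma sech_shift:
  "sech_coeff Q m * (\<i> / Q) powi m = 2 * \<i> powi m / (1 + q powi m)"
  "csch_coeff Q m * (\<i> / Q) powi m = 2 * \<i> powi m / (1 - q powi m)"
  using Q_nz unfolding sech_coeff_eq csch_coeff_eq
  by (simp_all add: power_int_divide_distrib power2_eq_square power_int_mult_distrib)

text \<open>For positive \<open>m\<close> the limit 1 is split off. For negative \<open>m\<close>
  the fraction is expanded by \<open>q^|m|\<close> and is already small.\<close>

lemma q_powi_split:
  assumes "m \<noteq> 0"
  shows "1 / (1 + q powi m) = (if m > 0 then 1 - q ^ nat \<bar>m\<bar> / (1 + q ^ nat \<bar>m\<bar>) else q ^ nat \<bar>m\<bar> / (1 + q ^ nat \<bar>m\<bar>))"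
    "1 / (1 - q powi m) = (if m > 0 then 1 + q ^ nat \<bar>m\<bar> / (1 - q ^ nat \<bar>m\<bar>) else - (q ^ nat \<bar>m\<bar> / (1 - q ^ nat \<bar>m\<bar>)))"
proof -
  define y where "y = q ^ nat \<bar>m\<bar>"
  have y: "1 + y \<noteq> 0" "y + 1 \<noteq> 0" "1 - y \<noteq> 0" "y \<noteq> 0"
    using q_power_nz[of "nat \<bar>m\<bar>"] assms Q_nz by (auto simp: y_def add.commute)
  have "q powi m = (if m > 0 then y else 1 / y)"
    using assms by (auto simp: power_int_def y_def field_simps)
  then show "1 / (1 + q powi m) = (if m > 0 then 1 - q ^ nat \<bar>m\<bar> / (1 + q ^ nat \<bar>m\<bar>) else q ^ nat \<bar>m\<bar> / (1 + q ^ nat \<bar>m\<bar>))"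
    "1 / (1 - q powi m) = (if m > 0 then 1 + q ^ nat \<bar>m\<bar> / (1 - q ^ nat \<bar>m\<bar>) else - (q ^ nat \<bar>m\<bar> / (1 - q ^ nat \<bar>m\<bar>)))"
    unfolding y_def[symmetric] using y by (auto simp: divide_simps)
qed

lemma powi_abs: "m > 0 \<Longrightarrow> \<i> powi m = \<i> ^ nat \<bar>m\<bar>" "m < 0 \<Longrightarrow> \<i> powi m = \<i> powi (- int (nat \<bar>m\<bar>))"
  by (auto simp: power_int_def)

lemma coeff_C_shift:
  "coeff_C Q m * (\<i> / Q) powi m = (if odd m \<and> m > 0 then 2 * \<i> powi m else 0) + \<i> * coeff_G q m"
proof (cases "odd m")
  case True
  then have m: "m \<noteq> 0" "odd (nat \<bar>m\<bar>)" by (auto simp: even_nat_iff)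
  have "coeff_C Q m * (\<i> / Q) powi m = 2 * \<i> powi m * (1 / (1 + q powi m))"
    using True by (simp add: coeff_C_def sech_shift)
  also have "\<dots> = (if odd m \<and> m > 0 then 2 * \<i> powi m else 0) + \<i> * coeff_G q m"
    unfolding q_powi_split[OF m(1)] using True m powi_abs[of m] i_power_odd[OF m(2)]
    by (cases "m > 0") (simp_all add: coeff_G_def algebra_simps)
  finally show ?thesis .
qed (simp add: coeff_C_def coeff_G_def)

lemma coeff_S_shift:
  "coeff_S Q m * (\<i> / Q) powi m = - \<i> * (if odd m \<and> m > 0 then 2 * \<i> powi m else 0) + 1 * coeff_H q m"
proof (cases "odd m")
  case True
  then have m: "m \<noteq> 0" "odd (nat \<bar>m\<bar>)" by (auto simp: even_nat_iff)
  have "coeff_S Q m * (\<i> / Q) powi m = - \<i> * (2 * \<i> powi m) * (1 / (1 - q powi m))"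
    using True by (simp add: coeff_S_def sech_shift mult.assoc)
  also have "\<dots> = - \<i> * (if odd m \<and> m > 0 then 2 * \<i> powi m else 0) + 1 * coeff_H q m"
    unfolding q_powi_split[OF m(1)] using True m powi_abs[of m] i_power_odd[OF m(2)]
    by (cases "m > 0") (simp_all add: coeff_H_def algebra_simps imaginary_unit_mult)
  finally show ?thesis .
qed (simp add: coeff_S_def coeff_H_def)

lemma coeff_D_shift:
  "coeff_D Q m * (\<i> / Q) powi m =
    (if even m \<and> m \<ge> 0 then (if m = 0 then 1 else 2) * \<i> powi m else 0) + - \<i> * coeff_T q m"
proof (cases "even m \<and> m \<noteq> 0")
  case True
  then have m: "m \<noteq> 0" "even (nat \<bar>m\<bar>)" by (auto simp: even_nat_iff)
  have "coeff_D Q m * (\<i> / Q) powi m = 2 * \<i> powi m * (1 / (1 + q powi m))"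
    using True by (simp add: coeff_D_def sech_shift)
  also have "\<dots> = (if even m \<and> m \<ge> 0 then (if m = 0 then 1 else 2) * \<i> powi m else 0) + - \<i> * coeff_T q m"
    unfolding q_powi_split[OF m(1)] using True m powi_abs[of m] i_power_even[OF m(2)]
    by (cases "m > 0") (simp_all add: coeff_T_def algebra_simps imaginary_unit_mult sgn_if)
  finally show ?thesis .
qed (auto simp: coeff_D_def coeff_T_def sech_coeff_def)

lemma coeff_CC_shift:
  "coeff_CC m * (\<i> / Q) powi m = (if even m \<and> m > 0 then 2 * of_int m * \<i> powi m else 0) + - 1 * coeff_E q m"
proof (cases "even m \<and> m \<noteq> 0")
  case True
  then have m: "m \<noteq> 0" "even (nat \<bar>m\<bar>)" by (auto simp: even_nat_iff)
  have "coeff_CC m * (\<i> / Q) powi m = of_int m * (2 * \<i> powi m) * (1 / (1 - q powi m))"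
    using True by (simp add: coeff_CC_def sech_shift mult.assoc)
  also have "\<dots> = (if even m \<and> m > 0 then 2 * of_int m * \<i> powi m else 0) + - 1 * coeff_E q m"
    unfolding q_powi_split[OF m(1)] using True m powi_abs[of m] i_power_even[OF m(2)]
    by (cases "m > 0") (simp_all add: coeff_E_def algebra_simps)
  finally show ?thesis .
qed (auto simp: coeff_CC_def coeff_E_def)

end

definition clambert_R :: "nat \<Rightarrow> complex \<Rightarrow> complex" where
  "clambert_R s x = (\<Sum>i. (-1) ^ i * (of_nat (2 * i + 1) ^ s * x ^ (2 * i + 1) / (1 + x ^ (2 * i + 1))))"

definition clambert_U :: "nat \<Rightarrow> complex \<Rightarrow> complex" where
  "clambert_U s x = (\<Sum>i. (-1) ^ i * (of_nat (Suc i) ^ s * x ^ Suc i / (1 + x ^ Suc i)))"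

definition clambert_G :: "nat \<Rightarrow> complex \<Rightarrow> complex" where
  "clambert_G s x = (\<Sum>i. (-1) ^ Suc i * (of_nat (Suc i) ^ s * x ^ Suc i / (1 - x ^ Suc i)))"

lemma imaginary_unit_mult2: "(\<i> * x) * (\<i> * y) = - (x * y)"
proof -
  have "(\<i> * x) * (\<i> * y) = (\<i> * \<i>) * (x * y)"
    by (simp only: mult_ac)
  then show ?thesis by simp
qed

text \<open>The zeros of the cosine have norm at least \<open>pi / 2\<close>; the cruder radius 1 is
  enough for the ball below.\<close>

lemma cos_nonzero: "norm v < 1 \<Longrightarrow> cos v \<noteq> (0 :: complex)"
proof
  assume v: "norm v < 1" and "cos v = 0"
  then obtain n :: int where "v = of_int n * of_real pi + of_real pi / 2"
    unfolding cos_eq_0 by auto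
  then have "v = of_real ((real_of_int n + 1 / 2) * pi)"
    by (simp add: algebra_simps)
  then have n: "norm v = \<bar>real_of_int n + 1 / 2\<bar> * pi"
    by (simp only: norm_of_real abs_mult) simp
  have "\<bar>real_of_int n + 1 / 2\<bar> \<ge> 1 / 2"
    by (cases "n \<ge> 0") (auto simp: abs_if)
  then have "1 / 2 * 2 \<le> \<bar>real_of_int n + 1 / 2\<bar> * pi"
    using pi_ge_two by (intro mult_mono) auto
  then show False using v n by simp
qed

context nome
begin

text \<open>Translates of \<open>- \<i> CC\<close>, \<open>SS\<close>, \<open>\<i> DD\<close> and, up to sign and a constant, of \<open>CC\<^sup>2\<close> by \<open>half_period\<close>; this line is the boundary of
  the strip where the Fourier series converge, and the trigonometric terms carry the poles on it.\<close>

definition GG :: "complex \<Rightarrow> complex" where "GG v = 1 / cos v + fourier (coeff_G q) v"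
definition HH :: "complex \<Rightarrow> complex" where "HH v = 1 / cos v + fourier (coeff_H q) v"
definition TT :: "complex \<Rightarrow> complex" where "TT v = tan v + fourier (coeff_T q) v"
definition EE :: "complex \<Rightarrow> complex" where "EE v = 1 / cos v ^ 2 + fourier (coeff_E q) v"

lemma norm_exp_lt_1: "0 < Im v \<Longrightarrow> norm (exp (\<i> * v)) < 1"
  by simp

lemma CC_shift:
  assumes v: "0 < Im v" "Im v < 2 * b"
  shows "CC (v + half_period) = \<i> * GG v"
  unfolding CC_def GG_def distrib_left sec_eq_exp(1)[OF norm_exp_lt_1[OF v(1)]]
  by (rule fourier_shift[OF strip_summable_C strip_summable_G v coeff_C_shift has_sum_sec[OF norm_exp_lt_1[OF v(1)]]])

lemma SS_shift:
  assumes v: "0 < Im v" "Im v < 2 * b"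
  shows "SS (v + half_period) = HH v"
proof -
  let ?x = "exp (\<i> * v)"
  have "((\<lambda>m. - \<i> * (if odd m \<and> m > 0 then 2 * \<i> powi m else 0) * ?x powi m) has_sum (- \<i> * (\<i> * (2 * ?x / (1 + ?x\<^sup>2))))) UNIV"
    unfolding mult.assoc[of "- \<i>"] by (rule has_sum_cmult_right[OF has_sum_sec[OF norm_exp_lt_1[OF v(1)]]])
  from fourier_shift[OF strip_summable_S strip_summable_H v coeff_S_shift this]
  show ?thesis
    unfolding SS_def HH_def sec_eq_exp(1)[OF norm_exp_lt_1[OF v(1)]] by (simp add: imaginary_unit_mult)
qed

lemma DD_shift:
  assumes v: "0 < Im v" "Im v < 2 * b"
  shows "DD (v + half_period) = - \<i> * TT v"
  unfolding DD_def TT_def distrib_left sec_eq_exp(2)[OF norm_exp_lt_1[OF v(1)], symmetric]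
  by (rule fourier_shift[OF strip_summable_D strip_summable_T v coeff_D_shift has_sum_tan[OF norm_exp_lt_1[OF v(1)]]])

lemma fourier_coeff_CC_shift:
  assumes v: "0 < Im v" "Im v < 2 * b"
  shows "fourier coeff_CC (v + half_period) = - EE v"
proof -
  have "1 / cos v ^ 2 = (1 / cos v)\<^sup>2"
    by (simp add: power_one_over)
  then show ?thesis
    using fourier_shift[OF strip_summable_coeff_CC strip_summable_E v coeff_CC_shift has_sum_sec_sqr[OF norm_exp_lt_1[OF v(1)]]]
    unfolding EE_def sec_eq_exp(1)[OF norm_exp_lt_1[OF v(1)]] by simp
qed

section \<open>Continuation to a ball around the half period\<close>

definition Bl :: "complex set" where "Bl = ball 0 (min 1 (2 * b))"

lemma Bl: "open Bl" "0 \<in> Bl" "connected Bl"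
  using b_pos by (auto simp: Bl_def)

lemma Bl_strip: "v \<in> Bl \<Longrightarrow> \<bar>Im v\<bar> < 2 * b" "v \<in> Bl \<Longrightarrow> cos v \<noteq> 0"
  using abs_Im_le_cmod[of v] cos_nonzero[of v] by (auto simp: Bl_def)

lemma Bl_upper: "v \<in> Bl \<Longrightarrow> 0 < Im v \<Longrightarrow> Im v < 2 * b"
  using Bl_strip(1)[of v] by auto

text \<open>Relations between the translates are known only for \<open>0 < Im v\<close>, that is
  inside the original strip; the identity theorem carries them to 0, which lies on its boundary. The
  radius of \<open>Bl\<close> keeps \<open>cos\<close> nonzero and the remainders
  convergent.\<close>

lemma Bl_continuation:
  assumes "f holomorphic_on Bl" "g holomorphic_on Bl" "\<And>v. v \<in> Bl \<Longrightarrow> 0 < Im v \<Longrightarrow> f v = g v" "v \<in> Bl"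
  shows "f v = g v"
proof (rule analytic_continuation_open[of "Bl \<inter> {v. 0 < Im v}" Bl f g])
  have "\<i> * of_real (min 1 (2 * b) / 2) \<in> Bl \<inter> {v. 0 < Im v}"
    using b_pos by (auto simp: Bl_def norm_mult)
  then show "Bl \<inter> {v. 0 < Im v} \<noteq> {}" by blast
  show "open (Bl \<inter> {v. 0 < Im v})"
    by (intro open_Int Bl open_halfspace_Im_gt)
qed (use assms Bl in auto)

lemma fourier_holomorphic_Bl:
  assumes "strip_summable (2 * b) c"
  shows "fourier c holomorphic_on Bl"
  by (rule holomorphic_on_subset[OF fourier_holomorphic[OF assms]]) (auto dest: Bl_strip)

lemma holomorphic_Bl: "GG holomorphic_on Bl" "HH holomorphic_on Bl" "TT holomorphic_on Bl" "EE holomorphic_on Bl"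
  unfolding GG_def HH_def TT_def EE_def tan_def
  using fourier_holomorphic_Bl[OF strip_summable_G] fourier_holomorphic_Bl[OF strip_summable_H]
    fourier_holomorphic_Bl[OF strip_summable_T] fourier_holomorphic_Bl[OF strip_summable_E]
  by (auto intro!: holomorphic_intros dest: Bl_strip)

text \<open>\<open>R\<close> is the candidate derivative. Since \<open>deriv F\<close> and
  \<open>R\<close> are both holomorphic on the ball, agreement on its upper half suffices.\<close>

lemma DERIV_continuation:
  assumes F: "F holomorphic_on Bl" and R: "R holomorphic_on Bl"
    and \<Phi>: "\<And>w. \<bar>Im w\<bar> < b \<Longrightarrow> (\<Phi> has_field_derivative \<Phi>' w) (at w)"
    and eq: "\<And>v. v \<in> Bl \<Longrightarrow> 0 < Im v \<Longrightarrow> F v = a * \<Phi> (v + half_period)"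
      "\<And>v. v \<in> Bl \<Longrightarrow> 0 < Im v \<Longrightarrow> R v = a * \<Phi>' (v + half_period)"
    and v: "v \<in> Bl"
  shows "(F has_field_derivative R v) (at v)"
proof -
  have "deriv F v = R v"
  proof (rule Bl_continuation[OF _ R _ v])
    show "deriv F holomorphic_on Bl"
      by (rule holomorphic_deriv[OF F Bl(1)])
    fix v assume v: "v \<in> Bl" "0 < Im v"
    have "((\<lambda>v. a * \<Phi> (v + half_period)) has_field_derivative a * \<Phi>' (v + half_period)) (at v)"
      by (rule DERIV_cmult, rule DERIV_shift[THEN iffD1], rule \<Phi>) (use v(2) Bl_upper[OF v] Im_half_period in simp)
    then have "(F has_field_derivative R v) (at v)"
      unfolding eq(2)[OF v]
      by (rule has_field_derivative_transform_within_open[of _ _ _ "Bl \<inter> {v. 0 < Im v}"])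
        (use v Bl(1) in \<open>auto simp: eq(1) intro: open_Int open_halfspace_Im_gt\<close>)
    then show "deriv F v = R v" by (rule DERIV_imp_deriv)
  qed
  then show ?thesis
    using holomorphic_derivI[OF F Bl(1) v] by simp
qed

lemma Bl_shift:
  assumes "v \<in> Bl" "0 < Im v"
  shows "TT v = \<i> * DD (v + half_period)" "GG v = - \<i> * CC (v + half_period)" "HH v = 1 * SS (v + half_period)"
  using CC_shift[OF assms(2) Bl_upper[OF assms]] SS_shift[OF assms(2) Bl_upper[OF assms]]
    DD_shift[OF assms(2) Bl_upper[OF assms]]
  by (simp_all add: imaginary_unit_mult)

lemma DERIV_TT:
  assumes "v \<in> Bl"
  shows "(TT has_field_derivative GG v * HH v) (at v)"
proof (rule DERIV_continuation[where a = \<i>, OF _ _ DERIV_DD Bl_shift(1) _ assms])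
  show "GG v * HH v = \<i> * - (SS (v + half_period) * CC (v + half_period))" if "v \<in> Bl" "0 < Im v" for v
    unfolding Bl_shift[OF that] by simp
qed (intro holomorphic_intros holomorphic_Bl)+

lemma DERIV_GG:
  assumes "v \<in> Bl"
  shows "(GG has_field_derivative TT v * HH v) (at v)"
proof (rule DERIV_continuation[where a = "- \<i>", OF _ _ DERIV_CC Bl_shift(2) _ assms])
  show "TT v * HH v = - \<i> * - (SS (v + half_period) * DD (v + half_period))" if "v \<in> Bl" "0 < Im v" for v
    unfolding Bl_shift[OF that] by simp
qed (intro holomorphic_intros holomorphic_Bl)+

lemma DERIV_HH:
  assumes "v \<in> Bl"
  shows "(HH has_field_derivative TT v * GG v) (at v)"
proof (rule DERIV_continuation[where a = 1, OF _ _ DERIV_SS Bl_shift(3) _ assms])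
  show "TT v * GG v = 1 * (CC (v + half_period) * DD (v + half_period))" if "v \<in> Bl" "0 < Im v" for v
    unfolding Bl_shift[OF that] by (simp add: imaginary_unit_mult2)
qed (intro holomorphic_intros holomorphic_Bl)+

lemma TT_0: "TT 0 = 0"
proof -
  have "fourier (coeff_T q) 0 = fourier (coeff_T q) (- 0)" by simp
  also have "\<dots> = fourier (\<lambda>m. - coeff_T q m) 0"
    unfolding fourier_minus by (rule arg_cong[where f = "\<lambda>c. fourier c 0"]) (auto simp: coeff_T_def fun_eq_iff)
  also have "\<dots> = - fourier (coeff_T q) 0"
    by (simp add: fourier_def infsum_uminus)
  finally show ?thesis by (simp add: TT_def)
qed

text \<open>The translates satisfy the equations with all signs positive; the factors
  \<open>- 1\<close>, \<open>\<i>\<close>, \<open>\<i>\<close> restore the signs demanded by the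
  locale.\<close>

lemma jacobi_system_TGH:
  "jacobi_system (fps_expansion (\<lambda>v. - TT v) 0) (fps_expansion (\<lambda>v. \<i> * GG v) 0) (fps_expansion (\<lambda>v. \<i> * HH v) 0)
    (\<i> * GG 0) (\<i> * HH 0)"
proof (rule jacobi_system_fps_expansion[OF Bl(1,2)])
  fix v assume v: "v \<in> Bl"
  show "((\<lambda>v. - TT v) has_field_derivative (\<i> * GG v) * (\<i> * HH v)) (at v)"
    using DERIV_minus[OF DERIV_TT[OF v]] by (simp add: imaginary_unit_mult2)
  show "((\<lambda>v. \<i> * GG v) has_field_derivative - (- TT v * (\<i> * HH v))) (at v)"
    using DERIV_cmult[OF DERIV_GG[OF v], of \<i>] by (simp add: mult_ac)
  show "((\<lambda>v. \<i> * HH v) has_field_derivative - (- TT v * (\<i> * GG v))) (at v)"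
    using DERIV_cmult[OF DERIV_HH[OF v], of \<i>] by (simp add: mult_ac)
qed (simp add: TT_0)

lemma CC_SS_sqr: "\<bar>Im w\<bar> < b \<Longrightarrow> CC w * CC w + SS w * SS w = CC 0 * CC 0"
  and DD_SS_sqr: "\<bar>Im w\<bar> < b \<Longrightarrow> DD w * DD w + SS w * SS w = DD 0 * DD 0"
proof -
  assume w: "\<bar>Im w\<bar> < b"
  have S: "convex {w. \<bar>Im w\<bar> < b}"
  proof -
    have "{w. \<bar>Im w\<bar> < b} = {z. Im z < b} \<inter> {z. Im z > - b}" by auto
    then show ?thesis by (auto intro!: convex_Int convex_halfspace_Im_lt convex_halfspace_Im_gt)
  qed
  have "\<exists>c. \<forall>w\<in>{w. \<bar>Im w\<bar> < b}. CC w * CC w + SS w * SS w = c"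
  proof (rule has_field_derivative_zero_constant[OF S])
    fix w assume "w \<in> {w. \<bar>Im w\<bar> < b}"
    then have w: "\<bar>Im w\<bar> < b" by simp
    show "((\<lambda>w. CC w * CC w + SS w * SS w) has_field_derivative 0) (at w within {w. \<bar>Im w\<bar> < b})"
      by (rule has_field_derivative_at_within,
        rule DERIV_cong[OF DERIV_add[OF DERIV_mult[OF DERIV_CC[OF w] DERIV_CC[OF w]] DERIV_mult[OF DERIV_SS[OF w] DERIV_SS[OF w]]]])
        (simp add: mult_ac)
  qed
  then obtain c where c: "\<forall>w\<in>{w. \<bar>Im w\<bar> < b}. CC w * CC w + SS w * SS w = c" ..
  show "CC w * CC w + SS w * SS w = CC 0 * CC 0"
    using bspec[OF c, of w] bspec[OF c, of 0] w by (simp add: b_pos SS_0)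
  have "\<exists>c. \<forall>w\<in>{w. \<bar>Im w\<bar> < b}. DD w * DD w + SS w * SS w = c"
  proof (rule has_field_derivative_zero_constant[OF S])
    fix w assume "w \<in> {w. \<bar>Im w\<bar> < b}"
    then have w: "\<bar>Im w\<bar> < b" by simp
    show "((\<lambda>w. DD w * DD w + SS w * SS w) has_field_derivative 0) (at w within {w. \<bar>Im w\<bar> < b})"
      by (rule has_field_derivative_at_within,
        rule DERIV_cong[OF DERIV_add[OF DERIV_mult[OF DERIV_DD[OF w] DERIV_DD[OF w]] DERIV_mult[OF DERIV_SS[OF w] DERIV_SS[OF w]]]])
        (simp add: mult_ac)
  qed
  then obtain d where d: "\<forall>w\<in>{w. \<bar>Im w\<bar> < b}. DD w * DD w + SS w * SS w = d" ..
  show "DD w * DD w + SS w * SS w = DD 0 * DD 0"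
    using bspec[OF d, of w] bspec[OF d, of 0] w by (simp add: b_pos SS_0)
qed

text \<open>The first integral \<open>CC^2 + SS^2\<close>, read at the half period, where
  \<open>CC\<close> becomes \<open>\<i> * GG\<close>. In terms of theta constants this is Jacobi's
  quartic identity.\<close>

lemma HH_GG_sqr: "HH 0 * HH 0 - GG 0 * GG 0 = CC 0 * CC 0"
proof (rule Bl_continuation[of "\<lambda>v. HH v * HH v - GG v * GG v" "\<lambda>_. CC 0 * CC 0", OF _ _ _ Bl(2)])
  fix v assume v: "v \<in> Bl" "0 < Im v"
  have "\<bar>Im (v + half_period)\<bar> < b"
    using Bl_upper[OF v] v(2) Im_half_period by simp
  from CC_SS_sqr[OF this]
  show "HH v * HH v - GG v * GG v = CC 0 * CC 0"
    unfolding Bl_shift[OF v] by (simp add: imaginary_unit_mult2 add.commute)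
qed (intro holomorphic_intros holomorphic_Bl)+

lemma GG_sqr: "\<exists>K. \<forall>v\<in>Bl. (\<i> * GG v) * (\<i> * GG v) = K - EE v"
proof -
  obtain K where K: "\<forall>w. \<bar>Im w\<bar> < b \<longrightarrow> CC w * CC w = K + fourier coeff_CC w"
    using CC_sqr by (rule exE)
  have "(\<i> * GG v) * (\<i> * GG v) = K - EE v" if "v \<in> Bl" for v
  proof (rule Bl_continuation[of "\<lambda>v. (\<i> * GG v) * (\<i> * GG v)" "\<lambda>v. K - EE v", OF _ _ _ that])
    fix v assume v: "v \<in> Bl" "0 < Im v"
    have "\<bar>Im (v + half_period)\<bar> < b"
      using Bl_upper[OF v] v(2) Im_half_period by simp
    then have "CC (v + half_period) * CC (v + half_period) = K + - EE v"
      using K fourier_coeff_CC_shift[OF v(2) Bl_upper[OF v]] by simp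
    then show "(\<i> * GG v) * (\<i> * GG v) = K - EE v"
      unfolding CC_shift[OF v(2) Bl_upper[OF v]] by simp
  qed (intro holomorphic_intros holomorphic_Bl)+
  then show ?thesis by (intro exI ballI)
qed

end

section \<open>Secant and tangent numbers\<close>

definition sec_fps :: "complex fps" where "sec_fps = inverse (fps_cos 1)"
definition tan_fps :: "complex fps" where "tan_fps = sec_fps * fps_sin 1"

lemma sec_fps_cos: "sec_fps * fps_cos 1 = 1"
  unfolding sec_fps_def by (rule inverse_mult_eq_1) simp

lemma deriv_sec_fps: "fps_deriv sec_fps = sec_fps * tan_fps"
proof -
  have "fps_deriv sec_fps = - fps_deriv (fps_cos 1) * sec_fps\<^sup>2"
    unfolding sec_fps_def by (rule fps_inverse_deriv) simp
  then show ?thesis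
    by (simp add: fps_cos_deriv tan_fps_def power2_eq_square mult_ac flip: fps_const_neg)
qed

lemma deriv_tan_fps: "fps_deriv tan_fps = 1 + tan_fps * tan_fps"
proof -
  have "fps_deriv tan_fps = sec_fps * fps_cos 1 + sec_fps * tan_fps * fps_sin 1"
    by (simp add: tan_fps_def[symmetric] fps_deriv_mult[of sec_fps "fps_sin 1", folded tan_fps_def] deriv_sec_fps fps_sin_deriv)
  then show ?thesis
    unfolding sec_fps_cos by (simp add: tan_fps_def mult_ac)
qed

lemma nonneg_Reals_sum:
  fixes f :: "'b \<Rightarrow> complex"
  assumes "\<And>i. i \<in> A \<Longrightarrow> f i \<in> \<real>\<^sub>\<ge>\<^sub>0"
  shows "sum f A \<in> \<real>\<^sub>\<ge>\<^sub>0"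
  using assms by (induction A rule: infinite_finite_induct) (auto intro: nonneg_Reals_add_I)

text \<open>The equations \<open>sec' = sec tan\<close> and \<open>tan' = 1 + tan^2\<close> produce
  each coefficient from earlier ones by sums and products and division by a positive integer. This
  fixes the signs of Euler and Bernoulli numbers behind the absolute values in the correction
  sequences.\<close>

lemma sec_tan_nonneg: "fps_nth sec_fps n \<in> \<real>\<^sub>\<ge>\<^sub>0 \<and> fps_nth tan_fps n \<in> \<real>\<^sub>\<ge>\<^sub>0"
proof (induction n rule: less_induct)
  case (less n)
  show ?case
  proof (cases n)
    case 0
    then show ?thesis by (simp add: sec_fps_def tan_fps_def)
  next
    case (Suc m)
    have *: "x \<in> \<real>\<^sub>\<ge>\<^sub>0" if "of_nat (Suc m) * x \<in> \<real>\<^sub>\<ge>\<^sub>0" for x :: complex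
    proof -
      have "of_real (1 / real (Suc m)) * (of_nat (Suc m) * x) \<in> \<real>\<^sub>\<ge>\<^sub>0"
        by (intro nonneg_Reals_mult_I that) (simp add: nonneg_Reals_of_real_iff)
      also have "of_real (1 / real (Suc m)) * (of_nat (Suc m) * x) = x"
        by (simp add: field_simps del: of_nat_Suc)
      finally show ?thesis .
    qed
    have "of_nat (Suc m) * fps_nth sec_fps n = fps_nth (sec_fps * tan_fps) m"
      using arg_cong[OF deriv_sec_fps, of "\<lambda>f. fps_nth f m"] Suc by simp
    also have "\<dots> \<in> \<real>\<^sub>\<ge>\<^sub>0"
      unfolding fps_mult_nth using less Suc by (intro nonneg_Reals_sum nonneg_Reals_mult_I) auto
    finally have 1: "fps_nth sec_fps n \<in> \<real>\<^sub>\<ge>\<^sub>0" by (rule *)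
    have "of_nat (Suc m) * fps_nth tan_fps n = fps_nth 1 m + fps_nth (tan_fps * tan_fps) m"
      using arg_cong[OF deriv_tan_fps, of "\<lambda>f. fps_nth f m"] Suc by simp
    also have "\<dots> \<in> \<real>\<^sub>\<ge>\<^sub>0"
      unfolding fps_mult_nth using less Suc
      by (intro nonneg_Reals_add_I nonneg_Reals_sum nonneg_Reals_mult_I) auto
    finally have 2: "fps_nth tan_fps n \<in> \<real>\<^sub>\<ge>\<^sub>0" by (rule *)
    show ?thesis using 1 2 ..
  qed
qed

definition fps_of_real :: "real fps \<Rightarrow> complex fps" where
  "fps_of_real f = Abs_fps (\<lambda>n. of_real (fps_nth f n))"

lemma fps_of_real_simps:
  "fps_of_real (f + g) = fps_of_real f + fps_of_real g"
  "fps_of_real (f - g) = fps_of_real f - fps_of_real g"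
  "fps_of_real (f * g) = fps_of_real f * fps_of_real g"
  "fps_of_real (fps_exp c) = fps_exp (of_real c)"
  "fps_of_real 1 = 1" "fps_of_real (fps_const c) = fps_const (of_real c)" "fps_of_real fps_X = fps_X"
  by (rule fps_ext; simp add: fps_of_real_def fps_mult_nth)+

lemma fps_compose_linear_mult:
  fixes f g :: "complex fps"
  shows "(f * g) oo (fps_const c * fps_X) = (f oo (fps_const c * fps_X)) * (g oo (fps_const c * fps_X))"
  by (rule fps_compose_mult_distrib) simp

lemma cos_fps_eq: "fps_cos 1 = fps_const (1 / 2) * (fps_exp \<i> + fps_exp (- \<i>))"
  unfolding fps_cos_fps_exp_ii by (simp add: fps_divide_unit fps_const_inverse field_simps)

lemma sin_fps_eq: "fps_sin 1 = fps_const (1 / (2 * \<i>)) * (fps_exp \<i> - fps_exp (- \<i>))"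
  unfolding fps_sin_fps_exp_ii by (simp add: fps_divide_unit fps_const_inverse field_simps)

text \<open>Substituting \<open>\<i> t\<close> for \<open>t\<close> in
  \<open>2 e^t / (e^(2t) + 1)\<close> gives \<open>1 / cos t\<close>.\<close>

lemma sec_fps_nth: "fps_nth sec_fps n = \<i> ^ n * of_real (euler_num n) / fact n"
proof -
  define E where "E = fps_of_real (Abs_fps (\<lambda>n. euler_num n / fact n))"
  define Ei where "Ei = E oo (fps_const \<i> * fps_X)"
  have "E * (fps_exp 2 + 1) = fps_const 2 * fps_exp 1"
    using arg_cong[OF euler_num_egf, of fps_of_real] unfolding numeral_fps_const
    by (simp add: fps_of_real_simps E_def)
  from arg_cong[OF this, of "\<lambda>f. f oo (fps_const \<i> * fps_X)"]
  have "Ei * (fps_exp (2 * \<i>) + 1) = fps_const 2 * fps_exp \<i>"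
    unfolding fps_compose_linear_mult fps_compose_add_distrib Ei_def
    by (simp add: mult.commute[of \<i> 2])
  then have "Ei * (fps_exp (2 * \<i>) + 1) * fps_exp (- \<i>) = fps_const 2 * fps_exp \<i> * fps_exp (- \<i>)"
    by simp
  then have "Ei * (fps_exp \<i> + fps_exp (- \<i>)) = fps_const 2"
    by (simp add: algebra_simps flip: fps_exp_add_mult)
  then have "Ei * fps_cos 1 = 1"
    unfolding cos_fps_eq by (simp only: mult.left_commute[of Ei]) simp
  note Ei_cos = this
  have "Ei = Ei * (sec_fps * fps_cos 1)"
    unfolding sec_fps_cos by simp
  also have "\<dots> = (Ei * fps_cos 1) * sec_fps"
    by (simp only: mult_ac)
  finally have "Ei = sec_fps"
    unfolding Ei_cos by simp
  then have "fps_nth sec_fps n = fps_nth (E oo (fps_const \<i> * fps_X)) n"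
    by (simp add: Ei_def)
  then show ?thesis
    by (simp add: E_def fps_of_real_def)
qed

lemma sec_derivative: "fps_diff sec_fps (2 * k) = of_real \<bar>euler_num (2 * k)\<bar>"
proof -
  have "fps_nth sec_fps (2 * k) = of_real ((-1) ^ k * euler_num (2 * k) / fact (2 * k))"
    unfolding sec_fps_nth imaginary_unit_power_even by simp
  moreover from this have "0 \<le> (-1) ^ k * euler_num (2 * k) / fact (2 * k)"
    using sec_tan_nonneg[of "2 * k"] by (simp only: nonneg_Reals_of_real_iff)
  then have "0 \<le> (-1) ^ k * euler_num (2 * k) / fact (2 * k) * fact (2 * k)"
    by (rule mult_nonneg_nonneg) simp
  then have "0 \<le> (-1) ^ k * euler_num (2 * k)"
    by simp
  then have "(-1) ^ k * euler_num (2 * k) = \<bar>euler_num (2 * k)\<bar>"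
    by (cases "even k") auto
  ultimately show ?thesis
    by (simp add: fps_diff_def)
qed

lemma tan_fps_exp: "tan_fps * (fps_exp (2 * \<i>) + 1) = - (fps_const \<i> * (fps_exp (2 * \<i>) - 1))"
proof -
  have "tan_fps * fps_cos 1 = sec_fps * fps_cos 1 * fps_sin 1"
    by (simp add: tan_fps_def mult_ac)
  then have "tan_fps * fps_cos 1 = fps_sin 1"
    by (simp add: sec_fps_cos)
  then have "fps_const (2 * \<i>) * fps_exp \<i> * (tan_fps * fps_cos 1) = fps_const (2 * \<i>) * fps_exp \<i> * fps_sin 1"
    by simp
  moreover have "fps_const (2 * \<i>) * fps_exp \<i> * (tan_fps * fps_cos 1) = fps_const \<i> * (tan_fps * (fps_exp (2 * \<i>) + 1))"
  proof -
    have "fps_const (2 * \<i>) * fps_exp \<i> * (tan_fps * fps_cos 1) =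
        (fps_const (2 * \<i>) * fps_const (1 / 2)) * (tan_fps * (fps_exp \<i> * (fps_exp \<i> + fps_exp (- \<i>))))"
      unfolding cos_fps_eq by (simp only: mult_ac)
    then show ?thesis
      by (simp add: distrib_left flip: fps_exp_add_mult)
  qed
  moreover have "fps_const (2 * \<i>) * fps_exp \<i> * fps_sin 1 = fps_exp (2 * \<i>) - 1"
  proof -
    have "fps_const (2 * \<i>) * fps_exp \<i> * fps_sin 1 =
        (fps_const (2 * \<i>) * fps_const (1 / (2 * \<i>))) * (fps_exp \<i> * (fps_exp \<i> - fps_exp (- \<i>)))"
      unfolding sin_fps_eq by (simp only: mult_ac)
    then show ?thesis
      by (simp add: right_diff_distrib flip: fps_exp_add_mult)
  qed
  ultimately have "fps_const \<i> * (tan_fps * (fps_exp (2 * \<i>) + 1)) = fps_exp (2 * \<i>) - 1"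
    by simp
  then have "fps_const \<i> * (fps_const \<i> * (tan_fps * (fps_exp (2 * \<i>) + 1))) = fps_const \<i> * (fps_exp (2 * \<i>) - 1)"
    by simp
  then have "- (tan_fps * (fps_exp (2 * \<i>) + 1)) = fps_const \<i> * (fps_exp (2 * \<i>) - 1)"
    unfolding mult.assoc[of "fps_const \<i>" "fps_const \<i>", symmetric] fps_const_mult i_squared
    by (simp flip: fps_const_neg)
  from arg_cong[OF this, of uminus] show ?thesis by (simp only: minus_minus)
qed

lemma bernoulli_exp:
  "Abs_fps (\<lambda>n. c ^ n * of_real (bernoulli_num n) / fact n) * (fps_exp c - 1) = fps_const c * (fps_X :: complex fps)"
proof -
  define B where "B = fps_of_real (Abs_fps (\<lambda>n. bernoulli_num n / fact n))"
  have "B * (fps_exp 1 - 1) = fps_X"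
    using arg_cong[OF bernoulli_num_egf, of fps_of_real] by (simp add: fps_of_real_simps B_def)
  from arg_cong[OF this, of "\<lambda>f. f oo (fps_const c * fps_X)"]
  have "(B oo (fps_const c * fps_X)) * (fps_exp c - 1) = fps_const c * fps_X"
    unfolding fps_compose_linear_mult fps_compose_sub_distrib by simp
  moreover have "B oo (fps_const c * fps_X) = Abs_fps (\<lambda>n. c ^ n * of_real (bernoulli_num n) / fact n)"
    by (simp add: fps_compose_linear B_def fps_of_real_def)
  ultimately show ?thesis by simp
qed

text \<open>Partial fractions in \<open>y = exp (2 \<i> x)\<close>:
  \<open>tan x = - \<i> + 2 \<i> / (y - 1) - 4 \<i> / (y^2 - 1)\<close>. After multiplication by
  \<open>x\<close> the two fractions are Bernoulli generating functions at \<open>2 \<i> x\<close>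
  and \<open>4 \<i> x\<close>.\<close>

lemma X_tan_fps:
  "fps_X * tan_fps = Abs_fps (\<lambda>n. (2 * \<i>) ^ n * of_real (bernoulli_num n) / fact n)
    - Abs_fps (\<lambda>n. (4 * \<i>) ^ n * of_real (bernoulli_num n) / fact n) - fps_const \<i> * fps_X"
    (is "_ = ?B2 - ?B4 - _")
proof -
  define y where "y = fps_exp (2 * \<i>)"
  have y4: "fps_exp (4 * \<i>) = y * y"
    by (simp add: y_def flip: fps_exp_add_mult)
  have t: "tan_fps * (y + 1) = - (fps_const \<i> * (y - 1))"
    unfolding y_def by (rule tan_fps_exp)
  have B2: "?B2 * (y - 1) = fps_const (2 * \<i>) * fps_X"
    unfolding y_def by (rule bernoulli_exp)
  have B4: "?B4 * (y * y - 1) = fps_const (4 * \<i>) * fps_X"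
    unfolding y4[symmetric] by (rule bernoulli_exp)
  have c: "fps_const (2 * \<i>) = 2 * fps_const \<i>" "fps_const (4 * \<i>) = 4 * fps_const \<i>"
    by (simp_all flip: fps_const_mult add: numeral_fps_const)
  \<comment> \<open>Denominators are cleared because \<open>y - 1\<close> is not a unit; power
    series form a domain, so the factor cancels at the end.\<close>
  have "(fps_X * tan_fps) * ((y + 1) * (y - 1)) = fps_X * (y - 1) * (tan_fps * (y + 1))"
    by (simp only: mult_ac)
  also have "\<dots> = - (fps_const \<i> * fps_X * ((y - 1) * (y - 1)))"
    unfolding t by (simp add: mult_ac)
  also have "\<dots> = (y + 1) * (fps_const (2 * \<i>) * fps_X) - fps_const (4 * \<i>) * fps_X - fps_const \<i> * fps_X * ((y + 1) * (y - 1))"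
    unfolding c by (simp add: algebra_simps)
  also have "\<dots> = (?B2 - ?B4 - fps_const \<i> * fps_X) * ((y + 1) * (y - 1))"
    unfolding B2[symmetric] B4[symmetric] by (simp add: algebra_simps)
  finally have "(fps_X * tan_fps) * ((y + 1) * (y - 1)) = (?B2 - ?B4 - fps_const \<i> * fps_X) * ((y + 1) * (y - 1))" .
  moreover have "(y + 1) * (y - 1) \<noteq> 0"
  proof -
    have "fps_nth (y + 1) 0 \<noteq> fps_nth 0 0" "fps_nth (y - 1) 1 \<noteq> fps_nth 0 1"
      by (simp_all add: y_def)
    then have "y + 1 \<noteq> 0" "y - 1 \<noteq> 0"
      by (auto simp only:)
    then show ?thesis by simp
  qed
  ultimately show ?thesis by simp
qed

lemma tan_derivative:
  "fps_diff tan_fps (2 * k + 1) =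
    of_real (4 ^ (k + 1) * (4 ^ (k + 1) - 1) / (2 * (real k + 1)) * \<bar>bernoulli_num (2 * k + 2)\<bar>)"
proof -
  define m where "m = k + 1"
  \<comment> \<open>The Taylor coefficient with its sign written out; comparison with
    \<open>sec_tan_nonneg\<close> then shows that \<open>(-1)^k\<close> times the Bernoulli number
    is nonnegative.\<close>
  define t :: real where "t = (-1) ^ k * (4 ^ m * (4 ^ m - 1)) * bernoulli_num (2 * m) / fact (2 * m)"
  have p: "(2 * \<i>) ^ (2 * m) = (-1) ^ m * 4 ^ m" "(4 * \<i>) ^ (2 * m) = (-1) ^ m * (4 ^ m * 4 ^ m)"
    by (simp_all add: power_mult flip: power_mult_distrib)
  have m1: "(-1 :: complex) ^ m = - ((-1) ^ k)"
    by (simp add: m_def)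
  have "fps_nth tan_fps (2 * k + 1) = fps_nth (fps_X * tan_fps) (2 * m)"
    by (simp add: m_def)
  also have "\<dots> = of_real t"
    unfolding X_tan_fps fps_sub_nth fps_nth_Abs_fps p t_def
    by (simp add: m1 diff_divide_distrib right_diff_distrib left_diff_distrib mult_ac)
  finally have *: "fps_nth tan_fps (2 * k + 1) = of_real t" .
  then have "0 \<le> t"
    using sec_tan_nonneg[of "2 * k + 1"] by (simp only: nonneg_Reals_of_real_iff)
  moreover have "t = ((-1) ^ k * bernoulli_num (2 * m)) * (4 ^ m * (4 ^ m - 1) / fact (2 * m))"
    by (simp add: t_def)
  moreover have "1 < (4 :: real) ^ m"
    unfolding m_def by (rule one_less_power) simp_all
  then have "0 < 4 ^ m * (4 ^ m - 1) / (fact (2 * m) :: real)"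
    by (intro divide_pos_pos mult_pos_pos) simp_all
  moreover have "0 \<le> x" if "0 \<le> s" "s = x * w" "0 < w" for s x w :: real
    using that by (simp add: zero_le_mult_iff)
  note this[of t "(-1) ^ k * bernoulli_num (2 * m)" "4 ^ m * (4 ^ m - 1) / fact (2 * m)"]
  ultimately have "0 \<le> (-1) ^ k * bernoulli_num (2 * m)"
    by (simp only: simp_thms)
  then have b: "(-1) ^ k * bernoulli_num (2 * m) = \<bar>bernoulli_num (2 * m)\<bar>"
    by (cases "even k") auto
  have f: "fact (2 * m) = 2 * (real k + 1) * fact (2 * k + 1)"
    by (simp add: m_def algebra_simps)
  have "fact (2 * k + 1) * t = 4 ^ m * (4 ^ m - 1) / (2 * (real k + 1)) * ((-1) ^ k * bernoulli_num (2 * m))"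
    unfolding t_def f by (simp del: fact_Suc)
  then have "fact (2 * k + 1) * t = 4 ^ (k + 1) * (4 ^ (k + 1) - 1) / (2 * (real k + 1)) * \<bar>bernoulli_num (2 * k + 2)\<bar>"
    unfolding b by (simp only: m_def) (simp only: distrib_left mult_1_right)
  moreover have "fps_diff tan_fps (2 * k + 1) = of_real (fact (2 * k + 1) * t)"
    by (simp only: fps_diff_def * of_real_mult of_real_fact)
  ultimately show ?thesis by (simp only:)
qed

lemma has_fps_expansion_sec: "(\<lambda>v. 1 / cos v) has_fps_expansion sec_fps"
  unfolding sec_fps_def using has_fps_expansion_inverse[OF has_fps_expansion_cos']
  by (simp add: inverse_eq_divide)

lemma has_fps_expansion_tan_fps: "tan has_fps_expansion tan_fps"
  unfolding tan_fps_def tan_def[abs_def]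
  using has_fps_expansion_mult[OF has_fps_expansion_sec has_fps_expansion_sin'] by simp

section \<open>Determinants of Lambert series\<close>

definition tri :: "nat \<Rightarrow> nat" where "tri n = (\<Sum>m<n. m)"

lemma fps_diff_fps_expansion: "fps_diff (fps_expansion f 0) k = (deriv ^^ k) f 0" for f :: "complex \<Rightarrow> complex"
  by (simp add: fps_diff_def fps_expansion_def)

lemma fourier_has_fps_expansion:
  assumes "strip_summable b c" "b > 0"
  shows "fourier c has_fps_expansion fps_expansion (fourier c) 0"
  by (rule has_fps_expansion_fps_expansion[OF open_strip _ fourier_holomorphic[OF assms(1)]]) (simp add: assms(2))

lemma fps_expansion_eq: "f has_fps_expansion F \<Longrightarrow> fps_expansion f 0 = F" for f :: "complex \<Rightarrow> complex"
  using fps_expansion_unique_complex has_fps_expansion_fps_expansion has_fps_expansion_imp_holomorphic by metis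

lemma has_fps_expansion_transfer:
  "f has_fps_expansion F \<Longrightarrow> eventually (\<lambda>w. f w = g w) (nhds 0) \<Longrightarrow> g has_fps_expansion F"
  for f g :: "complex \<Rightarrow> complex"
  using has_fps_expansion_cong[OF _ refl] by (rule iffD1)

lemma has_fps_expansion_sec_sqr: "(\<lambda>v :: complex. 1 / cos v ^ 2) has_fps_expansion fps_deriv tan_fps"
proof -
  have "eventually (\<lambda>v :: complex. v \<in> ball 0 1) (nhds 0)"
    by (intro eventually_nhds_in_open) auto
  then have "eventually (\<lambda>v :: complex. deriv tan v = 1 / cos v ^ 2) (nhds 0)"
  proof eventually_elim
    case (elim v)
    then have "cos v \<noteq> 0" by (intro cos_nonzero) simp
    from DERIV_imp_deriv[OF DERIV_tan[OF this]] show ?case by (simp add: inverse_eq_divide)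
  qed
  then show ?thesis
    by (rule has_fps_expansion_transfer[OF has_fps_expansion_deriv[OF has_fps_expansion_tan_fps]])
qed

lemma fps_diff_uminus: "fps_diff (- f) k = - fps_diff f k"
  by (simp add: fps_diff_def)

lemma fps_diff_const: "fps_diff (fps_const x) (Suc k) = 0"
  by (simp add: fps_diff_def)

lemma minus_one_power_cancel: "(-1) ^ i * ((-1) ^ i * x) = (x :: complex)"
  by (simp flip: mult.assoc power_mult_distrib)

text \<open>The factor \<open>8 * (-4)^i\<close> is the one in front of \<open>clambert_U\<close> in
  the derivatives of \<open>TT\<close>; with it the tangent number and the Lambert series combine
  into one entry.\<close>

lemma beta_seq_eq:
  "8 * (-4) ^ i * beta_seq (i + 1) =
    4 ^ (i + 1) * (4 ^ (i + 1) - 1) / (2 * (real i + 1)) * \<bar>bernoulli_num (2 * i + 2)\<bar>"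
proof -
  define u :: real where "u = 4 ^ (i + 1)"
  have "beta_seq (i + 1) = (-1) ^ i * ((u - 1) / (4 * (real i + 1)) * \<bar>bernoulli_num (2 * i + 2)\<bar>)"
    by (simp add: beta_seq_def power_mult u_def add.commute)
  then have "8 * (-4) ^ i * beta_seq (i + 1) =
      8 * ((-4) ^ i * (-1) ^ i) * ((u - 1) / (4 * (real i + 1)) * \<bar>bernoulli_num (2 * i + 2)\<bar>)"
    by (simp only: mult_ac)
  also have "8 * ((-4) ^ i * (-1) ^ i) = 2 * u"
    by (simp add: u_def flip: power_mult_distrib)
  also have "2 * u * ((u - 1) / (4 * w) * x) = u * (u - 1) / (2 * w) * x" for w x :: real
    by simp
  finally show ?thesis by (simp only: u_def)
qed

lemma beta'_seq_eq: "beta'_seq (i + 1) = beta_seq (i + 1 + 1)"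
  by (simp add: beta'_seq_def beta_seq_def numeral_eq_Suc algebra_simps)

context nome
begin

section \<open>Derivatives at the half period\<close>

lemma two_b_pos: "2 * b > 0"
  using b_pos by simp

lemma fps_diff_G: "fps_diff (fps_expansion GG 0) (2 * k) = of_real \<bar>euler_num (2 * k)\<bar> - 4 * (-1) ^ k * clambert_R (2 * k) q"
proof -
  have "(\<lambda>i. 2 * \<i> ^ (2 * k) * (of_nat (2 * i + 1) ^ (2 * k) * coeff_G q (int (2 * i + 1)))) sums (deriv ^^ (2 * k)) (fourier (coeff_G q)) 0"
    by (rule higher_deriv_fourier_odd[OF strip_summable_G two_b_pos]) (auto simp: coeff_G_def)
  also have "(\<lambda>i. 2 * \<i> ^ (2 * k) * (of_nat (2 * i + 1) ^ (2 * k) * coeff_G q (int (2 * i + 1)))) =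
      (\<lambda>i. - 4 * (-1) ^ k * ((-1) ^ i * (of_nat (2 * i + 1) ^ (2 * k) * q ^ (2 * i + 1) / (1 + q ^ (2 * i + 1)))))"
  proof
    fix i
    have n: "nat \<bar>int (2 * i + 1)\<bar> = 2 * i + 1" "2 * i + 1 - 1 = 2 * i" "odd (int (2 * i + 1))" by simp_all
    show "2 * \<i> ^ (2 * k) * (of_nat (2 * i + 1) ^ (2 * k) * coeff_G q (int (2 * i + 1))) =
        - 4 * (-1) ^ k * ((-1) ^ i * (of_nat (2 * i + 1) ^ (2 * k) * q ^ (2 * i + 1) / (1 + q ^ (2 * i + 1))))"
      unfolding coeff_G_def n imaginary_unit_power_even if_P[OF n(3)] by simp
  qed
  finally have "(deriv ^^ (2 * k)) (fourier (coeff_G q)) 0 = - 4 * (-1) ^ k * clambert_R (2 * k) q"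
    unfolding clambert_R_def by (rule sums_cmult_suminf) simp
  moreover have "fps_expansion GG 0 = sec_fps + fps_expansion (fourier (coeff_G q)) 0"
    unfolding GG_def[abs_def]
    by (intro fps_expansion_eq has_fps_expansion_add has_fps_expansion_sec fourier_has_fps_expansion[OF strip_summable_G two_b_pos])
  ultimately show ?thesis
    by (simp add: fps_diff_add sec_derivative fps_diff_fps_expansion)
qed

text \<open>\<open>HH\<close> enters the determinants through its value at 0. As odd powers occur,
  \<open>1 - q^m\<close> is \<open>1 + (- q)^m\<close>, and the series \<open>R\<close> serves for
  \<open>HH\<close> as well as for \<open>GG\<close>.\<close>

lemma HH_0: "HH 0 = 1 - 4 * clambert_R 0 (- q)"
proof -
  have "(\<lambda>i. 2 * \<i> ^ 0 * (of_nat (2 * i + 1) ^ 0 * coeff_H q (int (2 * i + 1)))) sums (deriv ^^ 0) (fourier (coeff_H q)) 0"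
    by (rule higher_deriv_fourier_odd[OF strip_summable_H two_b_pos]) (auto simp: coeff_H_def)
  also have "(\<lambda>i. 2 * \<i> ^ 0 * (of_nat (2 * i + 1) ^ 0 * coeff_H q (int (2 * i + 1)))) =
      (\<lambda>i. - 4 * ((-1) ^ i * (of_nat (2 * i + 1) ^ 0 * (- q) ^ (2 * i + 1) / (1 + (- q) ^ (2 * i + 1)))))"
  proof
    fix i
    have n: "nat \<bar>int (2 * i + 1)\<bar> = 2 * i + 1" "2 * i + 1 - 1 = 2 * i" "odd (int (2 * i + 1))" by simp_all
    show "2 * \<i> ^ 0 * (of_nat (2 * i + 1) ^ 0 * coeff_H q (int (2 * i + 1))) =
        - 4 * ((-1) ^ i * (of_nat (2 * i + 1) ^ 0 * (- q) ^ (2 * i + 1) / (1 + (- q) ^ (2 * i + 1))))"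
      unfolding coeff_H_def n imaginary_unit_power_even if_P[OF n(3)] by simp
  qed
  finally have "(deriv ^^ 0) (fourier (coeff_H q)) 0 = - 4 * clambert_R 0 (- q)"
    unfolding clambert_R_def by (rule sums_cmult_suminf) simp
  then show ?thesis by (simp add: HH_def)
qed

text \<open>Only even frequencies occur in \<open>TT\<close>, so the Lambert series is one in
  \<open>q^2\<close>, the fourth power of \<open>Q\<close>.\<close>

lemma fps_diff_T:
  "fps_diff (fps_expansion TT 0) (2 * k + 1) = fps_diff tan_fps (2 * k + 1) - 8 * (-4) ^ k * clambert_U (2 * k + 1) (q ^ 2)"
proof -
  have "(\<lambda>i. 2 * \<i> ^ (2 * k + 1) * (of_nat (2 * Suc i) ^ (2 * k + 1) * coeff_T q (int (2 * Suc i)))) sums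
      ((deriv ^^ (2 * k + 1)) (fourier (coeff_T q)) 0 - (if 2 * k + 1 = 0 then coeff_T q 0 else 0))"
    by (rule higher_deriv_fourier_even[OF strip_summable_T two_b_pos]) (auto simp: coeff_T_def)
  also have "(\<lambda>i. 2 * \<i> ^ (2 * k + 1) * (of_nat (2 * Suc i) ^ (2 * k + 1) * coeff_T q (int (2 * Suc i)))) =
      (\<lambda>i. - 8 * (-4) ^ k * ((-1) ^ i * (of_nat (Suc i) ^ (2 * k + 1) * (q ^ 2) ^ Suc i / (1 + (q ^ 2) ^ Suc i))))"
  proof
    fix i
    have "2 * \<i> ^ (2 * k + 1) * (of_nat (2 * n) ^ (2 * k + 1) * coeff_T q (int (2 * n))) =
        8 * (-4) ^ k * ((-1) ^ n * (of_nat n ^ (2 * k + 1) * (q ^ 2) ^ n / (1 + (q ^ 2) ^ n)))" if "n > 0" for n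
    proof -
      have n: "nat \<bar>int (2 * n)\<bar> = 2 * n" "even (int (2 * n))" "sgn (int (2 * n)) = 1" using that by simp_all
      have "\<i> ^ (2 * k + 1) = (-1) ^ k * \<i>" by (simp add: power_mult)
      then show ?thesis
        unfolding coeff_T_def n if_P[OF n(2)] imaginary_unit_power_even power_mult[symmetric] minus_4_power
        by (simp add: power_mult_distrib mult_ac imaginary_unit_mult)
    qed
    from this[of "Suc i"] show "2 * \<i> ^ (2 * k + 1) * (of_nat (2 * Suc i) ^ (2 * k + 1) * coeff_T q (int (2 * Suc i))) =
        - 8 * (-4) ^ k * ((-1) ^ i * (of_nat (Suc i) ^ (2 * k + 1) * (q ^ 2) ^ Suc i / (1 + (q ^ 2) ^ Suc i)))"
      by (simp only: zero_less_Suc power_Suc[of "-1" i]) simp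
  qed
  finally have "(deriv ^^ (2 * k + 1)) (fourier (coeff_T q)) 0 - (if 2 * k + 1 = 0 then coeff_T q 0 else 0) =
      - 8 * (-4) ^ k * clambert_U (2 * k + 1) (q ^ 2)"
    unfolding clambert_U_def by (rule sums_cmult_suminf) simp
  moreover have "fps_expansion TT 0 = tan_fps + fps_expansion (fourier (coeff_T q)) 0"
    unfolding TT_def[abs_def]
    by (intro fps_expansion_eq has_fps_expansion_add has_fps_expansion_tan_fps fourier_has_fps_expansion[OF strip_summable_T two_b_pos])
  ultimately show ?thesis
    by (simp add: fps_diff_add fps_diff_fps_expansion)
qed

lemma fps_diff_E:
  "fps_diff (fps_expansion EE 0) (2 * k + 2) =
    fps_diff tan_fps (2 * k + 3) - 8 * (-4) ^ (k + 1) * clambert_G (2 * k + 3) (q ^ 2)"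
proof -
  define K where "K = k + 1"
  have "(\<lambda>i. 2 * \<i> ^ (2 * K) * (of_nat (2 * Suc i) ^ (2 * K) * coeff_E q (int (2 * Suc i)))) sums
      ((deriv ^^ (2 * K)) (fourier (coeff_E q)) 0 - (if 2 * K = 0 then coeff_E q 0 else 0))"
    by (rule higher_deriv_fourier_even[OF strip_summable_E two_b_pos]) (auto simp: coeff_E_def)
  also have "(\<lambda>i. 2 * \<i> ^ (2 * K) * (of_nat (2 * Suc i) ^ (2 * K) * coeff_E q (int (2 * Suc i)))) =
      (\<lambda>i. - 8 * (-4) ^ K * ((-1) ^ Suc i * (of_nat (Suc i) ^ (2 * K + 1) * (q ^ 2) ^ Suc i / (1 - (q ^ 2) ^ Suc i))))"
  proof
    fix i
    have "2 * \<i> ^ (2 * K) * (of_nat (2 * n) ^ (2 * K) * coeff_E q (int (2 * n))) =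
        - 8 * (-4) ^ K * ((-1) ^ n * (of_nat n ^ (2 * K + 1) * (q ^ 2) ^ n / (1 - (q ^ 2) ^ n)))" for n
    proof -
      have n: "nat \<bar>int (2 * n)\<bar> = 2 * n" "even (int (2 * n))" "\<bar>int (2 * n)\<bar> = int (2 * n)" by simp_all
      show ?thesis
        unfolding coeff_E_def n(1) if_P[OF n(2)] imaginary_unit_power_even power_mult[symmetric] minus_4_power
        by (simp add: power_mult_distrib mult_ac)
    qed
    then show "2 * \<i> ^ (2 * K) * (of_nat (2 * Suc i) ^ (2 * K) * coeff_E q (int (2 * Suc i))) =
        - 8 * (-4) ^ K * ((-1) ^ Suc i * (of_nat (Suc i) ^ (2 * K + 1) * (q ^ 2) ^ Suc i / (1 - (q ^ 2) ^ Suc i)))" .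
  qed
  finally have "(deriv ^^ (2 * K)) (fourier (coeff_E q)) 0 - (if 2 * K = 0 then coeff_E q 0 else 0) =
      - 8 * (-4) ^ K * clambert_G (2 * K + 1) (q ^ 2)"
    unfolding clambert_G_def by (rule sums_cmult_suminf) simp
  then have "(deriv ^^ (2 * k + 2)) (fourier (coeff_E q)) 0 = - 8 * (-4) ^ (k + 1) * clambert_G (2 * k + 3) (q ^ 2)"
    by (simp add: K_def numeral_eq_Suc)
  moreover have "fps_expansion EE 0 = fps_deriv tan_fps + fps_expansion (fourier (coeff_E q)) 0"
    unfolding EE_def[abs_def]
    by (intro fps_expansion_eq has_fps_expansion_add has_fps_expansion_sec_sqr fourier_has_fps_expansion[OF strip_summable_E two_b_pos])
  moreover have "fps_diff (fps_deriv tan_fps) (2 * k + 2) = fps_diff tan_fps (2 * k + 3)"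
    using fps_diff_Suc[of tan_fps "2 * k + 2"] by (simp add: numeral_eq_Suc)
  ultimately show ?thesis
    by (simp add: fps_diff_add fps_diff_fps_expansion)
qed

text \<open>Obtained through \<open>CC^2\<close>, whose Fourier coefficients are known, and the
  first integral \<open>CC^2 + SS^2\<close>; the unknown constant disappears under
  differentiation.\<close>

lemma fps_diff_SS_sqr:
  "fps_diff (fps_expansion SS 0 * fps_expansion SS 0) (2 * k + 2) = - 8 * (-4) ^ (k + 1) * clambert_D (2 * k + 3) q"
proof -
  obtain K where K: "\<forall>w. \<bar>Im w\<bar> < b \<longrightarrow> CC w * CC w = K + fourier coeff_CC w"
    using CC_sqr by (rule exE)
  have CC: "CC has_fps_expansion fps_expansion CC 0"
    unfolding CC_def by (rule fourier_has_fps_expansion[OF strip_summable_C b_pos])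
  have "(\<lambda>w. K + fourier coeff_CC w) has_fps_expansion fps_const K + fps_expansion (fourier coeff_CC) 0"
    by (intro has_fps_expansion_add has_fps_expansion_const fourier_has_fps_expansion[OF strip_summable_coeff_CC b_pos])
  moreover have "eventually (\<lambda>w. K + fourier coeff_CC w = CC w * CC w) (nhds 0)"
    using eventually_nhds_in_open[OF open_strip, of 0 b] b_pos by (auto elim!: eventually_mono simp: K)
  ultimately have "(\<lambda>w. CC w * CC w) has_fps_expansion fps_const K + fps_expansion (fourier coeff_CC) 0"
    by (rule has_fps_expansion_transfer)
  then have "fps_expansion CC 0 * fps_expansion CC 0 = fps_const K + fps_expansion (fourier coeff_CC) 0"
    using has_fps_expansion_mult[OF CC CC] by (rule fps_expansion_unique_complex[rotated])
  moreover have "fps_expansion SS 0 * fps_expansion SS 0 = fps_const (CC 0 ^ 2) + - (fps_expansion CC 0 * fps_expansion CC 0)"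
    unfolding jacobi_system.C_sqr[OF jacobi_system_SCD] by simp
  ultimately have "fps_expansion SS 0 * fps_expansion SS 0 =
      fps_const (CC 0 ^ 2 - K) + - fps_expansion (fourier coeff_CC) 0"
    by (simp flip: fps_const_sub)
  then have "fps_diff (fps_expansion SS 0 * fps_expansion SS 0) (2 * k + 2) =
      - (deriv ^^ (2 * (k + 1))) (fourier coeff_CC) 0"
    by (simp only: fps_diff_add fps_diff_uminus fps_diff_fps_expansion) (simp add: fps_diff_const)
  moreover have "(deriv ^^ (2 * (k + 1))) (fourier coeff_CC) 0 = 8 * (-4) ^ (k + 1) * clambert_D (2 * (k + 1) + 1) q"
    by (rule higher_deriv_coeff_CC) simp
  moreover have "2 * (k + 1) + 1 = 2 * k + 3" by simp
  ultimately show ?thesis by (simp only: mult_minus_left)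
qed

lemma fps_diff_TT_sqr:
  "fps_diff (fps_expansion (\<lambda>v. - TT v) 0 * fps_expansion (\<lambda>v. - TT v) 0) (2 * k + 2) = fps_diff (fps_expansion EE 0) (2 * k + 2)"
proof -
  obtain K where K: "\<forall>v\<in>Bl. (\<i> * GG v) * (\<i> * GG v) = K - EE v"
    using GG_sqr by (rule exE)
  have GG: "(\<lambda>v. \<i> * GG v) has_fps_expansion fps_expansion (\<lambda>v. \<i> * GG v) 0"
    by (rule has_fps_expansion_fps_expansion[OF Bl(1,2)]) (intro holomorphic_intros holomorphic_Bl)
  have EE: "EE has_fps_expansion fps_expansion EE 0"
    by (rule has_fps_expansion_fps_expansion[OF Bl(1,2) holomorphic_Bl(4)])
  have "(\<lambda>v. K - EE v) has_fps_expansion fps_const K - fps_expansion EE 0"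
    by (intro has_fps_expansion_diff has_fps_expansion_const EE)
  moreover have "eventually (\<lambda>v. K - EE v = (\<i> * GG v) * (\<i> * GG v)) (nhds 0)"
    using eventually_nhds_in_open[OF Bl(1,2)] by eventually_elim (simp add: K)
  ultimately have "(\<lambda>v. (\<i> * GG v) * (\<i> * GG v)) has_fps_expansion fps_const K - fps_expansion EE 0"
    by (rule has_fps_expansion_transfer)
  then have "fps_expansion (\<lambda>v. \<i> * GG v) 0 * fps_expansion (\<lambda>v. \<i> * GG v) 0 = fps_const K - fps_expansion EE 0"
    using has_fps_expansion_mult[OF GG GG] by (rule fps_expansion_unique_complex[rotated])
  then have "fps_expansion (\<lambda>v. - TT v) 0 * fps_expansion (\<lambda>v. - TT v) 0 =
      fps_const ((\<i> * GG 0) ^ 2 - K) + fps_expansion EE 0"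
    unfolding jacobi_system.C_sqr[OF jacobi_system_TGH] by (simp add: algebra_simps flip: fps_const_sub)
  then show ?thesis
    by (simp add: fps_diff_add fps_diff_const)
qed

section \<open>Determinants at a general complex parameter\<close>

lemma hankel_det_scale':
  assumes "\<And>i. f i = x * y ^ i * c i"
  shows "hankel_det n f = x ^ n * y ^ (2 * tri n) * hankel_det n c"
  unfolding assms tri_def by (rule hankel_det_scale)

lemma det_T:
  "4 ^ n * hankel_det n (\<lambda>i. clambert_T (2 * i) Q) = CC 0 ^ n * (CC 0 * DD 0) ^ (2 * tri n) * (\<Prod>m<n. fact (2 * m) ^ 2)"
  using jacobi_system.hankel_det_C[OF jacobi_system_SCD, of n]
    hankel_det_scale'[where x = 4 and y = "-1" and c = "\<lambda>i. clambert_T (2 * i) Q" and n = n and f = "\<lambda>i. (deriv ^^ (2 * i)) CC 0"]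
  by (simp add: fps_diff_fps_expansion higher_deriv_CC tri_def)

lemma det_T2:
  "4 ^ n * hankel_det n (\<lambda>i. clambert_T (2 * i + 2) Q) =
    (CC 0 * DD 0 ^ 2) ^ n * (CC 0 * DD 0) ^ (2 * tri n) * (\<Prod>m<n. fact (2 * m + 1) ^ 2)"
proof -
  have "fps_diff (fps_expansion CC 0) (2 * i + 2) = (- 4) * (-1) ^ i * clambert_T (2 * i + 2) Q" for i
    using higher_deriv_CC[of "i + 1"] by (simp only: fps_diff_fps_expansion distrib_left mult_1_right) simp
  from hankel_det_scale'[where f = "\<lambda>i. fps_diff (fps_expansion CC 0) (2 * i + 2)", OF this, of n]
  have "(- 1) ^ n * (4 ^ n * hankel_det n (\<lambda>i. clambert_T (2 * i + 2) Q)) =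
      (- 1) ^ n * ((CC 0 * DD 0 ^ 2) ^ n * (CC 0 * DD 0) ^ (2 * tri n) * (\<Prod>m<n. fact (2 * m + 1) ^ 2))"
    unfolding jacobi_system.hankel_det_C2[OF jacobi_system_SCD] power_minus[of 4] by (simp add: tri_def mult_ac)
  then show ?thesis by simp
qed

lemma det_C:
  "4 ^ n * hankel_det n (\<lambda>i. clambert_C (2 * i + 1) Q) =
    (CC 0 * DD 0) ^ (n + 2 * tri n) * (\<Prod>m<n. fact (2 * m) * fact (2 * m + 1))"
proof -
  have "fps_diff (fps_expansion SS 0) (2 * i + 1) = 4 * (-1) ^ i * clambert_C (2 * i + 1) Q" for i
    unfolding fps_diff_fps_expansion by (rule higher_deriv_SS)
  from hankel_det_scale'[where f = "\<lambda>i. fps_diff (fps_expansion SS 0) (2 * i + 1)", OF this, of n]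
  show ?thesis
    unfolding jacobi_system.hankel_det_S[OF jacobi_system_SCD] by (simp add: tri_def)
qed

text \<open>The correction \<open>1 / 4\<close> is the mean value 1 of \<open>DD\<close> divided by
  the scale factor 4.\<close>

lemma det_N:
  "4 ^ n * 4 ^ (2 * tri n) * hankel_det n (\<lambda>i. (if i = 0 then 1 / 4 else 0) + clambert_N (2 * i) q) =
    DD 0 ^ n * (CC 0 * DD 0) ^ (2 * tri n) * (\<Prod>m<n. fact (2 * m) ^ 2)"
proof -
  have "fps_diff (fps_expansion DD 0) (2 * i) = 4 * (-4) ^ i * ((if i = 0 then 1 / 4 else 0) + clambert_N (2 * i) q)" for i
    unfolding fps_diff_fps_expansion higher_deriv_DD by simp
  from hankel_det_scale'[where f = "\<lambda>i. fps_diff (fps_expansion DD 0) (2 * i)", OF this, of n]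
  show ?thesis
    unfolding jacobi_system.hankel_det_C[OF jacobi_system.swap[OF jacobi_system_SCD]] by (simp add: tri_def mult.commute)
qed

lemma det_N2:
  "16 ^ n * 4 ^ (2 * tri n) * hankel_det n (\<lambda>i. clambert_N (2 * i + 2) q) =
    (DD 0 * CC 0 ^ 2) ^ n * (CC 0 * DD 0) ^ (2 * tri n) * (\<Prod>m<n. fact (2 * m + 1) ^ 2)"
proof -
  have "fps_diff (fps_expansion DD 0) (2 * i + 2) = (- 16) * (-4) ^ i * clambert_N (2 * i + 2) q" for i
    using higher_deriv_DD[of "i + 1"] by (simp only: fps_diff_fps_expansion distrib_left mult_1_right) simp
  from hankel_det_scale'[where f = "\<lambda>i. fps_diff (fps_expansion DD 0) (2 * i + 2)", OF this, of n]
  have "(- 1) ^ n * (16 ^ n * 4 ^ (2 * tri n) * hankel_det n (\<lambda>i. clambert_N (2 * i + 2) q)) =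
      (- 1) ^ n * ((DD 0 * CC 0 ^ 2) ^ n * (CC 0 * DD 0) ^ (2 * tri n) * (\<Prod>m<n. fact (2 * m + 1) ^ 2))"
    unfolding jacobi_system.hankel_det_C2[OF jacobi_system.swap[OF jacobi_system_SCD]] power_minus[of 16]
    by (simp add: tri_def mult_ac)
  then show ?thesis by simp
qed

lemma det_D:
  "32 ^ n * 4 ^ (2 * tri n) * hankel_det n (\<lambda>i. clambert_D (2 * i + 3) q) =
    (CC 0 * DD 0) ^ (2 * n + 2 * tri n) * (\<Prod>m<n. fact (2 * m + 1) * fact (2 * m + 2))"
proof -
  have "fps_diff (fps_expansion SS 0 * fps_expansion SS 0) (2 * i + 2) = 32 * (-4) ^ i * clambert_D (2 * i + 3) q" for i
    unfolding fps_diff_SS_sqr by simp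
  from hankel_det_scale'[where f = "\<lambda>i. fps_diff (fps_expansion SS 0 * fps_expansion SS 0) (2 * i + 2)", OF this, of n]
  show ?thesis
    unfolding jacobi_system.hankel_det_S_sqr[OF jacobi_system_SCD] by (simp add: tri_def)
qed

lemma fps_expansion_cmult_GG: "fps_expansion (\<lambda>v. \<i> * GG v) 0 = fps_const \<i> * fps_expansion GG 0"
  by (intro fps_expansion_eq has_fps_expansion_cmult_left has_fps_expansion_fps_expansion[OF Bl(1,2) holomorphic_Bl(1)])

lemma fps_expansion_minus_TT: "fps_expansion (\<lambda>v. - TT v) 0 = - fps_expansion TT 0"
  by (intro fps_expansion_eq has_fps_expansion_minus has_fps_expansion_fps_expansion[OF Bl(1,2) holomorphic_Bl(3)])

lemma det_R:
  "(- 4) ^ n * hankel_det n (\<lambda>i. clambert_R (2 * i) q - of_real (eps_seq (i + 1))) =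
    GG 0 ^ n * (GG 0 * HH 0) ^ (2 * tri n) * (\<Prod>m<n. fact (2 * m) ^ 2)"
proof -
  have "fps_diff (fps_expansion (\<lambda>v. \<i> * GG v) 0) (2 * i) =
      (\<i> * - 4) * (-1) ^ i * (clambert_R (2 * i) q - of_real (eps_seq (i + 1)))" for i
    unfolding fps_expansion_cmult_GG fps_diff_cmult fps_diff_G eps_seq_def
    by (simp add: right_diff_distrib flip: power_mult_distrib)
  from hankel_det_scale'[where f = "\<lambda>i. fps_diff (fps_expansion (\<lambda>v. \<i> * GG v) 0) (2 * i)", OF this, of n]
  \<comment> \<open>The factor of \<open>\<i> * GG\<close> gives \<open>\<i>^n\<close> on both
    sides, while the product \<open>(\<i> * GG 0) * (\<i> * HH 0)\<close> occurs to an even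
    power.\<close>
  have "\<i> ^ n * ((- 4) ^ n * hankel_det n (\<lambda>i. clambert_R (2 * i) q - of_real (eps_seq (i + 1)))) =
      \<i> ^ n * (GG 0 ^ n * (GG 0 * HH 0) ^ (2 * tri n) * (\<Prod>m<n. fact (2 * m) ^ 2))"
    unfolding jacobi_system.hankel_det_C[OF jacobi_system_TGH] power_mult_distrib[of \<i>] imaginary_unit_mult2
    by (simp add: tri_def mult_ac)
  then show ?thesis by simp
qed

lemma det_R2:
  "4 ^ n * hankel_det n (\<lambda>i. clambert_R (2 * i + 2) q - of_real (eps'_seq (i + 1))) =
    (GG 0 * HH 0 ^ 2) ^ n * (GG 0 * HH 0) ^ (2 * tri n) * (\<Prod>m<n. fact (2 * m + 1) ^ 2)"
proof -
  have "fps_diff (fps_expansion (\<lambda>v. \<i> * GG v) 0) (2 * i + 2) =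
      (\<i> * 4) * (-1) ^ i * (clambert_R (2 * i + 2) q - of_real (eps'_seq (i + 1)))" for i
    using fps_diff_G[of "i + 1"]
    unfolding fps_expansion_cmult_GG fps_diff_cmult eps'_seq_def distrib_left mult_1_right
    by (simp only:) (simp add: distrib_left right_diff_distrib minus_one_power_cancel)
  from hankel_det_scale'[where f = "\<lambda>i. fps_diff (fps_expansion (\<lambda>v. \<i> * GG v) 0) (2 * i + 2)", OF this, of n]
  have "\<i> ^ n * (4 ^ n * hankel_det n (\<lambda>i. clambert_R (2 * i + 2) q - of_real (eps'_seq (i + 1)))) =
      (- 1) ^ n * (\<i> * GG 0 * (\<i> * HH 0)\<^sup>2) ^ n * (GG 0 * HH 0) ^ (2 * tri n) * (\<Prod>m<n. fact (2 * m + 1) ^ 2)"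
    unfolding jacobi_system.hankel_det_C2[OF jacobi_system_TGH] imaginary_unit_mult2 power_mult_distrib[of \<i> 4]
    by (simp add: tri_def mult_ac)
  also have "(- 1) ^ n * (\<i> * GG 0 * (\<i> * HH 0)\<^sup>2) ^ n = \<i> ^ n * (GG 0 * HH 0 ^ 2) ^ n"
    by (simp add: power_mult_distrib[of \<i> "HH 0"] mult.assoc flip: power_mult_distrib)
  finally show ?thesis by (simp add: mult.assoc)
qed

text \<open>Here \<open>(\<i> * GG 0) * (\<i> * HH 0)\<close> occurs to the power
  \<open>n + 2 * tri n\<close>, which leaves the sign \<open>(-1)^n\<close>.\<close>

lemma det_U:
  "8 ^ n * 4 ^ (2 * tri n) * hankel_det n (\<lambda>i. clambert_U (2 * i + 1) (q ^ 2) - of_real (beta_seq (i + 1))) =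
    (- 1) ^ n * (GG 0 * HH 0) ^ (n + 2 * tri n) * (\<Prod>m<n. fact (2 * m) * fact (2 * m + 1))"
proof -
  have "fps_diff (fps_expansion (\<lambda>v. - TT v) 0) (2 * i + 1) =
      8 * (-4) ^ i * (clambert_U (2 * i + 1) (q ^ 2) - of_real (beta_seq (i + 1)))" for i
  proof -
    have "fps_diff tan_fps (2 * i + 1) = of_real (8 * (-4) ^ i * beta_seq (i + 1))"
      unfolding tan_derivative beta_seq_eq ..
    then have "fps_diff tan_fps (2 * i + 1) = 8 * (-4) ^ i * of_real (beta_seq (i + 1))"
      by simp
    then show ?thesis
      unfolding fps_expansion_minus_TT fps_diff_uminus fps_diff_T by (simp add: right_diff_distrib)
  qed
  from hankel_det_scale'[where f = "\<lambda>i. fps_diff (fps_expansion (\<lambda>v. - TT v) 0) (2 * i + 1)", OF this, of n]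
  have "8 ^ n * 4 ^ (2 * tri n) * hankel_det n (\<lambda>i. clambert_U (2 * i + 1) (q ^ 2) - of_real (beta_seq (i + 1))) =
      (- (GG 0 * HH 0)) ^ (n + 2 * tri n) * (\<Prod>m<n. fact (2 * m) * fact (2 * m + 1))"
    unfolding jacobi_system.hankel_det_S[OF jacobi_system_TGH] imaginary_unit_mult2
    by (simp add: tri_def)
  moreover have "(- x) ^ (n + 2 * m) = (- 1) ^ n * x ^ (n + 2 * m)" for x :: complex and m
    by (simp add: power_minus[of x n] power_add)
  ultimately show ?thesis by (simp only:)
qed

lemma det_G:
  "32 ^ n * 4 ^ (2 * tri n) * hankel_det n (\<lambda>i. clambert_G (2 * i + 3) (q ^ 2) - of_real (beta'_seq (i + 1))) =
    (GG 0 * HH 0) ^ (2 * n + 2 * tri n) * (\<Prod>m<n. fact (2 * m + 1) * fact (2 * m + 2))"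
proof -
  have "fps_diff (fps_expansion (\<lambda>v. - TT v) 0 * fps_expansion (\<lambda>v. - TT v) 0) (2 * i + 2) =
      32 * (-4) ^ i * (clambert_G (2 * i + 3) (q ^ 2) - of_real (beta'_seq (i + 1)))" for i
  proof -
    have "fps_diff tan_fps (2 * (i + 1) + 1) = of_real (8 * (-4) ^ (i + 1) * beta'_seq (i + 1))"
      unfolding tan_derivative beta'_seq_eq[of i] beta_seq_eq ..
    moreover have "2 * (i + 1) + 1 = 2 * i + 3" by simp
    ultimately have "fps_diff tan_fps (2 * i + 3) = of_real (8 * (-4) ^ (i + 1) * beta'_seq (i + 1))"
      by (simp only:)
    then have "fps_diff tan_fps (2 * i + 3) = - 32 * (-4) ^ i * of_real (beta'_seq (i + 1))"
      by simp
    then show ?thesis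
      unfolding fps_diff_TT_sqr fps_diff_E by (simp add: right_diff_distrib)
  qed
  from hankel_det_scale'[where f = "\<lambda>i. fps_diff (fps_expansion (\<lambda>v. - TT v) 0 * fps_expansion (\<lambda>v. - TT v) 0) (2 * i + 2)", OF this, of n]
  show ?thesis
    unfolding jacobi_system.hankel_det_S_sqr[OF jacobi_system_TGH] imaginary_unit_mult2
    by (simp add: tri_def)
qed

end

section \<open>Theta constants\<close>

text \<open>Both sides sum \<open>(-1)^k * x^((a i + 1) (2 k + 1))\<close> over all \<open>i\<close>
  and \<open>k\<close>, by geometric series in one index first. The case \<open>a = 1\<close>
  relates \<open>N\<close> to \<open>R\<close>, and \<open>a = 2\<close> gives \<open>T\<close> a
  form with minus signs in the denominators.\<close>

lemma lambert_swap:
  fixes x :: complex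
  assumes x: "norm x < 1" and a: "a > 0"
  shows "(\<lambda>k. (-1) ^ k * (x ^ (2 * k + 1) / (1 - x ^ (a * (2 * k + 1))))) sums
    (\<Sum>i. x ^ (a * i + 1) / (1 + x ^ (2 * (a * i + 1))))"
proof -
  define f where "f = (\<lambda>(i, k). (-1) ^ k * x ^ ((a * i + 1) * (2 * k + 1)))"
  have pow1: "norm (x ^ n) < 1" if "n > 0" for n
    using that x by (simp add: norm_power power_less_one_iff)
  have geo: "(\<lambda>k. norm (x ^ k)) summable_on UNIV"
    using x by (subst summable_on_UNIV_nonneg_real_iff) (simp_all add: norm_power summable_geometric)
  have "(\<lambda>z. norm (f z)) summable_on UNIV \<times> UNIV"
  proof (rule Infinite_Sum.abs_summable_on_comparison_test[OF abs_summable_on_product[OF geo geo]])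
    fix z :: "nat \<times> nat"
    obtain i k where z: "z = (i, k)" by (cases z)
    \<comment> \<open>Bounds the double family by the summable product
      \<open>|x|^i * |x|^k\<close>.\<close>
    have "i + k \<le> (a * i + 1) * (2 * k + 1)"
    proof -
      have "i + k \<le> (i + 1) * (2 * k + 1)" by simp
      also have "\<dots> \<le> (a * i + 1) * (2 * k + 1)"
        using a by (intro mult_right_mono) auto
      finally show ?thesis .
    qed
    then have "norm x ^ ((a * i + 1) * (2 * k + 1)) \<le> norm x ^ (i + k)"
      using x by (intro power_decreasing) auto
    then show "norm (f z) \<le> norm (case z of (i, k) \<Rightarrow> x ^ i * x ^ k)"
      by (simp add: f_def z norm_mult norm_power power_add)
  qed
  then have s: "(\<lambda>(i, k). f (i, k)) summable_on UNIV \<times> UNIV"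
    by (simp add: abs_summable_summable)
  have inner1: "((\<lambda>k. f (i, k)) has_sum (x ^ (a * i + 1) / (1 + x ^ (2 * (a * i + 1))))) UNIV" for i
  proof -
    define n where "n = a * i + 1"
    have "norm (- (x ^ (2 * n))) < 1"
      using pow1[of "2 * n"] by (simp add: n_def)
    from has_sum_cmult_right[OF has_sum_geometric[OF this], of "x ^ n"]
    have "((\<lambda>k. x ^ n * (- (x ^ (2 * n))) ^ k) has_sum (x ^ n / (1 + x ^ (2 * n)))) UNIV"
      by simp
    moreover have "x ^ n * (- (x ^ (2 * n))) ^ k = f (i, k)" for k
    proof -
      have "n * (2 * k + 1) = n + (2 * n) * k" by (simp add: algebra_simps)
      then have "f (i, k) = (-1) ^ k * (x ^ n * (x ^ (2 * n)) ^ k)"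
        unfolding f_def prod.case n_def[symmetric] by (simp only: power_add power_mult[of x "2 * n" k])
      then show ?thesis
        unfolding power_minus[of "x ^ (2 * n)" k] by (simp only: mult_ac)
    qed
    ultimately show ?thesis by (simp add: n_def)
  qed
  have inner2: "((\<lambda>i. f (i, k)) has_sum ((-1) ^ k * (x ^ (2 * k + 1) / (1 - x ^ (a * (2 * k + 1)))))) UNIV" for k
  proof -
    define n where "n = 2 * k + 1"
    have "norm (x ^ (a * n)) < 1"
      using pow1[of "a * n"] a by (simp add: n_def)
    from has_sum_cmult_right[OF has_sum_geometric[OF this], of "(-1) ^ k * x ^ n"]
    have "((\<lambda>i. (-1) ^ k * x ^ n * (x ^ (a * n)) ^ i) has_sum ((-1) ^ k * (x ^ n / (1 - x ^ (a * n))))) UNIV"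
      by (simp add: mult.assoc)
    moreover have "(-1) ^ k * x ^ n * (x ^ (a * n)) ^ i = f (i, k)" for i
    proof -
      have "(a * i + 1) * n = n + (a * n) * i" by (simp add: algebra_simps)
      then have "f (i, k) = (-1) ^ k * (x ^ n * (x ^ (a * n)) ^ i)"
        unfolding f_def prod.case n_def[symmetric] by (simp only: power_add power_mult[of x "a * n" i])
      then show ?thesis by (simp add: mult_ac)
    qed
    ultimately show ?thesis by (simp add: n_def)
  qed
  have s': "(\<lambda>(k, i). f (i, k)) summable_on UNIV \<times> UNIV"
    using s summable_on_swap[of "\<lambda>(i, k). f (i, k)" UNIV UNIV] by (simp add: case_prod_unfold prod.swap_def)
  have "(\<lambda>i. infsum (\<lambda>k. f (i, k)) UNIV) summable_on UNIV"
    by (rule summable_on_Sigma_banach[OF s])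
  then have "(\<lambda>i. infsum (\<lambda>k. f (i, k)) UNIV) sums (\<Sum>\<^sub>\<infinity>i. \<Sum>\<^sub>\<infinity>k. f (i, k))"
    by (intro has_sum_imp_sums) simp
  moreover have "(\<lambda>k. infsum (\<lambda>i. f (i, k)) UNIV) summable_on UNIV"
    by (rule summable_on_Sigma_banach[OF s'])
  then have "(\<lambda>k. infsum (\<lambda>i. f (i, k)) UNIV) sums (\<Sum>\<^sub>\<infinity>k. \<Sum>\<^sub>\<infinity>i. f (i, k))"
    by (intro has_sum_imp_sums) simp
  moreover have "(\<Sum>\<^sub>\<infinity>i. \<Sum>\<^sub>\<infinity>k. f (i, k)) = (\<Sum>\<^sub>\<infinity>k. \<Sum>\<^sub>\<infinity>i. f (i, k))"
    by (rule infsum_swap_banach[OF s])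
  ultimately have "(\<lambda>k. infsum (\<lambda>i. f (i, k)) UNIV) sums (\<Sum>i. infsum (\<lambda>k. f (i, k)) UNIV)"
    by (simp only: sums_iff simp_thms)
  then show ?thesis
    unfolding infsumI[OF inner1] infsumI[OF inner2] .
qed

text \<open>With Jacobi's theta function, \<open>theta3 q = \<theta>\<^sub>3(q)\<^sup>2\<close> by the two-square theorem.\<close>

definition theta3 :: "complex \<Rightarrow> complex" where "theta3 x = 1 + 4 * clambert_N 0 x"

lemma clambert_N_0:
  assumes "norm x < 1"
  shows "clambert_N 0 x = - clambert_R 0 (- x)"
proof -
  have "(\<lambda>k. (-1) ^ k * (x ^ (2 * k + 1) / (1 - x ^ (2 * k + 1)))) sums clambert_N 0 x"
    using lambert_swap[OF assms, of 1] unfolding clambert_N_def by simp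
  from sums_minus[OF this]
  have "(\<lambda>k. (-1) ^ k * (of_nat (2 * k + 1) ^ 0 * (- x) ^ (2 * k + 1) / (1 + (- x) ^ (2 * k + 1)))) sums (- clambert_N 0 x)"
    by simp
  then have "clambert_R 0 (- x) = - clambert_N 0 x"
    unfolding clambert_R_def by (rule sums_unique[symmetric])
  then show ?thesis by simp
qed

text \<open>At \<open>\<i> * x\<close> the defining series becomes, term by term,
  \<open>\<i>\<close> times the alternating form in \<open>lambert_swap\<close> with
  \<open>a = 2\<close>.\<close>

lemma clambert_T_0_i:
  assumes "norm x < 1"
  shows "clambert_T 0 (\<i> * x) = \<i> * clambert_T 0 x"
proof -
  have "(\<lambda>k. (-1) ^ k * (x ^ (2 * k + 1) / (1 - x ^ (2 * (2 * k + 1))))) sums clambert_T 0 x"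
    using lambert_swap[OF assms, of 2] unfolding clambert_T_def by simp
  note s = sums_mult[OF this, of \<i>]
  have "(\<i> * x) ^ (2 * k + 1) = \<i> * ((-1) ^ k * x ^ (2 * k + 1))" "(\<i> * x) ^ (2 * (2 * k + 1)) = - (x ^ (2 * (2 * k + 1)))" for k
    unfolding power_mult_distrib imaginary_unit_power_even power_add[of \<i>] by simp_all
  note p = this
  have "(\<lambda>k. of_nat (2 * k + 1) ^ 0 * (\<i> * x) ^ (2 * k + 1) / (1 + (\<i> * x) ^ (2 * (2 * k + 1)))) sums (\<i> * clambert_T 0 x)"
    unfolding p using s by simp
  then show ?thesis
    unfolding clambert_T_def by (rule sums_unique[symmetric])
qed

text \<open>Reuses the strip estimate: a polynomial factor arises from differentiating a Fourier
  series with geometric coefficients.\<close>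

lemma summable_poly_power:
  assumes r: "0 < r" "r < (1 :: real)"
  shows "summable (\<lambda>n. real n ^ s * r ^ n)"
proof -
  have "strip_summable (- ln r) (\<lambda>m. of_real (r ^ nat \<bar>m\<bar>))"
    by (rule strip_summableI[OF r, where K = 1]) (use r in \<open>simp add: norm_power\<close>)
  from strip_summableD[OF strip_summable_higher_deriv[OF this, of s], of 0] r
  have "(\<lambda>m. norm ((\<i> * of_int m) ^ s * of_real (r ^ nat \<bar>m\<bar>))) summable_on UNIV"
    by simp
  then have "(\<lambda>m. norm ((\<i> * of_int m) ^ s * of_real (r ^ nat \<bar>m\<bar>))) summable_on range int"
    by (rule summable_on_subset) simp
  then have "(\<lambda>n. real n ^ s * r ^ n) summable_on UNIV"
    using r by (subst (asm) summable_on_reindex) (simp_all add: o_def norm_mult norm_power)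
  then show ?thesis by (rule summable_on_imp_summable)
qed

section \<open>Real Lambert series as values of the complex ones\<close>

lemma norm_lambert_term_le:
  fixes x :: "'a :: real_normed_field"
  assumes "norm x \<le> r" "r < 1" "m > 0"
  shows "norm (x ^ n / (1 - x ^ m)) \<le> r ^ n / (1 - r)" "norm (x ^ n / (1 + x ^ m)) \<le> r ^ n / (1 - r)"
proof -
  have "norm x ^ m \<le> norm x ^ 1"
    using assms by (intro power_decreasing) auto
  then have "norm x ^ m \<le> r" using assms by simp
  moreover have "1 - norm x ^ m \<le> norm (1 - x ^ m)" "1 - norm x ^ m \<le> norm (1 + x ^ m)"
    using norm_triangle_ineq2[of 1 "x ^ m"] norm_triangle_ineq2[of 1 "- (x ^ m)"]
    by (simp_all add: norm_power)
  ultimately have "1 - r \<le> norm (1 - x ^ m)" "1 - r \<le> norm (1 + x ^ m)"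
    by auto
  moreover have "norm x ^ n \<le> r ^ n" using assms by (intro power_mono) auto
  moreover have "0 \<le> r" using norm_ge_zero[of x] assms(1) by linarith
  ultimately show "norm (x ^ n / (1 - x ^ m)) \<le> r ^ n / (1 - r)" "norm (x ^ n / (1 + x ^ m)) \<le> r ^ n / (1 - r)"
    using assms by (auto simp: norm_divide norm_power intro!: frac_le)
qed

lemma of_real_series1:
  fixes f :: "nat \<Rightarrow> real"
  assumes r: "0 < r" "r < 1" and n: "inj n" and le: "\<And>i. norm (f (Suc i)) \<le> K * (real (n i) ^ s * r ^ n i)"
  shows "(\<lambda>i. complex_of_real (f (Suc i))) sums of_real (series1 f)"
proof -
  have "summable ((\<lambda>n. real n ^ s * r ^ n) \<circ> n)"
    by (rule summable_reindex[OF summable_poly_power[OF r] n]) (use r in simp)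
  then have "summable (\<lambda>i. K * (real (n i) ^ s * r ^ n i))"
    by (intro summable_mult) (simp add: o_def)
  then have "summable (\<lambda>i. f (Suc i))"
    by (rule summable_comparison_test'[where N = 0]) (rule le)
  then show ?thesis
    unfolding series1_def by (intro sums_of_real summable_sums)
qed

text \<open>One statement for all nine series: \<open>n\<close> gives the exponents of the
  numerators, \<open>m\<close> those of the denominators, \<open>c\<close> the signs in front and
  \<open>\<epsilon>\<close> the sign in the denominator.\<close>

lemma of_real_lambert_series:
  fixes f :: "nat \<Rightarrow> real"
  assumes x: "\<bar>x\<bar> < 1" and n: "inj n" and m: "\<And>i. m i > 0" and c: "\<And>i. \<bar>c i\<bar> \<le> 1"
    and \<epsilon>: "\<epsilon> = 1 \<or> \<epsilon> = - 1"
    and f: "\<And>i. f (Suc i) = c i * (real (n i) ^ s * (x ^ n i / (1 + \<epsilon> * x ^ m i)))"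
  shows "(\<lambda>i. complex_of_real (f (Suc i))) sums of_real (series1 f)"
proof -
  define r where "r = (\<bar>x\<bar> + 1) / 2"
  have r: "0 < r" "r < 1" "norm x \<le> r" using x by (auto simp: r_def)
  show ?thesis
  proof (rule of_real_series1[OF r(1,2) n, where K = "1 / (1 - r)" and s = s])
    fix i
    have "norm (x ^ n i / (1 + \<epsilon> * x ^ m i)) \<le> r ^ n i / (1 - r)"
      using \<epsilon> norm_lambert_term_le[OF r(3,2) m[of i], of "n i"] by auto
    then have "\<bar>c i\<bar> * (real (n i) ^ s * norm (x ^ n i / (1 + \<epsilon> * x ^ m i))) \<le> 1 * (real (n i) ^ s * (r ^ n i / (1 - r)))"
      using c[of i] r by (intro mult_mono mult_left_mono) auto
    then show "norm (f (Suc i)) \<le> 1 / (1 - r) * (real (n i) ^ s * r ^ n i)"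
      unfolding f by (simp add: abs_mult)
  qed
qed

lemma suminf_of_real_lambert_series:
  fixes f :: "nat \<Rightarrow> real"
  assumes "\<bar>x\<bar> < 1" "inj n" "\<And>i. m i > 0" "\<And>i. \<bar>c i\<bar> \<le> 1" "\<epsilon> = 1 \<or> \<epsilon> = - 1"
    and "\<And>i. f (Suc i) = c i * (real (n i) ^ s * (x ^ n i / (1 + \<epsilon> * x ^ m i)))"
    and g: "\<And>i. g i = complex_of_real (f (Suc i))"
  shows "(\<Sum>i. g i) = of_real (series1 f)"
  unfolding g using of_real_lambert_series[OF assms(1-6)] by (rule sums_unique[symmetric])

lemma clambert_N_eq: "\<bar>x\<bar> < 1 \<Longrightarrow> clambert_N s (of_real x) = of_real (lambert_N s x)"
  unfolding clambert_N_def lambert_N_def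
  by (rule suminf_of_real_lambert_series[where x = x and n = Suc and m = "\<lambda>i. 2 * Suc i" and c = "\<lambda>_. 1" and \<epsilon> = 1 and s = s])
    (simp_all del: power_Suc of_nat_Suc)

lemma clambert_D_eq: "\<bar>x\<bar> < 1 \<Longrightarrow> clambert_D s (of_real x) = of_real (lambert_D s x)"
  unfolding clambert_D_def lambert_D_def
  by (rule suminf_of_real_lambert_series[where x = x and n = Suc and m = "\<lambda>i. 2 * Suc i" and c = "\<lambda>_. 1" and \<epsilon> = "- 1" and s = s])
    (simp_all del: power_Suc of_nat_Suc)

lemma clambert_U_eq: "\<bar>x\<bar> < 1 \<Longrightarrow> clambert_U s (of_real x) = of_real (lambert_U s x)"
  unfolding clambert_U_def lambert_U_def
  by (rule suminf_of_real_lambert_series[where x = x and n = Suc and m = "\<lambda>i. Suc i" and c = "\<lambda>i. (- 1) ^ i" and \<epsilon> = 1 and s = s])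
    (simp_all del: power_Suc of_nat_Suc)

lemma clambert_G_eq: "\<bar>x\<bar> < 1 \<Longrightarrow> clambert_G s (of_real x) = of_real (lambert_G s x)"
  unfolding clambert_G_def lambert_G_def
  by (rule suminf_of_real_lambert_series[where x = x and n = Suc and m = "\<lambda>i. Suc i" and c = "\<lambda>i. (- 1) ^ Suc i" and \<epsilon> = "- 1" and s = s])
    (simp_all del: power_Suc of_nat_Suc add: power_abs)

lemma inj_odd: "inj (\<lambda>i :: nat. 2 * i + 1)"
  by (rule injI) simp

lemma odd_index: "2 * Suc i - 1 = 2 * i + 1"
  by simp

lemma clambert_R_eq: "\<bar>x\<bar> < 1 \<Longrightarrow> clambert_R s (of_real x) = of_real (lambert_R s x)"
  unfolding clambert_R_def lambert_R_def
  by (rule suminf_of_real_lambert_series[where x = x and n = "\<lambda>i. 2 * i + 1" and m = "\<lambda>i. 2 * i + 1" and c = "\<lambda>i. (- 1) ^ i" and \<epsilon> = 1 and s = s])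
    (simp_all only: odd_index inj_odd, simp_all del: of_nat_Suc)

lemma clambert_C_eq: "\<bar>x\<bar> < 1 \<Longrightarrow> clambert_C s (of_real x) = of_real (lambert_C s x)"
  unfolding clambert_C_def lambert_C_def
  by (rule suminf_of_real_lambert_series[where x = x and n = "\<lambda>i. 2 * i + 1" and m = "\<lambda>i. 2 * (2 * i + 1)" and c = "\<lambda>i. 1" and \<epsilon> = "- 1" and s = s])
    (simp_all only: odd_index inj_odd, simp_all del: of_nat_Suc)

lemma powr_half_odd: "0 < x \<Longrightarrow> (x ^ 2) powr (real (Suc i) - 1 / 2) = x ^ (2 * i + 1)" for x :: real
proof -
  assume x: "0 < x"
  then have "(x ^ 2) powr (real (Suc i) - 1 / 2) = x powr (2 * (real (Suc i) - 1 / 2))"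
    by (simp add: powr_powr flip: powr_numeral)
  also have "2 * (real (Suc i) - 1 / 2) = real (2 * i + 1)" by simp
  finally show ?thesis using x by (simp only: powr_realpow)
qed

lemma clambert_T_eq: "0 < x \<Longrightarrow> x < 1 \<Longrightarrow> clambert_T s (of_real x) = of_real (lambert_T s (x ^ 2))"
  unfolding clambert_T_def lambert_T_def
  by (rule suminf_of_real_lambert_series[where x = x and n = "\<lambda>i. 2 * i + 1" and m = "\<lambda>i. 2 * (2 * i + 1)" and c = "\<lambda>i. 1" and \<epsilon> = 1 and s = s])
    (simp_all only: odd_index inj_odd powr_half_odd power_mult[symmetric], simp_all del: of_nat_Suc)

lemma i_power_odd': "(\<i> * x) ^ (2 * k + 1) = \<i> * ((-1) ^ k * x ^ (2 * k + 1))"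
  "(\<i> * x) ^ (2 * (2 * k + 1)) = - (x ^ (2 * (2 * k + 1)))"
  unfolding power_mult_distrib imaginary_unit_power_even power_add[of \<i>] by simp_all

text \<open>At \<open>\<i> * x\<close> an odd power acquires \<open>\<i> * (-1)^i\<close>, and the
  plus sign in the denominator becomes a minus. The extra factor \<open>\<i>\<close> turns this into
  \<open>(-1)^r\<close> for \<open>r = i + 1\<close>.\<close>

lemma clambert_T_hat_eq:
  assumes "0 < x" "x < 1"
  shows "\<i> * clambert_T s (\<i> * of_real x) = of_real (lambert_T_hat s (x ^ 2))"
proof -
  define f where "f r = real (2 * r - 1) ^ s * (- 1) ^ r * (x ^ 2) powr (real r - 1 / 2) / (1 - (x ^ 2) ^ (2 * r - 1))" for r
  have "(\<lambda>i. complex_of_real (f (Suc i))) sums of_real (series1 f)"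
    by (rule of_real_lambert_series[where x = x and n = "\<lambda>i. 2 * i + 1" and m = "\<lambda>i. 2 * (2 * i + 1)" and c = "\<lambda>i. (- 1) ^ Suc i" and \<epsilon> = "- 1" and s = s])
      (use assms in \<open>simp_all only: f_def odd_index inj_odd powr_half_odd power_mult[symmetric], simp_all add: power_abs del: of_nat_Suc\<close>)
  from sums_mult[OF this, of "- \<i>"]
  have "(\<lambda>i. of_nat (2 * i + 1) ^ s * (\<i> * of_real x) ^ (2 * i + 1) / (1 + (\<i> * of_real x) ^ (2 * (2 * i + 1)))) sums (- \<i> * of_real (series1 f))"
    unfolding f_def odd_index powr_half_odd[OF assms(1)] i_power_odd' power_mult[symmetric] by (simp add: mult_ac)
  then have "clambert_T s (\<i> * of_real x) = - \<i> * of_real (series1 (\<lambda>r. f r))"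
    unfolding clambert_T_def by (rule sums_unique[symmetric])
  then show ?thesis
    unfolding lambert_T_hat_def f_def[symmetric] by (simp add: imaginary_unit_mult)
qed

lemma clambert_C_hat_eq:
  assumes "0 < x" "x < 1"
  shows "\<i> * clambert_C s (\<i> * of_real x) = of_real (lambert_C_hat s (x ^ 2))"
proof -
  define f where "f r = real (2 * r - 1) ^ s * (- 1) ^ r * (x ^ 2) powr (real r - 1 / 2) / (1 + (x ^ 2) ^ (2 * r - 1))" for r
  have "(\<lambda>i. complex_of_real (f (Suc i))) sums of_real (series1 f)"
    by (rule of_real_lambert_series[where x = x and n = "\<lambda>i. 2 * i + 1" and m = "\<lambda>i. 2 * (2 * i + 1)" and c = "\<lambda>i. (- 1) ^ Suc i" and \<epsilon> = 1 and s = s])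
      (use assms in \<open>simp_all only: f_def odd_index inj_odd powr_half_odd power_mult[symmetric], simp_all add: power_abs del: of_nat_Suc\<close>)
  from sums_mult[OF this, of "- \<i>"]
  have "(\<lambda>i. of_nat (2 * i + 1) ^ s * (\<i> * of_real x) ^ (2 * i + 1) / (1 - (\<i> * of_real x) ^ (2 * (2 * i + 1)))) sums (- \<i> * of_real (series1 f))"
    unfolding f_def odd_index powr_half_odd[OF assms(1)] i_power_odd' power_mult[symmetric] by (simp add: mult_ac)
  then have "clambert_C s (\<i> * of_real x) = - \<i> * of_real (series1 (\<lambda>r. f r))"
    unfolding clambert_C_def by (rule sums_unique[symmetric])
  then show ?thesis
    unfolding lambert_C_hat_def f_def[symmetric] by (simp add: imaginary_unit_mult)
qed

text \<open>The terms of even exponent in \<open>N\<close> reproduce \<open>N\<close> at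
  \<open>p^2\<close>, those of odd exponent form \<open>T\<close>; the series at \<open>- p\<close>
  separates them. The first equation is
  \<open>theta_3(p)^2 + theta_4(p)^2 = 2 theta_3(p^2)^2\<close>.\<close>

lemma theta3_duplication:
  assumes p: "norm p < 1"
  shows "theta3 p + theta3 (- p) = 2 * theta3 (p ^ 2)" "theta3 p - theta3 (- p) = 8 * clambert_T 0 p"
proof -
  define h where "h = (\<lambda>i. p ^ Suc i / (1 + p ^ (2 * Suc i)))"
  have "summable h"
  proof (rule summable_comparison_test'[where N = 0])
    show "summable (\<lambda>i. norm p ^ Suc i / (1 - norm p))"
      using p by (intro summable_divide) (simp add: summable_geometric summable_mult)
    show "norm (h i) \<le> norm p ^ Suc i / (1 - norm p)" for i
      unfolding h_def using p by (intro norm_lambert_term_le) auto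
  qed
  then have s: "h sums clambert_N 0 p"
    unfolding clambert_N_def h_def by (simp add: summable_sums)
  have "summable (\<lambda>i. (- 1) ^ Suc i * h i)"
  proof (rule summable_comparison_test'[where N = 0])
    show "summable (\<lambda>i. norm p ^ Suc i / (1 - norm p))"
      using p by (intro summable_divide) (simp add: summable_geometric summable_mult)
    show "norm ((- 1) ^ Suc i * h i) \<le> norm p ^ Suc i / (1 - norm p)" for i
      unfolding h_def norm_mult using p norm_lambert_term_le(2)[of p "norm p" "2 * Suc i" "Suc i"] by (simp add: norm_power)
  qed
  then have "(\<lambda>i. (- 1) ^ Suc i * h i) sums (\<Sum>i. (- 1) ^ Suc i * h i)"
    by (rule summable_sums)
  moreover have "clambert_N 0 (- p) = (\<Sum>i. (- 1) ^ Suc i * h i)"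
  proof -
    have "(- p) ^ Suc i = (- 1) ^ Suc i * p ^ Suc i" "(- p) ^ (2 * Suc i) = p ^ (2 * Suc i)" for i
      by (rule power_minus, simp only: power_mult power2_minus)
    note p = this
    show ?thesis unfolding clambert_N_def h_def p by (simp del: power_Suc)
  qed
  ultimately have s': "(\<lambda>i. (- 1) ^ Suc i * h i) sums clambert_N 0 (- p)"
    by simp
  \<comment> \<open>Blocks of two terms: index \<open>2 i\<close> carries the odd exponent
    \<open>2 i + 1\<close>, index \<open>2 i + 1\<close> the even exponent
    \<open>2 i + 2\<close>.\<close>
  have range2: "{n * 2..<n * 2 + 2} = {2 * n, 2 * n + 1}" for n :: nat by auto
  have "(\<lambda>i. h i + (- 1) ^ Suc i * h i) sums (clambert_N 0 p + clambert_N 0 (- p))"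
    by (rule sums_add[OF s s'])
  from sums_group[OF this, of 2]
  have "(\<lambda>i. 2 * h (2 * i + 1)) sums (clambert_N 0 p + clambert_N 0 (- p))"
    unfolding range2 by simp
  then have "clambert_N 0 p + clambert_N 0 (- p) = 2 * (\<Sum>i. h (2 * i + 1))"
    by (rule sums_cmult_suminf) simp
  also have "(\<Sum>i. h (2 * i + 1)) = clambert_N 0 (p ^ 2)"
  proof -
    have "h (2 * i + 1) = (p ^ 2) ^ Suc i / (1 + (p ^ 2) ^ (2 * Suc i))" for i
    proof -
      have "Suc (2 * i + 1) = 2 * Suc i" by simp
      then show ?thesis unfolding h_def power_mult[symmetric] by (simp only: mult_ac)
    qed
    then show ?thesis unfolding clambert_N_def by simp
  qed
  finally have sum: "clambert_N 0 p + clambert_N 0 (- p) = 2 * clambert_N 0 (p ^ 2)" .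
  have "theta3 p + theta3 (- p) = 2 + 4 * (clambert_N 0 p + clambert_N 0 (- p))"
    by (simp add: theta3_def algebra_simps)
  then show "theta3 p + theta3 (- p) = 2 * theta3 (p ^ 2)"
    unfolding sum by (simp add: theta3_def)
  have "(\<lambda>i. h i - (- 1) ^ Suc i * h i) sums (clambert_N 0 p - clambert_N 0 (- p))"
    by (rule sums_diff[OF s s'])
  from sums_group[OF this, of 2]
  have "(\<lambda>i. 2 * h (2 * i)) sums (clambert_N 0 p - clambert_N 0 (- p))"
    unfolding range2 by simp
  then have "clambert_N 0 p - clambert_N 0 (- p) = 2 * (\<Sum>i. h (2 * i))"
    by (rule sums_cmult_suminf) simp
  also have "(\<Sum>i. h (2 * i)) = clambert_T 0 p"
    unfolding clambert_T_def h_def by simp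
  finally have diff: "clambert_N 0 p - clambert_N 0 (- p) = 2 * clambert_T 0 p" .
  have "theta3 p - theta3 (- p) = 4 * (clambert_N 0 p - clambert_N 0 (- p))"
    by (simp add: theta3_def algebra_simps)
  then show "theta3 p - theta3 (- p) = 8 * clambert_T 0 p"
    unfolding diff by simp
qed

context nome
begin

text \<open>In theta notation \<open>CC 0 = theta_2(q)^2\<close>,
  \<open>DD 0 = HH 0 = theta_3(q)^2\<close> and \<open>GG 0 = theta_4(q)^2\<close>.\<close>

lemma CC_0: "CC 0 = 4 * clambert_T 0 Q"
  using higher_deriv_CC[of 0] by simp

lemma DD_0: "DD 0 = theta3 q"
  using higher_deriv_DD[of 0] by (simp add: theta3_def)

lemma HH_0': "HH 0 = theta3 q"
  using clambert_N_0[OF norm_q(1)] by (simp add: HH_0 theta3_def)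

lemma GG_0: "GG 0 = theta3 (- q)"
proof -
  have "of_real \<bar>euler_num 0\<bar> = (1 :: complex)"
    using sec_derivative[of 0] by (simp add: fps_diff_def sec_fps_def)
  then have "GG 0 = 1 - 4 * clambert_R 0 q"
    using fps_diff_G[of 0] by (simp add: fps_diff_fps_expansion)
  then show ?thesis
    using clambert_N_0[of "- q"] norm_q(1) by (simp add: theta3_def)
qed

lemma theta3_sqr_diff: "theta3 q ^ 2 - theta3 (- q) ^ 2 = (4 * clambert_T 0 Q) ^ 2"
  using HH_GG_sqr unfolding HH_0' GG_0 CC_0 by (simp add: power2_eq_square)

text \<open>By \<open>4 x y = (x + y)^2 - (x - y)^2\<close>, duplication at \<open>Q\<close> reduces
  the product to Jacobi's quartic identity at \<open>q\<close>. It is the square of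
  \<open>theta_3(Q) theta_4(Q) = theta_4(Q^2)^2\<close>.\<close>

lemma theta3_prod: "theta3 Q * theta3 (- Q) = theta3 (- q) ^ 2"
proof -
  have "4 * (theta3 Q * theta3 (- Q)) = (theta3 Q + theta3 (- Q)) ^ 2 - (theta3 Q - theta3 (- Q)) ^ 2"
    by (simp add: power2_eq_square algebra_simps)
  also have "\<dots> = 4 * (theta3 q ^ 2 - (4 * clambert_T 0 Q) ^ 2)"
    unfolding theta3_duplication[OF Q_lt_1] by (simp add: power2_eq_square)
  also have "\<dots> = 4 * theta3 (- q) ^ 2"
    unfolding theta3_sqr_diff[symmetric] by simp
  finally show ?thesis by simp
qed

end

section \<open>The complete elliptic integral\<close>

definition ellF_integrand :: "real \<Rightarrow> real \<Rightarrow> real" where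
  "ellF_integrand k \<theta> = 1 / sqrt (1 - k\<^sup>2 * (sin \<theta>)\<^sup>2)"

lemma ellF_radicand_pos:
  assumes "0 \<le> k" "k < (1 :: real)"
  shows "0 < 1 - k\<^sup>2 * (sin \<theta>)\<^sup>2"
proof -
  have "k\<^sup>2 * (sin \<theta>)\<^sup>2 \<le> k\<^sup>2 * 1"
    by (intro mult_left_mono) (simp_all add: abs_square_le_1)
  moreover have "k\<^sup>2 < 1" using assms by (simp add: power_less_one_iff)
  ultimately show ?thesis by simp
qed

lemma continuous_on_ellF_integrand: "0 \<le> k \<Longrightarrow> k < 1 \<Longrightarrow> continuous_on S (ellF_integrand k)"
  unfolding ellF_integrand_def by (intro continuous_intros) (use ellF_radicand_pos in \<open>simp_all add: less_le\<close>)

text \<open>The incomplete integral in Legendre form: the substitution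
  \<open>t = sin \<theta>\<close> removes the singularity at \<open>t = 1\<close>, so continuity up
  to that endpoint is available.\<close>

definition ellF :: "real \<Rightarrow> real \<Rightarrow> real" where
  "ellF k t = integral {0..arcsin t} (ellF_integrand k)"

lemma continuous_on_ellF:
  assumes "0 \<le> k" "k < 1"
  shows "continuous_on {0..1} (ellF k)"
  unfolding ellF_def
proof (rule continuous_on_compose2[where g = "\<lambda>x. integral {0..x} (ellF_integrand k)"])
  show "continuous_on {0..pi / 2} (\<lambda>x. integral {0..x} (ellF_integrand k))"
    by (intro indefinite_integral_continuous_1 integrable_continuous_real continuous_on_ellF_integrand assms)
  show "continuous_on {0..1} arcsin"
    by (intro continuous_intros) auto
  show "arcsin ` {0..1} \<subseteq> {0..pi / 2}"
    using arcsin_bounded arcsin_nonneg by force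
qed

lemma DERIV_ellF:
  assumes k: "0 \<le> k" "k < 1" and t: "0 < t" "t < 1"
  shows "(ellF k has_real_derivative 1 / sqrt ((1 - t\<^sup>2) * (1 - k\<^sup>2 * t\<^sup>2))) (at t)"
proof -
  define x where "x = arcsin t"
  have x: "0 < x" "x < pi / 2"
    using arcsin_less_arcsin[of 0 t] arcsin_less_arcsin[of t 1] t by (simp_all add: x_def)
  have "((\<lambda>x. integral {0..x} (ellF_integrand k)) has_real_derivative ellF_integrand k x) (at x within {0..pi / 2})"
    by (rule integral_has_real_derivative) (use x k in \<open>simp_all add: continuous_on_ellF_integrand\<close>)
  then have "((\<lambda>x. integral {0..x} (ellF_integrand k)) has_real_derivative ellF_integrand k x) (at x)"
    using x by (simp add: at_within_Icc_at)
  moreover have "DERIV arcsin t :> inverse (sqrt (1 - t\<^sup>2))"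
    using t by (intro DERIV_arcsin) auto
  ultimately have "((\<lambda>t. integral {0..arcsin t} (ellF_integrand k)) has_real_derivative
      ellF_integrand k x * inverse (sqrt (1 - t\<^sup>2))) (at t)"
    unfolding x_def by (rule DERIV_chain2)
  moreover have "ellF_integrand k x * inverse (sqrt (1 - t\<^sup>2)) = 1 / sqrt ((1 - t\<^sup>2) * (1 - k\<^sup>2 * t\<^sup>2))"
    using t by (simp add: ellF_integrand_def x_def real_sqrt_mult divide_inverse)
  ultimately show ?thesis
    unfolding ellF_def[abs_def] by simp
qed

lemma ellF_0: "ellF k 0 = 0"
  by (simp add: ellF_def)

text \<open>The integrand of \<open>ellK\<close> is unbounded near 1; the fundamental theorem with
  derivatives in the open interval and continuity at its ends gives the improper integral.\<close>

lemma ellF_1: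
  assumes k: "0 \<le> k" "k < 1"
  shows "ellF k 1 = ellK k"
proof -
  have "((\<lambda>t. 1 / sqrt ((1 - t\<^sup>2) * (1 - k\<^sup>2 * t\<^sup>2))) has_integral (ellF k 1 - ellF k 0)) {0..1}"
    using DERIV_ellF[OF k] continuous_on_ellF[OF k]
    by (intro fundamental_theorem_of_calculus_interior) (auto simp: has_real_derivative_iff_has_vector_derivative)
  then show ?thesis
    unfolding ellK_def ellF_0 by (simp add: integral_unique)
qed

lemma ellK_eq_integral: "0 \<le> k \<Longrightarrow> k < 1 \<Longrightarrow> ellK k = integral {0..pi / 2} (ellF_integrand k)"
  using ellF_1[of k] by (simp add: ellF_def)

lemma ellK_strict_mono:
  assumes "0 < k" "k < l" "l < 1"
  shows "ellK k < ellK l"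
proof -
  have "ellF_integrand k \<theta> < ellF_integrand l \<theta>" if "\<theta> \<in> {0<..<pi / 2}" for \<theta>
  proof -
    have "sin \<theta> > 0" using that by (intro sin_gt_zero) auto
    moreover have "k\<^sup>2 < l\<^sup>2" using assms by (intro power_strict_mono) auto
    ultimately have "k\<^sup>2 * (sin \<theta>)\<^sup>2 < l\<^sup>2 * (sin \<theta>)\<^sup>2" by simp
    then show ?thesis
      unfolding ellF_integrand_def using assms ellF_radicand_pos[of k \<theta>] ellF_radicand_pos[of l \<theta>]
      by (intro divide_strict_left_mono mult_pos_pos) auto
  qed
  then have "integral {0..pi / 2} (ellF_integrand k) < integral {0..pi / 2} (ellF_integrand l)"
    by (intro integral_less_real continuous_on_ellF_integrand) (use assms pi_gt_zero in \<open>auto simp: not_le\<close>)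
  then show ?thesis
    using assms by (simp add: ellK_eq_integral)
qed

lemma ellK_pos:
  assumes "0 < k" "k < 1"
  shows "0 < ellK k"
proof -
  have "integral {0..pi / 2} (\<lambda>_. 0) < integral {0..pi / 2} (ellF_integrand k)"
    by (intro integral_less_real continuous_on_ellF_integrand)
      (use assms ellF_radicand_pos[of k] pi_gt_zero in \<open>auto simp: ellF_integrand_def not_le\<close>)
  then show ?thesis using assms by (simp add: ellK_eq_integral)
qed

text \<open>Along a solution \<open>f\<close> of Jacobi's equation that runs from 0 to 1,
  \<open>ellF k (f v) - A * v\<close> is constant. The derivative is asked for only in the interior,
  where \<open>f v < 1\<close> and \<open>ellF k\<close> is differentiable.\<close>

lemma ellK_eqI:
  assumes k: "0 < k" "k < 1" and L: "0 < L" and cont: "continuous_on {0..L} f" and f: "f 0 = 0" "f L = 1"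
    and f01: "\<And>v. 0 < v \<Longrightarrow> v < L \<Longrightarrow> 0 < f v \<and> f v < 1"
    and deriv: "\<And>v. 0 < v \<Longrightarrow> v < L \<Longrightarrow>
      (f has_real_derivative A * sqrt ((1 - (f v)\<^sup>2) * (1 - k\<^sup>2 * (f v)\<^sup>2))) (at v)"
  shows "ellK k = A * L"
proof -
  have im: "f v \<in> {0..1}" if "v \<in> {0..L}" for v
    using f01[of v] f that by (cases "v = 0"; cases "v = L") auto
  have "ellF k (f L) - A * L = ellF k (f 0) - A * 0"
  proof (rule DERIV_isconst_end[OF L, of "\<lambda>v. ellF k (f v) - A * v"])
    show "continuous_on {0..L} (\<lambda>v. ellF k (f v) - A * v)"
      by (intro continuous_intros continuous_on_compose2[OF continuous_on_ellF cont]) (use k im in auto)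
    show "((\<lambda>v. ellF k (f v) - A * v) has_real_derivative 0) (at v)" if v: "0 < v" "v < L" for v
    proof -
      define r where "r = sqrt ((1 - (f v)\<^sup>2) * (1 - k\<^sup>2 * (f v)\<^sup>2))"
      have fv: "0 < f v" "f v < 1" using f01[OF v] by auto
      have "(f v)\<^sup>2 < 1" "k\<^sup>2 * (f v)\<^sup>2 < 1"
        using fv k by (simp_all add: power_less_one_iff mult_strict_mono'[of "k\<^sup>2" 1 "(f v)\<^sup>2" 1, simplified])
      then have "r > 0" by (simp add: r_def)
      have "((\<lambda>v. ellF k (f v)) has_real_derivative 1 / r * (A * r)) (at v)"
        unfolding r_def using k fv by (intro DERIV_chain2[OF DERIV_ellF deriv] v) auto
      then have "((\<lambda>v. ellF k (f v) - A * v) has_real_derivative 1 / r * (A * r) - A) (at v)"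
        by (rule DERIV_diff) (auto intro!: derivative_eq_intros)
      then show ?thesis using \<open>r > 0\<close> by simp
    qed
  qed
  then show ?thesis
    using k ellF_1[of k] by (simp add: f ellF_0)
qed

lemma cnj_fourier: "cnj (fourier c w) = fourier (\<lambda>m. cnj (c m)) (- cnj w)"
  unfolding fourier_def infsum_cnj[symmetric] by (simp add: exp_cnj)

lemma fourier_uminus: "fourier (\<lambda>m. - c m) w = - fourier c w"
  unfolding fourier_def by (simp add: infsum_uminus)

lemma has_real_derivative_Re:
  "(f has_field_derivative D) (at (of_real v)) \<Longrightarrow> ((\<lambda>x. Re (f (of_real x))) has_real_derivative Re D) (at v)"
  by (intro has_field_derivative_Re has_vector_derivative_real_field)

section \<open>Real and imaginary axis\<close>

lemma has_sum_diff:
  fixes f g :: "'a \<Rightarrow> 'b :: real_normed_vector"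
  assumes "(f has_sum a) A" "(g has_sum b) A"
  shows "((\<lambda>x. f x - g x) has_sum (a - b)) A"
  unfolding diff_conv_add_uminus using assms by (intro has_sum_add) (simp_all add: has_sum_uminus)

text \<open>\<open>p\<close> is the positive square root of the nome, which is
  \<open>p^2\<close>.\<close>

locale real_nome =
  fixes p :: real
  assumes p_pos: "0 < p" and p_lt_1: "p < 1"

sublocale real_nome \<subseteq> nome "complex_of_real p"
  by unfold_locales (use p_pos p_lt_1 in auto)

context real_nome
begin

lemma b_eq: "b = - ln p"
  using p_pos by (simp add: b_def)

lemma cnj_coeff: "cnj (coeff_C p m) = coeff_C p m" "cnj (coeff_D p m) = coeff_D p m"
  "cnj (coeff_S p m) = - coeff_S p m"
  by (simp_all add: coeff_C_def coeff_D_def coeff_S_def sech_coeff_def csch_coeff_def)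

lemma coeff_minus: "coeff_C p (- m) = coeff_C p m" "coeff_D p (- m) = coeff_D p m"
  "coeff_S p (- m) = - coeff_S p m"
  by (simp_all add: coeff_C_def coeff_D_def coeff_S_def sech_coeff_minus csch_coeff_minus)

lemma cnj_SCD: "cnj (CC w) = CC (cnj w)" "cnj (DD w) = DD (cnj w)" "cnj (SS w) = SS (cnj w)"
  unfolding CC_def DD_def SS_def cnj_fourier fourier_minus by (simp_all add: cnj_coeff coeff_minus)

lemma SCD_minus: "CC (- w) = CC w" "DD (- w) = DD w" "SS (- w) = - SS w"
  unfolding CC_def DD_def SS_def fourier_minus by (simp_all add: coeff_minus fourier_uminus)

lemma real_axis:
  "CC (of_real v) = of_real (Re (CC (of_real v)))"
  "DD (of_real v) = of_real (Re (DD (of_real v)))"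
  "SS (of_real v) = of_real (Re (SS (of_real v)))"
  using cnj_SCD[of "of_real v"] by (simp_all add: complex_eq_iff)

definition rs :: "real \<Rightarrow> real" where "rs v = Re (SS (of_real v))"
definition rc :: "real \<Rightarrow> real" where "rc v = Re (CC (of_real v))"
definition rd :: "real \<Rightarrow> real" where "rd v = Re (DD (of_real v))"

lemma SCD_of_real: "SS (of_real v) = of_real (rs v)" "CC (of_real v) = of_real (rc v)" "DD (of_real v) = of_real (rd v)"
  unfolding rs_def rc_def rd_def by (rule real_axis)+

lemma SCD_0: "CC 0 = of_real (rc 0)" "DD 0 = of_real (rd 0)" "rs 0 = 0"
  using SCD_of_real[of 0] SCD_minus(3)[of 0] by auto

lemma DERIV_real_axis:
  "(rs has_real_derivative rc v * rd v) (at v)"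
  "(rc has_real_derivative - (rs v * rd v)) (at v)"
  "(rd has_real_derivative - (rs v * rc v)) (at v)"
  using has_real_derivative_Re[OF DERIV_SS, of v] has_real_derivative_Re[OF DERIV_CC, of v]
    has_real_derivative_Re[OF DERIV_DD, of v] b_pos
  unfolding rs_def[symmetric] rc_def[symmetric] rd_def[symmetric] by (simp_all add: SCD_of_real)

lemma real_axis_sqr:
  "(rc v)\<^sup>2 + (rs v)\<^sup>2 = (rc 0)\<^sup>2" "(rd v)\<^sup>2 + (rs v)\<^sup>2 = (rd 0)\<^sup>2"
proof -
  have "complex_of_real ((rc v)\<^sup>2 + (rs v)\<^sup>2) = of_real ((rc 0)\<^sup>2)"
    "complex_of_real ((rd v)\<^sup>2 + (rs v)\<^sup>2) = of_real ((rd 0)\<^sup>2)"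
    using CC_SS_sqr[of "of_real v"] DD_SS_sqr[of "of_real v"] b_pos
    by (simp_all add: SCD_of_real SCD_0 power2_eq_square)
  then show "(rc v)\<^sup>2 + (rs v)\<^sup>2 = (rc 0)\<^sup>2" "(rd v)\<^sup>2 + (rs v)\<^sup>2 = (rd 0)\<^sup>2"
    unfolding of_real_eq_iff by auto
qed

text \<open>By parity and complex conjugation, \<open>SS\<close> is purely imaginary on the
  imaginary axis and \<open>CC\<close>, \<open>DD\<close> are real there.\<close>

definition ims :: "real \<Rightarrow> real" where "ims y = Im (SS (\<i> * of_real y))"
definition imc :: "real \<Rightarrow> real" where "imc y = Re (CC (\<i> * of_real y))"
definition imd :: "real \<Rightarrow> real" where "imd y = Re (DD (\<i> * of_real y))"

lemma SCD_imaginary: "SS (\<i> * of_real y) = \<i> * of_real (ims y)" "CC (\<i> * of_real y) = of_real (imc y)"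
  "DD (\<i> * of_real y) = of_real (imd y)"
  using cnj_SCD[of "\<i> * of_real y"] SCD_minus[of "\<i> * of_real y"]
  by (simp_all add: ims_def imc_def imd_def complex_eq_iff)

lemma imaginary_0: "imc 0 = rc 0" "imd 0 = rd 0" "ims 0 = 0"
  using SCD_imaginary[of 0] SCD_0 SCD_of_real[of 0] by simp_all

lemma has_vector_derivative_imaginary_axis:
  "(f has_field_derivative D) (at (\<i> * of_real y)) \<Longrightarrow> ((\<lambda>y. f (\<i> * of_real y)) has_vector_derivative \<i> * D) (at y)"
proof -
  assume "(f has_field_derivative D) (at (\<i> * of_real y))"
  then have "((\<lambda>z. f (\<i> * z)) has_field_derivative D * \<i>) (at (of_real y))"
    by (rule DERIV_chain2) (auto intro!: derivative_eq_intros)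
  from has_vector_derivative_real_field[OF this] show ?thesis
    by (simp only: mult.commute)
qed

lemma DERIV_imaginary_axis:
  assumes "\<bar>y\<bar> < b"
  shows "(ims has_real_derivative imc y * imd y) (at y)"
    "(imc has_real_derivative ims y * imd y) (at y)"
    "(imd has_real_derivative ims y * imc y) (at y)"
proof -
  have y: "\<bar>Im (\<i> * complex_of_real y)\<bar> < b" using assms by simp
  show "(ims has_real_derivative imc y * imd y) (at y)"
    using has_field_derivative_Im[OF has_vector_derivative_imaginary_axis[OF DERIV_SS[OF y]]]
    unfolding ims_def[symmetric] by (simp add: SCD_imaginary)
  show "(imc has_real_derivative ims y * imd y) (at y)"
    using has_field_derivative_Re[OF has_vector_derivative_imaginary_axis[OF DERIV_CC[OF y]]]
    unfolding imc_def[symmetric] by (simp add: SCD_imaginary)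
  show "(imd has_real_derivative ims y * imc y) (at y)"
    using has_field_derivative_Re[OF has_vector_derivative_imaginary_axis[OF DERIV_DD[OF y]]]
    unfolding imd_def[symmetric] by (simp add: SCD_imaginary)
qed

lemma imaginary_axis_sqr:
  assumes "\<bar>y\<bar> < b"
  shows "(imc y)\<^sup>2 = (ims y)\<^sup>2 + (rc 0)\<^sup>2" "(imd y)\<^sup>2 = (ims y)\<^sup>2 + (rd 0)\<^sup>2"
proof -
  have "(\<i> * x) * (\<i> * x) = - (x * x)" for x :: complex
    by (simp add: algebra_simps)
  then have "complex_of_real ((imc y)\<^sup>2 - (ims y)\<^sup>2) = of_real ((rc 0)\<^sup>2)"
    "complex_of_real ((imd y)\<^sup>2 - (ims y)\<^sup>2) = of_real ((rd 0)\<^sup>2)"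
    using CC_SS_sqr[of "\<i> * of_real y"] DD_SS_sqr[of "\<i> * of_real y"] assms
    by (simp_all add: SCD_imaginary SCD_0 power2_eq_square)
  then show "(imc y)\<^sup>2 = (ims y)\<^sup>2 + (rc 0)\<^sup>2" "(imd y)\<^sup>2 = (ims y)\<^sup>2 + (rd 0)\<^sup>2"
    unfolding of_real_eq_iff by auto
qed

section \<open>Growth along the imaginary axis\<close>

definition rsech :: "int \<Rightarrow> real" where "rsech m = 2 / (p powi m + p powi (- m))"

lemma sech_coeff_of_real: "sech_coeff (of_real p) m = of_real (rsech m)"
  by (simp add: sech_coeff_def rsech_def)

lemma rsech_pos: "0 < rsech m"
  using p_pos by (simp add: rsech_def add_pos_pos)

lemma imaginary_axis_has_sum:
  assumes "\<bar>y\<bar> < b"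
  shows "((\<lambda>m. if odd m then rsech m * exp (- (m * y)) else 0) has_sum imc y) UNIV"
    "((\<lambda>m. if even m then rsech m * exp (- (m * y)) else 0) has_sum imd y) UNIV"
proof -
  have e: "exp (\<i> * of_int m * (\<i> * complex_of_real y)) = of_real (exp (- (m * y)))" for m
  proof -
    have "\<i> * of_int m * (\<i> * complex_of_real y) = of_real (- (m * y))"
      by (simp add: complex_eq_iff)
    then show ?thesis by (simp only: exp_of_real)
  qed
  have y: "\<bar>Im (\<i> * complex_of_real y)\<bar> < b" using assms by simp
  have "Re (coeff_C p m * of_real (exp (- (m * y)))) = (if odd m then rsech m * exp (- (m * y)) else 0)"
    "Re (coeff_D p m * of_real (exp (- (m * y)))) = (if even m then rsech m * exp (- (m * y)) else 0)" for m
    by (simp_all add: coeff_C_def coeff_D_def sech_coeff_of_real)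
  then show "((\<lambda>m. if odd m then rsech m * exp (- (m * y)) else 0) has_sum imc y) UNIV"
    "((\<lambda>m. if even m then rsech m * exp (- (m * y)) else 0) has_sum imd y) UNIV"
    using has_sum_Re[OF fourier_has_sum[OF strip_summable_C y]] has_sum_Re[OF fourier_has_sum[OF strip_summable_D y]]
    unfolding e imc_def imd_def CC_def DD_def by simp_all
qed

lemma imd_ge_1:
  assumes "\<bar>y\<bar> < b"
  shows "1 \<le> imd y"
proof -
  have "(\<Sum>m\<in>{0 :: int}. if even m then rsech m * exp (- (m * y)) else 0) \<le> imd y"
    by (rule has_sum_mono2[OF has_sum_finite imaginary_axis_has_sum(2)[OF assms]])
      (use rsech_pos in \<open>auto intro: less_imp_le\<close>)
  then show ?thesis by (simp add: rsech_def)
qed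

text \<open>No term of the series on the imaginary axis is negative. The \<open>N\<close> terms with
  \<open>m = - 1, - 3, ..., - (2 N - 1)\<close> are each at least \<open>(p * exp y)^(2 N)\<close>,
  because \<open>rsech m \<ge> p^|m|\<close>.\<close>

lemma imc_ge:
  assumes "0 \<le> y" "y < b"
  shows "N * (p * exp y) ^ (2 * N) \<le> imc y"
proof -
  define x where "x = p * exp y"
  have "p * exp y < p * exp b"
    using assms p_pos by simp
  then have x: "0 < x" "x < 1"
    using p_pos by (auto simp: x_def b_eq exp_minus)
  define A where "A = (\<lambda>i. - (2 * int i + 1)) ` {..<N}"
  have "N * x ^ (2 * N) = (\<Sum>i<N. x ^ (2 * N))"
    by simp
  also have "\<dots> \<le> (\<Sum>i<N. rsech (- (2 * int i + 1)) * exp ((2 * i + 1) * y))"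
  proof (rule sum_mono)
    fix i assume "i \<in> {..<N}"
    then have "x ^ (2 * N) \<le> x ^ (2 * i + 1)"
      using x by (intro power_decreasing) auto
    also have "\<dots> = p ^ (2 * i + 1) * exp ((2 * i + 1) * y)"
      unfolding x_def power_mult_distrib exp_of_nat_mult[symmetric] by simp
    also have "p ^ (2 * i + 1) \<le> rsech (- (2 * int i + 1))"
    proof -
      define u where "u = p ^ (2 * i + 1)"
      have u: "0 < u" "u \<le> 1" unfolding u_def using p_pos p_lt_1 by (simp_all del: power_Suc power_add add: power_le_one)
      have "rsech (- int k) = 2 / (1 / p ^ k + p ^ k)" for k
        by (simp add: rsech_def power_int_minus divide_inverse)
      from this[of "2 * i + 1"] have "rsech (- (2 * int i + 1)) = 2 / (1 / u + u)"
        by (simp add: u_def add.commute)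
      also have "\<dots> = u * (2 / (1 + u * u))"
        using u by (simp add: field_simps)
      also have "2 / (1 + u * u) \<ge> 1"
        using u mult_le_one[of u u] by (simp add: add_pos_pos)
      then have "u * (2 / (1 + u * u)) \<ge> u * 1"
        using u by (intro mult_left_mono) auto
      finally show ?thesis by (simp add: u_def)
    qed
    finally show "x ^ (2 * N) \<le> rsech (- (2 * int i + 1)) * exp ((2 * i + 1) * y)"
      by simp
  qed
  also have "\<dots> = (\<Sum>m\<in>A. if odd m then rsech m * exp (- (m * y)) else 0)"
    unfolding A_def by (subst sum.reindex) (auto simp: inj_on_def algebra_simps)
  also have "\<dots> \<le> imc y"
  proof (rule has_sum_mono2[OF has_sum_finite imaginary_axis_has_sum(1)])
    show "finite A" by (simp add: A_def)
  qed (use assms rsech_pos in \<open>auto intro: less_imp_le\<close>)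
  finally show ?thesis by (simp add: x_def)
qed

lemma imc_pos:
  assumes "0 \<le> y" "y < b"
  shows "0 < imc y"
proof -
  have "0 < 1 * (p * exp y) ^ (2 * 1)" using p_pos by simp
  also have "\<dots> \<le> imc y" using imc_ge[OF assms, of 1] by simp
  finally show ?thesis .
qed

lemma rc_0_pos: "0 < rc 0"
  using imc_pos[of 0] b_pos by (simp add: imaginary_0)

lemma rd_0_ge_1: "1 \<le> rd 0"
  using imd_ge_1[of 0] b_pos by (simp add: imaginary_0)

text \<open>As \<open>y\<close> tends to \<open>b\<close>, \<open>p * exp y\<close> tends to 1, so
  the lower bound eventually exceeds \<open>N / 2\<close> for each fixed \<open>N\<close>. This
  detects the pole without computing its principal part.\<close>

lemma imc_at_top: "filterlim imc at_top (at_left b)"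
  unfolding filterlim_at_top
proof
  fix Z :: real
  obtain N :: nat where N: "N > 2 * Z" using reals_Archimedean2 by blast
  have "((\<lambda>y. (p * exp y) ^ (2 * N)) \<longlongrightarrow> (p * exp b) ^ (2 * N)) (at_left b)"
    by (intro tendsto_intros)
  moreover have "p * exp b = 1"
    using p_pos by (simp add: b_eq exp_minus)
  ultimately have "((\<lambda>y. (p * exp y) ^ (2 * N)) \<longlongrightarrow> 1) (at_left b)"
    by simp
  then have "eventually (\<lambda>y. 1 / 2 < (p * exp y) ^ (2 * N)) (at_left b)"
    by (rule order_tendstoD) simp
  moreover have "eventually (\<lambda>y. 0 < y \<and> y < b) (at_left b)"
    using eventually_at_left_real[OF b_pos] by simp
  ultimately show "eventually (\<lambda>y. Z \<le> imc y) (at_left b)"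
  proof eventually_elim
    case (elim y)
    have "Z \<le> N * (1 / 2)" using N by simp
    also have "\<dots> \<le> N * (p * exp y) ^ (2 * N)" using elim by (intro mult_left_mono) auto
    also have "\<dots> \<le> imc y" using elim by (intro imc_ge) auto
    finally show ?case .
  qed
qed


section \<open>Positivity of the sine series\<close>

definition rcsch :: "int \<Rightarrow> real" where
  "rcsch m = (if odd m then 2 / (p powi (- m) - p powi m) else 0)"

lemma coeff_S_of_real: "coeff_S p m = - \<i> * of_real (rcsch m)"
  by (simp add: coeff_S_def csch_coeff_def rcsch_def)

lemma rcsch_minus: "rcsch (- m) = - rcsch m"
proof -
  have "2 / (x - y) = - (2 / (y - x))" for x y :: real
    unfolding minus_divide_right by simp
  from this[of "p powi m" "p powi (- m)"] show ?thesis by (simp add: rcsch_def)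
qed

lemma rcsch_nat: "odd k \<Longrightarrow> rcsch (int k) = 2 * p ^ k / (1 - p ^ (2 * k))"
proof -
  assume "odd k"
  have "1 / p ^ k - p ^ k = (1 - p ^ (2 * k)) / p ^ k"
    using p_pos by (simp add: diff_divide_distrib mult_2 power_add)
  then show ?thesis
    using \<open>odd k\<close> by (simp add: rcsch_def power_int_minus divide_inverse)
qed

lemma rcsch_less:
  assumes "odd k"
  shows "rcsch (int k + 2) < rcsch (int k)"
proof -
  have k: "k > 0" using assms by (cases k) auto
  have l: "p ^ (2 * k) < 1"
    using p_pos p_lt_1 k by (simp add: power_less_one_iff)
  have l2: "p ^ (2 * (k + 2)) \<le> p ^ (2 * k)"
    using p_pos p_lt_1 by (intro power_decreasing) auto
  have l3: "p ^ (k + 2) < p ^ k"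
    using p_pos p_lt_1 by (intro power_strict_decreasing) auto
  have "2 * p ^ (k + 2) / (1 - p ^ (2 * (k + 2))) \<le> 2 * p ^ (k + 2) / (1 - p ^ (2 * k))"
  proof (intro divide_left_mono mult_pos_pos)
    show "0 \<le> 2 * p ^ (k + 2)" using p_pos by simp
  qed (use l l2 in linarith)+
  also have "\<dots> < 2 * p ^ k / (1 - p ^ (2 * k))"
    using l l3 by (intro divide_strict_right_mono) linarith+
  finally have "rcsch (int (k + 2)) < rcsch (int k)"
    unfolding rcsch_nat[OF assms] using assms by (subst rcsch_nat) auto
  then show ?thesis by (simp add: add.commute)
qed

definition drcsch :: "int \<Rightarrow> real" where "drcsch m = rcsch (m - 1) - rcsch (m + 1)"

lemma drcsch_pos:
  assumes "j > 0"
  shows "0 < drcsch (int (2 * j))"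
proof -
  obtain i where i: "j = Suc i" using assms by (cases j) auto
  have "int (2 * j) - 1 = int (2 * i + 1)" "int (2 * j) + 1 = int (2 * i + 1) + 2"
    unfolding i by simp_all
  note e = this
  show ?thesis unfolding drcsch_def e diff_gt_0_iff_gt by (rule rcsch_less) simp
qed

text \<open>Index 0 is excluded because there the difference is \<open>- 2 * rcsch 1\<close>, which
  is negative.\<close>

lemma drcsch_nonneg: "m \<noteq> 0 \<Longrightarrow> 0 \<le> drcsch m"
proof -
  assume m: "m \<noteq> 0"
  have sym: "drcsch (- m) = drcsch m"
    using rcsch_minus[of "m + 1"] rcsch_minus[of "m - 1"] by (simp add: drcsch_def)
  have "0 \<le> drcsch \<bar>m\<bar>"
  proof (cases "even m")
    case True
    define j where "j = nat (\<bar>m\<bar> div 2)"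
    have e: "\<bar>m\<bar> = int (2 * j)" unfolding j_def using True by simp
    have "j > 0" using e m by (cases j) auto
    then show ?thesis unfolding e by (intro less_imp_le drcsch_pos)
  next
    case False
    then show ?thesis by (simp add: drcsch_def rcsch_def)
  qed
  then show ?thesis using sym by (cases "m \<ge> 0") simp_all
qed

text \<open>Multiplying the sine series of \<open>rs\<close> by \<open>2 sin v\<close> gives a cosine series whose coefficients
  are nonnegative up to the constant one; subtracting its value \<open>0\<close> at \<open>v = 0\<close> makes every term nonnegative.\<close>

lemma sin_rs_has_sum: "((\<lambda>m. drcsch m * cos (m * v)) has_sum (- (2 * sin v * rs v))) UNIV"
proof -
  define f where "f = (\<lambda>m. of_real (rcsch m) * exp (\<i> * of_int m * complex_of_real v))"
  have "((\<lambda>m. \<i> * (coeff_S p m * exp (\<i> * of_int m * complex_of_real v))) has_sum \<i> * SS (of_real v)) UNIV"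
    unfolding SS_def using b_pos by (intro has_sum_cmult_right fourier_has_sum[OF strip_summable_S]) simp
  then have f: "(f has_sum \<i> * SS (of_real v)) UNIV"
    unfolding f_def coeff_S_of_real by (simp add: mult.assoc imaginary_unit_mult)
  have bij: "bij_betw (\<lambda>m :: int. m + a) UNIV UNIV" for a
    by (rule bij_betw_byWitness[where f' = "\<lambda>m. m - a"]) auto
  have sh: "((\<lambda>m. f (m - 1)) has_sum \<i> * SS (of_real v)) UNIV" "((\<lambda>m. f (m + 1)) has_sum \<i> * SS (of_real v)) UNIV"
    using has_sum_reindex_bij_betw[OF bij[of "- 1"], of f] has_sum_reindex_bij_betw[OF bij[of 1], of f] f by simp_all
  have "((\<lambda>m. exp (\<i> * of_real v) * f (m - 1) - exp (- (\<i> * of_real v)) * f (m + 1)) has_sum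
      (exp (\<i> * of_real v) * (\<i> * SS (of_real v)) - exp (- (\<i> * of_real v)) * (\<i> * SS (of_real v)))) UNIV"
    by (intro has_sum_diff has_sum_cmult_right sh)
  moreover have "exp (\<i> * of_real v) * f (m - 1) - exp (- (\<i> * of_real v)) * f (m + 1)
      = of_real (drcsch m) * exp (\<i> * of_real (m * v))" for m
  proof -
    have "exp (\<i> * of_real v) * exp (\<i> * of_int (m - 1) * complex_of_real v) = exp (\<i> * of_real (m * v))"
      "exp (- (\<i> * of_real v)) * exp (\<i> * of_int (m + 1) * complex_of_real v) = exp (\<i> * of_real (m * v))"
      unfolding exp_add[symmetric] by (simp_all add: algebra_simps)
    note e = this
    have "exp (\<i> * of_real v) * f (m - 1) = of_real (rcsch (m - 1)) * exp (\<i> * of_real (m * v))"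
      "exp (- (\<i> * of_real v)) * f (m + 1) = of_real (rcsch (m + 1)) * exp (\<i> * of_real (m * v))"
      unfolding f_def by (subst e(1)[symmetric], rule mult.left_commute) (subst e(2)[symmetric], rule mult.left_commute)
    then show ?thesis
      by (simp only: drcsch_def of_real_diff left_diff_distrib)
  qed
  moreover have "exp (\<i> * of_real v) - exp (- (\<i> * of_real v)) = 2 * \<i> * of_real (sin v)"
    unfolding complex_eq_iff by (simp add: Re_exp Im_exp)
  note e = this
  have "exp (\<i> * of_real v) * (\<i> * SS (of_real v)) - exp (- (\<i> * of_real v)) * (\<i> * SS (of_real v))
      = of_real (- (2 * sin v * rs v))"
    unfolding left_diff_distrib[symmetric] e SCD_of_real by (simp add: complex_eq_iff)
  ultimately have "((\<lambda>m. of_real (drcsch m) * exp (\<i> * of_real (m * v))) has_sum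
      complex_of_real (- (2 * sin v * rs v))) UNIV"
    by simp
  from has_sum_Re[OF this] show ?thesis
    by (simp add: Re_exp)
qed

lemma rs_pos:
  assumes "0 < v" "v < pi"
  shows "0 < rs v"
proof -
  have "sin v > 0" using assms by (rule sin_gt_zero)
  have "((\<lambda>m. drcsch m * cos (m * 0) - drcsch m * cos (m * v)) has_sum
      (- (2 * sin 0 * rs 0) - (- (2 * sin v * rs v)))) UNIV"
    by (intro has_sum_diff sin_rs_has_sum)
  then have s: "((\<lambda>m. drcsch m * (1 - cos (m * v))) has_sum (2 * sin v * rs v)) UNIV"
    by (simp add: right_diff_distrib)
  \<comment> \<open>The term \<open>m = 2\<close> alone bounds the sum from below by a positive
    multiple of \<open>sin v\<close> squared.\<close>
  have "(\<Sum>m\<in>{2 :: int}. drcsch m * (1 - cos (m * v))) \<le> 2 * sin v * rs v"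
  proof (rule has_sum_mono2[OF has_sum_finite s])
    show "0 \<le> drcsch m * (1 - cos (m * v))" for m
      using drcsch_nonneg[of m] by (cases "m = 0") simp_all
  qed simp_all
  moreover have "1 - cos (2 * v) = 2 * (sin v)\<^sup>2"
    by (simp add: cos_double_sin)
  then have "0 < drcsch 2 * (1 - cos (2 * v))"
    using drcsch_pos[of 1] \<open>sin v > 0\<close> by simp
  ultimately have "0 < sin v * rs v"
    by simp
  then show ?thesis using \<open>sin v > 0\<close> by (simp add: zero_less_mult_iff)
qed


text \<open>For odd \<open>m\<close> the exponentials at \<open>pi / 2\<close> and
  \<open>- pi / 2\<close> are opposite, so \<open>CC (pi / 2) = - CC (- pi / 2)\<close>, while
  \<open>CC\<close> is even.\<close>

lemma rc_pi_half: "rc (pi / 2) = 0"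
proof -
  have "fourier (coeff_C p) (of_real (pi / 2)) = fourier (\<lambda>m. - coeff_C p m) (- of_real (pi / 2))"
    unfolding fourier_def
  proof (rule infsum_cong)
    fix m :: int
    show "coeff_C p m * exp (\<i> * of_int m * of_real (pi / 2)) = - coeff_C p m * exp (\<i> * of_int m * - of_real (pi / 2))"
    proof (cases "odd m")
      case True
      then obtain j where j: "m = 2 * j + 1" by (elim oddE)
      have "\<i> * of_int m * complex_of_real (pi / 2) = \<i> * of_int m * - of_real (pi / 2) + \<i> * of_real pi * of_int m"
        by (simp add: algebra_simps)
      also have "\<dots> = \<i> * of_int m * - of_real (pi / 2) + \<i> * of_real pi + of_int j * (of_real (2 * pi) * \<i>)"
        by (simp add: j algebra_simps)
      finally have e: "\<i> * of_int m * complex_of_real (pi / 2)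
          = \<i> * of_int m * - of_real (pi / 2) + \<i> * of_real pi + of_int j * (of_real (2 * pi) * \<i>)" .
      have "exp (\<i> * of_int m * complex_of_real (pi / 2)) = - exp (\<i> * of_int m * - of_real (pi / 2))"
        unfolding e exp_add exp_pi_i' by (simp add: exp_integer_2pi mult_ac)
      then show ?thesis by simp
    qed (simp add: coeff_C_def)
  qed
  then have "CC (of_real (pi / 2)) = - CC (- of_real (pi / 2))"
    unfolding CC_def fourier_uminus .
  then have "CC (of_real (pi / 2)) = 0"
    unfolding SCD_minus by simp
  then show ?thesis by (simp add: rc_def)
qed

text \<open>The square of \<open>rd\<close> never falls below the difference of squares in
  \<open>gap\<close>, so \<open>rd\<close> keeps its sign. The assumption \<open>gap\<close> will
  come from the positivity of \<open>rtheta3\<close> at the negative nome.\<close>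

lemma rd_pos:
  assumes gap: "(rc 0)\<^sup>2 < (rd 0)\<^sup>2" and v: "0 \<le> v"
  shows "0 < rd v"
proof (rule ccontr)
  have nz: "rd u \<noteq> 0" for u
  proof -
    have "(rs u)\<^sup>2 \<le> (rc 0)\<^sup>2" using real_axis_sqr(1)[of u] by (metis le_add_same_cancel2 zero_le_power2)
    then show ?thesis using real_axis_sqr(2)[of u] gap by auto
  qed
  assume "\<not> 0 < rd v"
  then have "\<exists>u\<ge>0. u \<le> v \<and> rd u = 0"
    using rd_0_ge_1 v by (intro IVT2) (auto intro: DERIV_isCont DERIV_real_axis)
  then show False using nz by auto
qed

lemma rc_pos:
  assumes gap: "(rc 0)\<^sup>2 < (rd 0)\<^sup>2" and v: "0 \<le> v" "v < pi / 2"
  shows "0 < rc v"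
proof -
  have "rc (pi / 2) < rc v"
  proof (rule DERIV_neg_imp_decreasing_open[OF v(2)])
    show "\<exists>y. (rc has_real_derivative y) (at u) \<and> y < 0" if "v < u" "u < pi / 2" for u
      using DERIV_real_axis(2)[of u] rs_pos[of u] rd_pos[OF gap, of u] that v by (intro exI[of _ "- (rs u * rd u)"]) auto
    show "continuous_on {v..pi / 2} rc"
      by (intro DERIV_continuous_on) (rule DERIV_subset[OF DERIV_real_axis(2)], simp)
  qed
  then show ?thesis by (simp add: rc_pi_half)
qed

text \<open>\<open>rs v / rc 0\<close> is \<open>sn\<close> for the modulus
  \<open>rc 0 / rd 0\<close>; it rises from 0 to 1 on the quarter period
  \<open>pi / 2\<close>.\<close>

lemma ellK_real_axis:
  assumes gap: "(rc 0)\<^sup>2 < (rd 0)\<^sup>2"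
  shows "ellK (rc 0 / rd 0) = rd 0 * (pi / 2)"
proof (rule ellK_eqI[where f = "\<lambda>v. rs v / rc 0"])
  have c: "0 < rc 0" "rc 0 < rd 0" "0 < rd 0"
    using rc_0_pos rd_0_ge_1 gap power2_less_imp_less[OF gap] by auto
  then show "0 < rc 0 / rd 0" "rc 0 / rd 0 < 1" by simp_all
  show "0 < pi / 2" by simp
  show "continuous_on {0..pi / 2} (\<lambda>v. rs v / rc 0)"
    using c by (intro continuous_intros DERIV_continuous_on) (rule DERIV_subset[OF DERIV_real_axis(1)], simp_all)
  show "rs 0 / rc 0 = 0" by (simp add: SCD_0)
  have "(rs (pi / 2))\<^sup>2 = (rc 0)\<^sup>2"
    using real_axis_sqr(1)[of "pi / 2"] by (simp add: rc_pi_half)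
  then show "rs (pi / 2) / rc 0 = 1"
    using c rs_pos[of "pi / 2"] by (simp add: power2_eq_iff_nonneg)
  fix v assume v: "0 < v" "v < pi / 2"
  have pos: "0 < rs v" "0 < rc v" "0 < rd v"
    using v rs_pos[of v] rc_pos[OF gap, of v] rd_pos[OF gap, of v] by auto
  have "(rs v)\<^sup>2 < (rc 0)\<^sup>2"
    using real_axis_sqr(1)[of v] pos by (metis less_add_same_cancel2 zero_less_power)
  then have "rs v < rc 0" using c by (intro power2_less_imp_less[of "rs v"]) auto
  then show "0 < rs v / rc 0 \<and> rs v / rc 0 < 1"
    using pos c by simp
  have "1 - (rs v / rc 0)\<^sup>2 = ((rc 0)\<^sup>2 - (rs v)\<^sup>2) / (rc 0)\<^sup>2"
    using c by (simp add: power_divide diff_divide_distrib)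
  also have "(rc 0)\<^sup>2 - (rs v)\<^sup>2 = (rc v)\<^sup>2"
    using real_axis_sqr(1)[of v] by simp
  finally have 1: "1 - (rs v / rc 0)\<^sup>2 = (rc v / rc 0)\<^sup>2"
    by (simp add: power_divide)
  have "1 - (rc 0 / rd 0)\<^sup>2 * (rs v / rc 0)\<^sup>2 = ((rd 0)\<^sup>2 - (rs v)\<^sup>2) / (rd 0)\<^sup>2"
    using c by (simp add: power_divide diff_divide_distrib)
  also have "(rd 0)\<^sup>2 - (rs v)\<^sup>2 = (rd v)\<^sup>2"
    using real_axis_sqr(2)[of v] by simp
  finally have 2: "1 - (rc 0 / rd 0)\<^sup>2 * (rs v / rc 0)\<^sup>2 = (rd v / rd 0)\<^sup>2"
    by (simp add: power_divide)
  have "rd 0 * sqrt ((1 - (rs v / rc 0)\<^sup>2) * (1 - (rc 0 / rd 0)\<^sup>2 * (rs v / rc 0)\<^sup>2)) = rc v * rd v / rc 0"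
    unfolding 1 2 using pos c by (simp add: real_sqrt_mult)
  moreover have "((\<lambda>v. rs v / rc 0) has_real_derivative rc v * rd v / rc 0) (at v)"
    by (rule DERIV_cdivide[OF DERIV_real_axis(1)])
  ultimately show "((\<lambda>v. rs v / rc 0) has_real_derivative
      rd 0 * sqrt ((1 - (rs v / rc 0)\<^sup>2) * (1 - (rc 0 / rd 0)\<^sup>2 * (rs v / rc 0)\<^sup>2))) (at v)"
    by simp
qed

lemma ims_pos:
  assumes "0 < y" "y < b"
  shows "0 < ims y"
proof -
  have "ims 0 < ims y"
  proof (rule DERIV_pos_imp_increasing[OF assms(1)])
    fix u assume u: "0 \<le> u" "u \<le> y"
    then have "(ims has_real_derivative imc u * imd u) (at u)" "0 < imc u" "1 \<le> imd u"
      using assms by (auto intro!: DERIV_imaginary_axis imc_pos imd_ge_1)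
    then show "\<exists>d. (ims has_real_derivative d) (at u) \<and> 0 < d"
      by (intro exI[of _ "imc u * imd u"]) auto
  qed
  then show ?thesis by (simp add: imaginary_0)
qed

text \<open>Jacobi's imaginary transformation:
  \<open>sn(\<i> u, k) / cn(\<i> u, k) = \<i> sn(u, k')\<close>. Thus \<open>ims / imc\<close>
  satisfies the equation for the complementary modulus \<open>B / rd 0\<close>, and it reaches 1 at
  the pole, at height \<open>b\<close>.\<close>

lemma ellK_imaginary_axis:
  assumes B: "0 < B" "B\<^sup>2 = (rd 0)\<^sup>2 - (rc 0)\<^sup>2"
  shows "ellK (B / rd 0) = rd 0 * b"
proof -
  define \<tau> where "\<tau> y = ims y / imc y" for y
  \<comment> \<open>At the pole the quotient is replaced by its limit 1.\<close>
  define f where "f y = (if y < b then \<tau> y else 1)" for y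
  have c: "0 < rc 0" "0 < rd 0"
    using rc_0_pos rd_0_ge_1 by auto
  have B_less: "B < rd 0"
    using B c by (intro power2_less_imp_less[of B]) auto
  have \<tau>_sqr: "1 - (\<tau> y)\<^sup>2 = (rc 0 / imc y)\<^sup>2" if "0 \<le> y" "y < b" for y
  proof -
    have "1 - (\<tau> y)\<^sup>2 = ((imc y)\<^sup>2 - (ims y)\<^sup>2) / (imc y)\<^sup>2"
      using imc_pos[OF that] by (simp add: \<tau>_def power_divide diff_divide_distrib)
    then show ?thesis
      using imaginary_axis_sqr(1)[of y] that by (simp add: power_divide)
  qed
  have bounds: "0 \<le> \<tau> y \<and> \<tau> y < 1" if y: "0 \<le> y" "y < b" for y
  proof -
    have "0 \<le> ims y" using ims_pos[of y] y by (cases "y = 0") (simp_all add: imaginary_0)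
    then have "0 \<le> \<tau> y" using imc_pos[OF y] by (simp add: \<tau>_def)
    moreover have "(\<tau> y)\<^sup>2 < 1\<^sup>2"
    proof -
      have "0 < (rc 0 / imc y)\<^sup>2" using c imc_pos[OF y] by (intro zero_less_power divide_pos_pos)
      then show ?thesis unfolding \<tau>_sqr[OF y, symmetric] by simp
    qed
    ultimately show ?thesis using power2_less_imp_less[of "\<tau> y" 1] by simp
  qed
  have deriv: "(\<tau> has_real_derivative rd 0 * sqrt ((1 - (\<tau> y)\<^sup>2) * (1 - (B / rd 0)\<^sup>2 * (\<tau> y)\<^sup>2))) (at y)"
    if y: "0 \<le> y" "y < b" for y
  proof -
    have pos: "0 < imc y" "0 < imd y" using imc_pos[OF y] imd_ge_1[of y] y by auto
    have sq: "(imc y)\<^sup>2 = (ims y)\<^sup>2 + (rc 0)\<^sup>2" "(imd y)\<^sup>2 = (ims y)\<^sup>2 + (rd 0)\<^sup>2"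
      using imaginary_axis_sqr[of y] y by auto
    have "1 - (B / rd 0)\<^sup>2 * (\<tau> y)\<^sup>2 = ((rd 0)\<^sup>2 * (imc y)\<^sup>2 - B\<^sup>2 * (ims y)\<^sup>2) / (rd 0 * imc y)\<^sup>2"
      using c pos by (simp add: \<tau>_def power_divide power_mult_distrib diff_divide_distrib)
    also have "(rd 0)\<^sup>2 * (imc y)\<^sup>2 - B\<^sup>2 * (ims y)\<^sup>2 = (rc 0 * imd y)\<^sup>2"
      unfolding sq B power_mult_distrib by (simp add: algebra_simps)
    finally have 2: "1 - (B / rd 0)\<^sup>2 * (\<tau> y)\<^sup>2 = (rc 0 * imd y / (rd 0 * imc y))\<^sup>2"
      by (simp add: power_divide)
    have "rd 0 * sqrt ((1 - (\<tau> y)\<^sup>2) * (1 - (B / rd 0)\<^sup>2 * (\<tau> y)\<^sup>2)) = (rc 0)\<^sup>2 * imd y / (imc y)\<^sup>2"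
    proof -
      have "(1 - (\<tau> y)\<^sup>2) * (1 - (B / rd 0)\<^sup>2 * (\<tau> y)\<^sup>2) = ((rc 0)\<^sup>2 * imd y / ((imc y)\<^sup>2 * rd 0))\<^sup>2"
        unfolding \<tau>_sqr[OF y] 2 by (simp add: power_divide power_mult_distrib power2_eq_square mult_ac)
      note e = this
      have "0 \<le> (rc 0)\<^sup>2 * imd y / ((imc y)\<^sup>2 * rd 0)" using pos c by simp
      then show ?thesis using c by (simp only: e real_sqrt_abs abs_of_nonneg) simp
    qed
    moreover have "((\<lambda>y. ims y / imc y) has_real_derivative
        (imc y * imd y * imc y - ims y * (ims y * imd y)) / (imc y * imc y)) (at y)"
      using y pos by (intro DERIV_divide DERIV_imaginary_axis) auto
    moreover have "imc y * imd y * imc y - ims y * (ims y * imd y) = (rc 0)\<^sup>2 * imd y"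
    proof -
      have "imc y * imd y * imc y - ims y * (ims y * imd y) = ((imc y)\<^sup>2 - (ims y)\<^sup>2) * imd y"
        by (simp add: power2_eq_square algebra_simps)
      then show ?thesis by (simp add: sq)
    qed
    ultimately show ?thesis
      unfolding \<tau>_def[abs_def] by (simp add: power2_eq_square)
  qed
  \<comment> \<open>One minus the square of \<open>\<tau>\<close> is the square of
    \<open>rc 0 / imc y\<close>, which tends to 0 because \<open>imc\<close> tends to
    infinity.\<close>
  have "(f \<longlongrightarrow> 1) (at_left b)"
  proof -
    have "((\<lambda>y. sqrt (1 - (rc 0 / imc y)\<^sup>2)) \<longlongrightarrow> sqrt (1 - 0\<^sup>2)) (at_left b)"
      by (intro tendsto_intros real_tendsto_divide_at_top[OF tendsto_const imc_at_top])
    then have "((\<lambda>y. sqrt (1 - (rc 0 / imc y)\<^sup>2)) \<longlongrightarrow> 1) (at_left b)"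
      by simp
    moreover have "eventually (\<lambda>y. 0 < y \<and> y < b) (at_left b)"
      using eventually_at_left_real[OF b_pos] by simp
    then have "eventually (\<lambda>y. sqrt (1 - (rc 0 / imc y)\<^sup>2) = f y) (at_left b)"
    proof eventually_elim
      case (elim y)
      then have "1 - (rc 0 / imc y)\<^sup>2 = (\<tau> y)\<^sup>2" using \<tau>_sqr[of y] by simp
      then show ?case using elim bounds[of y] by (simp add: f_def)
    qed
    ultimately show ?thesis by (rule Lim_transform_eventually)
  qed
  have f_deriv: "(f has_real_derivative rd 0 * sqrt ((1 - (f y)\<^sup>2) * (1 - (B / rd 0)\<^sup>2 * (f y)\<^sup>2))) (at y)"
    if y: "0 \<le> y" "y < b" for y
  proof -
    have "eventually (\<lambda>u. u < b) (nhds y)"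
      using y by (intro eventually_nhds_in_open[of "{..<b}", simplified]) auto
    then have "eventually (\<lambda>u. f u = \<tau> u) (nhds y)"
      by eventually_elim (simp add: f_def)
    note cong = DERIV_cong_ev[OF refl this refl]
    have "f y = \<tau> y" using y by (simp add: f_def)
    then show ?thesis using deriv[OF y] cong by metis
  qed
  show ?thesis
  proof (rule ellK_eqI[where f = f])
    show "0 < B / rd 0" "B / rd 0 < 1" using B B_less c by simp_all
    show "0 < b" by (rule b_pos)
    show "f 0 = 0" "f b = 1" using b_pos by (simp_all add: f_def \<tau>_def imaginary_0)
    show "continuous_on {0..b} f"
    proof (rule continuous_on_IccI)
      have "isCont f 0" using f_deriv[of 0] b_pos by (intro DERIV_isCont) auto
      then show "(f \<longlongrightarrow> f 0) (at_right 0)"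
        by (auto simp: isCont_def filterlim_at_split)
      show "(f \<longlongrightarrow> f b) (at_left b)" using \<open>(f \<longlongrightarrow> 1) (at_left b)\<close> by (simp add: f_def)
      show "f \<midarrow>y\<rightarrow> f y" if "0 < y" "y < b" for y
        using DERIV_isCont[OF f_deriv[of y]] that by (simp add: isCont_def)
    qed (rule b_pos)
    show "0 < f v \<and> f v < 1" if "0 < v" "v < b" for v
      using that bounds[of v] ims_pos[of v] imc_pos[of v] by (simp add: f_def \<tau>_def)
    show "(f has_real_derivative rd 0 * sqrt ((1 - (f v)\<^sup>2) * (1 - (B / rd 0)\<^sup>2 * (f v)\<^sup>2))) (at v)"
      if "0 < v" "v < b" for v
      using f_deriv[of v] that by simp
  qed
qed

end

definition rtheta3 :: "real \<Rightarrow> real" where "rtheta3 x = 1 + 4 * lambert_N 0 x"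

lemma theta3_of_real: "\<bar>x\<bar> < 1 \<Longrightarrow> theta3 (of_real x) = of_real (rtheta3 x)"
  by (simp add: theta3_def rtheta3_def clambert_N_eq)

lemma rtheta3_duplication:
  assumes "0 < p" "p < 1"
  shows "rtheta3 p + rtheta3 (- p) = 2 * rtheta3 (p\<^sup>2)" "rtheta3 p - rtheta3 (- p) = 8 * lambert_T 0 (p\<^sup>2)"
proof -
  have "\<bar>p\<^sup>2\<bar> < 1" using assms by (simp add: power_less_one_iff)
  then have "complex_of_real (rtheta3 p + rtheta3 (- p)) = of_real (2 * rtheta3 (p\<^sup>2))"
    "complex_of_real (rtheta3 p - rtheta3 (- p)) = of_real (8 * lambert_T 0 (p\<^sup>2))"
    using theta3_duplication[of "of_real p"] theta3_of_real[of p] theta3_of_real[of "- p"] theta3_of_real[of "p\<^sup>2"]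
      clambert_T_eq[of p 0] assms by simp_all
  then show "rtheta3 p + rtheta3 (- p) = 2 * rtheta3 (p\<^sup>2)" "rtheta3 p - rtheta3 (- p) = 8 * lambert_T 0 (p\<^sup>2)"
    unfolding of_real_eq_iff .
qed

context real_nome
begin

lemma p_sqr_lt_1: "\<bar>p\<^sup>2\<bar> < 1"
  using p_pos p_lt_1 by (simp add: power_less_one_iff)

lemma rd_0: "rd 0 = rtheta3 (p\<^sup>2)"
proof -
  have "complex_of_real (rd 0) = of_real (rtheta3 (p\<^sup>2))"
    using DD_0 theta3_of_real[OF p_sqr_lt_1] by (simp add: SCD_0)
  then show ?thesis unfolding of_real_eq_iff .
qed

lemma rc_0: "rc 0 = 4 * lambert_T 0 (p\<^sup>2)"
proof -
  have "complex_of_real (rc 0) = of_real (4 * lambert_T 0 (p\<^sup>2))"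
    using CC_0 clambert_T_eq[OF p_pos p_lt_1, of 0] by (simp add: SCD_0)
  then show ?thesis unfolding of_real_eq_iff .
qed

lemma rtheta3_sqr_diff: "(rtheta3 (p\<^sup>2))\<^sup>2 - (rtheta3 (- p\<^sup>2))\<^sup>2 = (4 * lambert_T 0 (p\<^sup>2))\<^sup>2"
proof -
  have "complex_of_real ((rtheta3 (p\<^sup>2))\<^sup>2 - (rtheta3 (- p\<^sup>2))\<^sup>2) = of_real ((4 * lambert_T 0 (p\<^sup>2))\<^sup>2)"
    using theta3_sqr_diff clambert_T_eq[OF p_pos p_lt_1, of 0] theta3_of_real[of "p\<^sup>2"] theta3_of_real[of "- p\<^sup>2"] p_sqr_lt_1
    by simp
  then show ?thesis unfolding of_real_eq_iff .
qed

lemma rtheta3_prod: "rtheta3 p * rtheta3 (- p) = (rtheta3 (- p\<^sup>2))\<^sup>2"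
proof -
  have "complex_of_real (rtheta3 p * rtheta3 (- p)) = of_real ((rtheta3 (- p\<^sup>2))\<^sup>2)"
    using theta3_prod theta3_of_real[of p] theta3_of_real[of "- p"] theta3_of_real[of "- p\<^sup>2"] p_sqr_lt_1 p_pos p_lt_1
    by simp
  then show ?thesis unfolding of_real_eq_iff .
qed

end

lemma rtheta3_ge_1:
  assumes "0 < x" "x < 1"
  shows "1 \<le> rtheta3 x"
proof -
  interpret real_nome "sqrt x" by unfold_locales (use assms in auto)
  show ?thesis using rd_0_ge_1 rd_0 assms by simp
qed

text \<open>A zero of \<open>rtheta3\<close> at \<open>- x\<close> would propagate to \<open>- x\<^sup>2\<close>, \<open>- x\<^sup>4\<close> and so on by \<open>rtheta3_prod\<close>, and each time
  \<open>rtheta3_duplication\<close> would double the value at \<open>x\<close>.\<close>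

lemma rtheta3_minus_pos:
  assumes "0 < x" "x < 1"
  shows "0 < rtheta3 (- x)"
proof -
  have nz: "rtheta3 (- x) \<noteq> 0" if "0 < x" "x < 1" for x
  proof
    assume zero: "rtheta3 (- x) = 0"
    have "2 ^ n \<le> rtheta3 x" if "0 < x" "x < 1" "rtheta3 (- x) = 0" for n x
      using that
    proof (induction n arbitrary: x)
      case 0
      then show ?case using rtheta3_ge_1 by simp
    next
      case (Suc n)
      interpret real_nome x by unfold_locales (use Suc in auto)
      have "0 < x\<^sup>2" "x\<^sup>2 < 1" "rtheta3 (- x\<^sup>2) = 0"
        using rtheta3_prod Suc.prems by (simp_all add: power_less_one_iff)
      from Suc.IH[OF this] show ?case
        using rtheta3_duplication(1)[of x] Suc.prems by simp
    qed
    then have "2 ^ n \<le> rtheta3 x" for n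
      using that zero by blast
    moreover obtain n where "rtheta3 x < 2 ^ n"
      using real_arch_pow[of 2] by auto
    ultimately show False using not_le by blast
  qed
  interpret real_nome x by unfold_locales (use assms in auto)
  \<comment> \<open>The sign needs no continuity argument: the product is the square of a value that
    is nonzero by \<open>nz\<close>.\<close>
  have "0 < rtheta3 x * rtheta3 (- x)"
    unfolding rtheta3_prod using nz[of "x\<^sup>2"] assms by (simp add: power_less_one_iff)
  then show ?thesis using rtheta3_ge_1[OF assms] by (simp add: zero_less_mult_iff)
qed

lemma ellK_nome:
  fixes k k' z q :: real
  assumes k: "0 < k" "k < 1"
    and k': "k' = sqrt (1 - k\<^sup>2)"
    and z: "z = 2 * ellK k / pi"
    and q: "q = exp (- pi * ellK k' / ellK k)"
  shows "0 < q" "q < 1" "z = rtheta3 q" "k * z = 4 * lambert_T 0 q" "k' * z = rtheta3 (- q)"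
proof -
  have k'_sqr: "k'\<^sup>2 = 1 - k\<^sup>2" and k'_01: "0 < k'" "k' < 1"
    using k by (auto simp: k' power_less_one_iff power_le_one)
  have K: "0 < ellK k" "0 < ellK k'"
    using k k'_01 by (auto intro: ellK_pos)
  show q01: "0 < q" "q < 1"
    using K by (simp_all add: q)
  interpret real_nome "sqrt q" by unfold_locales (use q01 in auto)
  define A B C where "A = rtheta3 q" and "B = rtheta3 (- q)" and "C = 4 * lambert_T 0 q"
  have AC: "rd 0 = A" "rc 0 = C"
    using rd_0 rc_0 q01 by (simp_all add: A_def C_def)
  have B: "0 < B" using rtheta3_minus_pos[OF q01] by (simp add: B_def)
  have sq: "B\<^sup>2 = A\<^sup>2 - C\<^sup>2" using rtheta3_sqr_diff q01 by (simp add: A_def B_def C_def)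
  have A: "1 \<le> A" using rd_0_ge_1 by (simp add: AC)
  have C: "0 < C" using rc_0_pos by (simp add: AC)
  \<comment> \<open>Positivity of \<open>rtheta3 (- q)\<close> puts \<open>C\<close> strictly below
    \<open>A\<close>, which is the gap condition and makes \<open>C / A\<close> a modulus.\<close>
  have "0 < B\<^sup>2" using B by simp
  then have "C\<^sup>2 < A\<^sup>2" unfolding sq by simp
  then have CA: "C < A" using A by (intro power2_less_imp_less[of C]) auto
  have "0 < C\<^sup>2" using C by simp
  then have "B\<^sup>2 < A\<^sup>2" unfolding sq by simp
  then have BA: "B < A" using A by (intro power2_less_imp_less[of B]) auto
  have K0: "ellK (C / A) = A * (pi / 2)"
    using ellK_real_axis \<open>C\<^sup>2 < A\<^sup>2\<close> unfolding AC by blast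
  have "b = - ln q / 2" using q01 by (simp add: b_eq ln_sqrt)
  also have "\<dots> = pi / 2 * (ellK k' / ellK k)" by (simp add: q)
  finally have b: "b = pi / 2 * (ellK k' / ellK k)" .
  have K0': "ellK (B / A) = ellK (C / A) * (ellK k' / ellK k)"
    using ellK_imaginary_axis[of B] B sq unfolding AC K0 b by simp
  have sq': "(B / A)\<^sup>2 = 1 - (C / A)\<^sup>2"
    using A by (simp add: power_divide sq diff_divide_distrib)
  have cross: "ellK (B / A) * ellK k = ellK (C / A) * ellK k'"
    using K unfolding K0' by simp
  have K0_pos: "0 < ellK (C / A)" "0 < ellK (B / A)" using A B C BA CA by (auto intro!: ellK_pos)
  \<comment> \<open>If \<open>k\<close> were smaller than \<open>C / A\<close>, then
    \<open>ellK k\<close> would be smaller and \<open>ellK k'\<close> larger than the values at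
    \<open>C / A\<close> and \<open>B / A\<close>, contradicting \<open>cross\<close>; the other
    case is symmetric.\<close>
  have "k = C / A"
  proof (rule linorder_cases[of k "C / A"])
    assume less: "k < C / A"
    then have "k\<^sup>2 < (C / A)\<^sup>2" using k by (intro power_strict_mono) auto
    then have "(B / A)\<^sup>2 < k'\<^sup>2" unfolding sq' k'_sqr by simp
    then have "B / A < k'" using k'_01 by (intro power2_less_imp_less[of "B / A"]) auto
    then have "ellK (B / A) < ellK k'" using A B k'_01 by (intro ellK_strict_mono) auto
    moreover have "ellK k < ellK (C / A)" using less k A CA by (intro ellK_strict_mono) auto
    ultimately have "ellK (B / A) * ellK k < ellK k' * ellK (C / A)"
      using K K0_pos by (intro mult_strict_mono) auto
    then show ?thesis using cross by (simp add: mult.commute)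
  next
    assume less: "C / A < k"
    then have "(C / A)\<^sup>2 < k\<^sup>2" using A C by (intro power_strict_mono) auto
    then have "k'\<^sup>2 < (B / A)\<^sup>2" unfolding sq' k'_sqr by simp
    then have "k' < B / A" using A B by (intro power2_less_imp_less[of k']) auto
    then have "ellK k' < ellK (B / A)" using A BA k'_01 by (intro ellK_strict_mono) auto
    moreover have "ellK (C / A) < ellK k" using less k A C by (intro ellK_strict_mono) auto
    ultimately have "ellK k' * ellK (C / A) < ellK (B / A) * ellK k"
      using K K0_pos by (intro mult_strict_mono) auto
    then show ?thesis using cross by (simp add: mult.commute)
  qed
  then have kA: "k * A = C" using A by simp
  show zA: "z = rtheta3 q"
    unfolding z \<open>k = C / A\<close> K0 by (simp add: A_def)
  show "k * z = 4 * lambert_T 0 q"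
    using kA unfolding zA A_def C_def .
  have "k'\<^sup>2 = (B / A)\<^sup>2" unfolding sq' k'_sqr \<open>k = C / A\<close> ..
  then have "k' = B / A" using k'_01 A B by (simp add: power2_eq_iff_nonneg)
  then show "k' * z = rtheta3 (- q)"
    using A unfolding zA A_def[symmetric] B_def[symmetric] by simp
qed

section \<open>The real identities\<close>

text \<open>Laplace expansion along the first row: only the corner entry changes, and its minor is
  the Hankel matrix shifted by 2. In the notation with superscripts this turns 1 into 3.\<close>

lemma hankel_det_add_first:
  fixes c :: "nat \<Rightarrow> 'a :: comm_ring_1"
  shows "hankel_det (Suc m) (\<lambda>i. (if i = 0 then e else 0) + c i) = hankel_det (Suc m) c + e * hankel_det m (\<lambda>i. c (i + 2))"
proof -
  define A where "A c = Matrix.mat (Suc m) (Suc m) (\<lambda>(i, j). c (i + j) :: 'a)" for c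
  have del: "mat_delete (A (\<lambda>i. (if i = 0 then e else 0) + c i)) 0 j = mat_delete (A c) 0 j" for j
    by (rule eq_matI) (auto simp: mat_delete_def A_def)
  have del0: "mat_delete (A c) 0 0 = Matrix.mat m m (\<lambda>(i, j). c (i + j + 2))"
    by (rule eq_matI) (auto simp: mat_delete_def A_def)
  have carrier: "A c \<in> carrier_mat (Suc m) (Suc m)" for c
    by (simp add: A_def)
  have "Determinant.det (A (\<lambda>i. (if i = 0 then e else 0) + c i)) =
      (\<Sum>j<Suc m. ((if j = 0 then e else 0) + c j) * cofactor (A c) 0 j)"
    unfolding laplace_expansion_row[OF carrier zero_less_Suc] cofactor_def del
    by (rule sum.cong) (auto simp: A_def)
  also have "\<dots> = (\<Sum>j<Suc m. (if j = 0 then e * cofactor (A c) 0 j else 0)) + (\<Sum>j<Suc m. c j * cofactor (A c) 0 j)"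
    unfolding sum.distrib[symmetric] by (rule sum.cong) (auto simp: algebra_simps)
  also have "(\<Sum>j<Suc m. if j = 0 then e * cofactor (A c) 0 j else 0) = e * cofactor (A c) 0 0"
    by (subst sum.delta) auto
  also have "(\<Sum>j<Suc m. c j * cofactor (A c) 0 j) = Determinant.det (A c)"
    unfolding laplace_expansion_row[OF carrier zero_less_Suc] by (rule sum.cong) (auto simp: A_def)
  finally have "Determinant.det (A (\<lambda>i. (if i = 0 then e else 0) + c i)) = Determinant.det (A c) + e * hankel_det m (\<lambda>i. c (i + 2))"
    unfolding cofactor_def del0 by (simp add: hankel_det_def add.commute)
  then show ?thesis unfolding A_def hankel_det_def[of "Suc m"] .
qed

lemma P_fac_prod: "P_fac n * (\<Prod>m<n. fact (2 * m) ^ 2) = 1"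
proof (induction n)
  case (Suc n)
  have "P_fac (Suc n) = P_fac n * (1 / fact (2 * n) ^ 2)"
    by (cases n) (simp_all add: P_fac_def del: fact_Suc)
  then show ?case
    unfolding prod.lessThan_Suc using Suc by (simp del: fact_Suc)
qed (simp add: P_fac_def)

lemma Q_fac_prod: "Q_fac n * (\<Prod>m<n. fact (2 * m + 1) ^ 2) = 1"
proof (induction n)
  case (Suc n)
  have "Q_fac (Suc n) = Q_fac n * (1 / fact (2 * n + 1) ^ 2)"
    by (simp add: Q_fac_def del: fact_Suc)
  then show ?case
    unfolding prod.lessThan_Suc using Suc by (simp del: fact_Suc)
qed (simp add: Q_fac_def)

lemma F'_fac_prod: "F'_fac n * (\<Prod>m<n. fact (2 * m + 1) * fact (2 * m + 2)) = 1"
proof (induction n)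
  case (Suc n)
  have "F'_fac (Suc n) = F'_fac n * (1 / fact (2 * n + 1)) * (1 / fact (2 * n + 2))"
    by (simp add: F'_fac_def del: fact_Suc)
  then show ?case
    unfolding prod.lessThan_Suc using Suc by (simp del: fact_Suc)
qed (simp add: F'_fac_def)

lemma F_fac_prod: "F_fac n * (\<Prod>m<n. fact (2 * m) * fact (2 * m + 1)) = 1"
proof (induction n)
  case (Suc n)
  have "F_fac (Suc n) = F_fac n * (1 / fact (2 * n)) * (1 / fact (2 * n + 1))"
    by (cases n) (simp_all add: F_fac_def del: fact_Suc)
  then show ?case
    unfolding prod.lessThan_Suc using Suc by (simp del: fact_Suc)
qed (simp add: F_fac_def)

lemma clear_factorials:
  assumes "complex_of_real (c * h) = of_real (M * D)" "P * D = 1"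
  shows "M = c * P * h"
proof -
  have "M = P * (M * D)" using assms(2) by (simp add: mult_ac)
  then show ?thesis using assms(1) unfolding of_real_eq_iff by (simp add: mult_ac)
qed

lemma hankel_det_of_real_eqI:
  assumes "\<And>i. c i = complex_of_real (f i)"
  shows "hankel_det n c = of_real (hankel_det n f)"
  unfolding of_real_hankel_det using assms by (rule hankel_det_cong)

lemma hankel_det_imaginary_eqI:
  assumes "\<And>i. \<i> * c i = complex_of_real (f i)"
  shows "\<i> ^ n * hankel_det n c = of_real (hankel_det n f)"
  using hankel_det_scale[of n \<i> 1 c] assms by (simp add: of_real_hankel_det)

text \<open>\<open>zz\<close>, \<open>zk\<close> and \<open>zk'\<close> will be \<open>z\<close>,
  \<open>k * z\<close> and \<open>k' * z\<close>; this keeps elliptic integrals out of the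
  evaluation of determinants.\<close>

locale theta_values =
  fixes q :: real
  assumes q_pos: "0 < q" and q_lt_1: "q < 1"
begin

abbreviation "zz \<equiv> rtheta3 q"
abbreviation "zk' \<equiv> rtheta3 (- q)"
abbreviation "zk \<equiv> 4 * lambert_T 0 q"
abbreviation "p \<equiv> sqrt q"

lemma p: "0 < p" "p < 1" "p\<^sup>2 = q" "(complex_of_real p)\<^sup>2 = of_real q" "(\<i> * complex_of_real p)\<^sup>2 = of_real (- q)"
proof -
  show "(complex_of_real p)\<^sup>2 = of_real q"
    using q_pos unfolding of_real_power[symmetric] by simp
  then show "(\<i> * complex_of_real p)\<^sup>2 = of_real (- q)"
    by (simp add: power_mult_distrib)
qed (use q_pos q_lt_1 in auto)

lemma q_sqr: "0 < q\<^sup>2" "q\<^sup>2 < 1"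
  using q_pos q_lt_1 by (simp_all add: power_less_one_iff)

lemma theta3_q: "theta3 (of_real q) = of_real zz" "theta3 (of_real (- q)) = of_real zk'" "theta3 (- of_real q) = of_real zk'"
  using theta3_of_real[of q] theta3_of_real[of "- q"] q_pos q_lt_1 by simp_all

lemma clambert_T_p: "4 * clambert_T 0 (of_real p) = of_real zk" "4 * clambert_T 0 (\<i> * of_real p) = \<i> * of_real zk"
  using clambert_T_eq[OF p(1,2), of 0] clambert_T_0_i[of "of_real p"] p by simp_all

lemma sqr_diff: "zz\<^sup>2 - zk'\<^sup>2 = zk\<^sup>2"
proof -
  interpret real_nome p by unfold_locales (use p in auto)
  show ?thesis using rtheta3_sqr_diff by (simp add: p)
qed

text \<open>The evaluations at \<open>Q = sqrt q\<close>, where \<open>CC 0 = zk\<close>,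
  \<open>DD 0 = HH 0 = zz\<close> and \<open>GG 0 = zk'\<close>.\<close>

lemma hankel_T: "zk ^ n * (zk * zz) ^ (2 * tri n) = 4 ^ n * P_fac n * hankel n 1 (\<lambda>\<nu>. lambert_T (2 * \<nu> - 2) q)"
  and hankel_T2: "(zk * zz\<^sup>2) ^ n * (zk * zz) ^ (2 * tri n) = 4 ^ n * Q_fac n * hankel n 1 (\<lambda>\<nu>. lambert_T (2 * \<nu>) q)"
  and hankel_C_sqrt: "(zk * zz) ^ (n + 2 * tri n) = 4 ^ n * F_fac n * hankel n 1 (\<lambda>\<nu>. lambert_C (2 * \<nu> - 1) p)"
  and hankel_N: "n > 0 \<Longrightarrow> zz ^ n * (zk * zz) ^ (2 * tri n) = 4 ^ n * 4 ^ (2 * tri n) * P_fac n *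
    (hankel n 1 (\<lambda>\<nu>. lambert_N (2 * \<nu> - 2) q) + 1 / 4 * hankel (n - 1) 3 (\<lambda>\<nu>. lambert_N (2 * \<nu> - 2) q))"
  and hankel_N2: "(zz * zk\<^sup>2) ^ n * (zk * zz) ^ (2 * tri n) =
    16 ^ n * 4 ^ (2 * tri n) * Q_fac n * hankel n 1 (\<lambda>\<nu>. lambert_N (2 * \<nu>) q)"
  and hankel_D: "(zk * zz) ^ (2 * n + 2 * tri n) =
    32 ^ n * 4 ^ (2 * tri n) * F'_fac n * hankel n 1 (\<lambda>\<nu>. lambert_D (2 * \<nu> + 1) q)"
  and hankel_R: "zk' ^ n * (zk' * zz) ^ (2 * tri n) =
    (- 4) ^ n * P_fac n * hankel n 1 (\<lambda>\<nu>. lambert_R (2 * \<nu> - 2) q - eps_seq \<nu>)"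
  and hankel_R2: "(zk' * zz\<^sup>2) ^ n * (zk' * zz) ^ (2 * tri n) =
    4 ^ n * Q_fac n * hankel n 1 (\<lambda>\<nu>. lambert_R (2 * \<nu>) q - eps'_seq \<nu>)"
  and hankel_U_sqr: "(- 1) ^ n * (zk' * zz) ^ (n + 2 * tri n) =
    8 ^ n * 4 ^ (2 * tri n) * F_fac n * hankel n 1 (\<lambda>\<nu>. lambert_U (2 * \<nu> - 1) (q\<^sup>2) - beta_seq \<nu>)"
proof -
  interpret nome "of_real p" by unfold_locales (use p in auto)
  have CD: "CC 0 = of_real zk" "DD 0 = of_real zz"
    unfolding CC_0 DD_0 p clambert_T_p theta3_q by simp_all
  have GH: "GG 0 = of_real zk'" "HH 0 = of_real zz"
    unfolding GG_0 HH_0' p theta3_q by simp_all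
  have q1: "\<bar>q\<bar> < 1" "\<bar>p\<bar> < 1" "\<bar>q\<^sup>2\<bar> < 1" using q_pos q_lt_1 q_sqr by auto
  have T: "clambert_T s (of_real p) = of_real (lambert_T s q)" for s
    using clambert_T_eq[OF p(1,2), of s] p(3) by simp
  show "zk ^ n * (zk * zz) ^ (2 * tri n) = 4 ^ n * P_fac n * hankel n 1 (\<lambda>\<nu>. lambert_T (2 * \<nu> - 2) q)"
  proof (rule clear_factorials[OF _ P_fac_prod])
    have "hankel_det n (\<lambda>i. clambert_T (2 * i) (of_real p)) = of_real (hankel n 1 (\<lambda>\<nu>. lambert_T (2 * \<nu> - 2) q))"
      unfolding hankel_altdef by (rule hankel_det_of_real_eqI) (simp add: T)
    then show "complex_of_real (4 ^ n * hankel n 1 (\<lambda>\<nu>. lambert_T (2 * \<nu> - 2) q)) =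
        of_real (zk ^ n * (zk * zz) ^ (2 * tri n) * (\<Prod>m<n. fact (2 * m) ^ 2))"
      using det_T[of n] by (simp add: CD)
  qed
  show "(zk * zz\<^sup>2) ^ n * (zk * zz) ^ (2 * tri n) = 4 ^ n * Q_fac n * hankel n 1 (\<lambda>\<nu>. lambert_T (2 * \<nu>) q)"
  proof (rule clear_factorials[OF _ Q_fac_prod])
    have "hankel_det n (\<lambda>i. clambert_T (2 * i + 2) (of_real p)) = of_real (hankel n 1 (\<lambda>\<nu>. lambert_T (2 * \<nu>) q))"
      unfolding hankel_altdef by (rule hankel_det_of_real_eqI) (simp add: T add.commute)
    then show "complex_of_real (4 ^ n * hankel n 1 (\<lambda>\<nu>. lambert_T (2 * \<nu>) q)) =
        of_real ((zk * zz\<^sup>2) ^ n * (zk * zz) ^ (2 * tri n) * (\<Prod>m<n. fact (2 * m + 1) ^ 2))"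
      using det_T2[of n] by (simp add: CD)
  qed
  show "(zk * zz) ^ (n + 2 * tri n) = 4 ^ n * F_fac n * hankel n 1 (\<lambda>\<nu>. lambert_C (2 * \<nu> - 1) p)"
  proof (rule clear_factorials[OF _ F_fac_prod])
    have "hankel_det n (\<lambda>i. clambert_C (2 * i + 1) (of_real p)) = of_real (hankel n 1 (\<lambda>\<nu>. lambert_C (2 * \<nu> - 1) p))"
      unfolding hankel_altdef by (rule hankel_det_of_real_eqI) (simp add: clambert_C_eq[OF q1(2)])
    then show "complex_of_real (4 ^ n * hankel n 1 (\<lambda>\<nu>. lambert_C (2 * \<nu> - 1) p)) =
        of_real ((zk * zz) ^ (n + 2 * tri n) * (\<Prod>m<n. fact (2 * m) * fact (2 * m + 1)))"
      using det_C[of n] by (simp add: CD)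
  qed
  show "zz ^ n * (zk * zz) ^ (2 * tri n) = 4 ^ n * 4 ^ (2 * tri n) * P_fac n *
    (hankel n 1 (\<lambda>\<nu>. lambert_N (2 * \<nu> - 2) q) + 1 / 4 * hankel (n - 1) 3 (\<lambda>\<nu>. lambert_N (2 * \<nu> - 2) q))" (is "_ = _ * ?H") if "n > 0"
  proof (rule clear_factorials[OF _ P_fac_prod])
    obtain m where m: "n = Suc m" using \<open>n > 0\<close> by (cases n) auto
    have "hankel_det n (\<lambda>i. (if i = 0 then 1 / 4 else 0) + clambert_N (2 * i) (of_real q)) =
        of_real (hankel_det n (\<lambda>i. (if i = 0 then 1 / 4 else 0) + lambert_N (2 * i) q))"
      by (rule hankel_det_of_real_eqI) (simp add: clambert_N_eq[OF q1(1)])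
    also have "hankel_det n (\<lambda>i. (if i = 0 then 1 / 4 else 0) + lambert_N (2 * i) q) = ?H"
      unfolding hankel_altdef m hankel_det_add_first by (simp add: numeral_eq_Suc)
    finally show "complex_of_real (4 ^ n * 4 ^ (2 * tri n) * ?H) =
        of_real (zz ^ n * (zk * zz) ^ (2 * tri n) * (\<Prod>m<n. fact (2 * m) ^ 2))"
      using det_N[of n] unfolding p by (simp add: CD)
  qed
  show "(zz * zk\<^sup>2) ^ n * (zk * zz) ^ (2 * tri n) =
    16 ^ n * 4 ^ (2 * tri n) * Q_fac n * hankel n 1 (\<lambda>\<nu>. lambert_N (2 * \<nu>) q)"
  proof (rule clear_factorials[OF _ Q_fac_prod])
    have "hankel_det n (\<lambda>i. clambert_N (2 * i + 2) (of_real q)) = of_real (hankel n 1 (\<lambda>\<nu>. lambert_N (2 * \<nu>) q))"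
      unfolding hankel_altdef by (rule hankel_det_of_real_eqI) (simp add: clambert_N_eq[OF q1(1)] add.commute)
    then show "complex_of_real (16 ^ n * 4 ^ (2 * tri n) * hankel n 1 (\<lambda>\<nu>. lambert_N (2 * \<nu>) q)) =
        of_real ((zz * zk\<^sup>2) ^ n * (zk * zz) ^ (2 * tri n) * (\<Prod>m<n. fact (2 * m + 1) ^ 2))"
      using det_N2[of n] unfolding p by (simp add: CD)
  qed
  show "(zk * zz) ^ (2 * n + 2 * tri n) =
    32 ^ n * 4 ^ (2 * tri n) * F'_fac n * hankel n 1 (\<lambda>\<nu>. lambert_D (2 * \<nu> + 1) q)"
  proof (rule clear_factorials[OF _ F'_fac_prod])
    have "hankel_det n (\<lambda>i. clambert_D (2 * i + 3) (of_real q)) = of_real (hankel n 1 (\<lambda>\<nu>. lambert_D (2 * \<nu> + 1) q))"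
      unfolding hankel_altdef by (rule hankel_det_of_real_eqI) (simp add: clambert_D_eq[OF q1(1)] add.commute eval_nat_numeral)
    then show "complex_of_real (32 ^ n * 4 ^ (2 * tri n) * hankel n 1 (\<lambda>\<nu>. lambert_D (2 * \<nu> + 1) q)) =
        of_real ((zk * zz) ^ (2 * n + 2 * tri n) * (\<Prod>m<n. fact (2 * m + 1) * fact (2 * m + 2)))"
      using det_D[of n] unfolding p by (simp add: CD)
  qed
  show "zk' ^ n * (zk' * zz) ^ (2 * tri n) =
    (- 4) ^ n * P_fac n * hankel n 1 (\<lambda>\<nu>. lambert_R (2 * \<nu> - 2) q - eps_seq \<nu>)"
  proof (rule clear_factorials[OF _ P_fac_prod])
    have "hankel_det n (\<lambda>i. clambert_R (2 * i) (of_real q) - of_real (eps_seq (i + 1))) =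
        of_real (hankel n 1 (\<lambda>\<nu>. lambert_R (2 * \<nu> - 2) q - eps_seq \<nu>))"
      unfolding hankel_altdef by (rule hankel_det_of_real_eqI) (simp add: clambert_R_eq[OF q1(1)])
    then show "complex_of_real ((- 4) ^ n * hankel n 1 (\<lambda>\<nu>. lambert_R (2 * \<nu> - 2) q - eps_seq \<nu>)) =
        of_real (zk' ^ n * (zk' * zz) ^ (2 * tri n) * (\<Prod>m<n. fact (2 * m) ^ 2))"
      using det_R[of n] unfolding p by (simp add: GH)
  qed
  show "(zk' * zz\<^sup>2) ^ n * (zk' * zz) ^ (2 * tri n) =
    4 ^ n * Q_fac n * hankel n 1 (\<lambda>\<nu>. lambert_R (2 * \<nu>) q - eps'_seq \<nu>)"
  proof (rule clear_factorials[OF _ Q_fac_prod])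
    have "hankel_det n (\<lambda>i. clambert_R (2 * i + 2) (of_real q) - of_real (eps'_seq (i + 1))) =
        of_real (hankel n 1 (\<lambda>\<nu>. lambert_R (2 * \<nu>) q - eps'_seq \<nu>))"
      unfolding hankel_altdef by (rule hankel_det_of_real_eqI) (simp add: clambert_R_eq[OF q1(1)])
    then show "complex_of_real (4 ^ n * hankel n 1 (\<lambda>\<nu>. lambert_R (2 * \<nu>) q - eps'_seq \<nu>)) =
        of_real ((zk' * zz\<^sup>2) ^ n * (zk' * zz) ^ (2 * tri n) * (\<Prod>m<n. fact (2 * m + 1) ^ 2))"
      using det_R2[of n] unfolding p by (simp add: GH)
  qed
  show "(- 1) ^ n * (zk' * zz) ^ (n + 2 * tri n) =
    8 ^ n * 4 ^ (2 * tri n) * F_fac n * hankel n 1 (\<lambda>\<nu>. lambert_U (2 * \<nu> - 1) (q\<^sup>2) - beta_seq \<nu>)"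
  proof (rule clear_factorials[OF _ F_fac_prod])
    have "hankel_det n (\<lambda>i. clambert_U (2 * i + 1) (of_real q ^ 2) - of_real (beta_seq (i + 1))) =
        of_real (hankel n 1 (\<lambda>\<nu>. lambert_U (2 * \<nu> - 1) (q\<^sup>2) - beta_seq \<nu>))"
      unfolding hankel_altdef of_real_power[symmetric] by (rule hankel_det_of_real_eqI) (simp add: clambert_U_eq[OF q1(3)] del: of_real_power)
    then show "complex_of_real (8 ^ n * 4 ^ (2 * tri n) * hankel n 1 (\<lambda>\<nu>. lambert_U (2 * \<nu> - 1) (q\<^sup>2) - beta_seq \<nu>)) =
        of_real ((- 1) ^ n * (zk' * zz) ^ (n + 2 * tri n) * (\<Prod>m<n. fact (2 * m) * fact (2 * m + 1)))"
      using det_U[of n] unfolding p by (simp add: GH)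
  qed
qed

end

lemma imaginary_power:
  "\<i> ^ n * (\<i> * x) ^ n = (- 1) ^ n * x ^ n" "(\<i> * x) ^ (2 * m) = (- 1) ^ m * x ^ (2 * m)"
  "\<i> ^ n * (\<i> * x) ^ (n + 2 * m) = (- 1) ^ n * (- 1) ^ m * x ^ (n + 2 * m)"
proof -
  show 1: "\<i> ^ n * (\<i> * x) ^ n = (- 1) ^ n * x ^ n" for n x
    unfolding power_mult_distrib[symmetric] by (simp add: imaginary_unit_mult)
  show 2: "(\<i> * x) ^ (2 * m) = (- 1) ^ m * x ^ (2 * m)" for m x
    unfolding power_mult_distrib power_mult by simp
  have "\<i> ^ n * (\<i> * x) ^ (n + 2 * m) = (\<i> ^ n * (\<i> * x) ^ n) * (\<i> * x) ^ (2 * m)"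
    by (simp only: power_add mult.assoc)
  then show "\<i> ^ n * (\<i> * x) ^ (n + 2 * m) = (- 1) ^ n * (- 1) ^ m * x ^ (n + 2 * m)"
    unfolding 1 2 by (simp only: power_add mult_ac)
qed

context theta_values
begin

text \<open>The evaluations at \<open>Q = \<i> * sqrt q\<close>: \<open>zz\<close> and
  \<open>zk'\<close> trade places and \<open>CC 0 = \<i> * zk\<close>. The power
  \<open>2 * tri n\<close> of \<open>CC 0 * DD 0\<close> contributes the sign
  \<open>(-1)^(tri n)\<close>.\<close>

lemma hankel_T_hat: "(- 1) ^ n * (- 1) ^ tri n * (zk ^ n * (zk * zk') ^ (2 * tri n)) =
    4 ^ n * P_fac n * hankel n 1 (\<lambda>\<nu>. lambert_T_hat (2 * \<nu> - 2) q)"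
  and hankel_T_hat2: "(- 1) ^ n * (- 1) ^ tri n * ((zk * zk'\<^sup>2) ^ n * (zk * zk') ^ (2 * tri n)) =
    4 ^ n * Q_fac n * hankel n 1 (\<lambda>\<nu>. lambert_T_hat (2 * \<nu>) q)"
  and hankel_C_hat: "(- 1) ^ n * (- 1) ^ tri n * (zk * zk') ^ (n + 2 * tri n) =
    4 ^ n * F_fac n * hankel n 1 (\<lambda>\<nu>. lambert_C_hat (2 * \<nu> - 1) q)"
  and hankel_N_minus: "n > 0 \<Longrightarrow> (- 1) ^ tri n * (zk' ^ n * (zk * zk') ^ (2 * tri n)) = 4 ^ n * 4 ^ (2 * tri n) * P_fac n *
    (hankel n 1 (\<lambda>\<nu>. lambert_N (2 * \<nu> - 2) (- q)) + 1 / 4 * hankel (n - 1) 3 (\<lambda>\<nu>. lambert_N (2 * \<nu> - 2) (- q)))"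
  and hankel_N2_minus: "(- 1) ^ n * (- 1) ^ tri n * ((zk' * zk\<^sup>2) ^ n * (zk * zk') ^ (2 * tri n)) =
    16 ^ n * 4 ^ (2 * tri n) * Q_fac n * hankel n 1 (\<lambda>\<nu>. lambert_N (2 * \<nu>) (- q))"
  and hankel_D_minus: "(- 1) ^ (n + tri n) * (zk * zk') ^ (2 * (n + tri n)) =
    32 ^ n * 4 ^ (2 * tri n) * F'_fac n * hankel n 1 (\<lambda>\<nu>. lambert_D (2 * \<nu> + 1) (- q))"
  and hankel_R_minus: "zz ^ n * (zz * zk') ^ (2 * tri n) =
    (- 4) ^ n * P_fac n * hankel n 1 (\<lambda>\<nu>. lambert_R (2 * \<nu> - 2) (- q) - eps_seq \<nu>)"
  and hankel_R2_minus: "(zz * zk'\<^sup>2) ^ n * (zz * zk') ^ (2 * tri n) =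
    4 ^ n * Q_fac n * hankel n 1 (\<lambda>\<nu>. lambert_R (2 * \<nu>) (- q) - eps'_seq \<nu>)"
proof -
  interpret nome "\<i> * of_real p" by unfold_locales (use p in \<open>auto simp: norm_mult\<close>)
  have CD: "CC 0 = \<i> * of_real zk" "DD 0 = of_real zk'"
    unfolding CC_0 DD_0 p clambert_T_p theta3_q by simp_all
  have CD': "CC 0 * DD 0 = \<i> * of_real (zk * zk')" "CC 0 * DD 0 ^ 2 = \<i> * of_real (zk * zk'\<^sup>2)"
    "DD 0 * CC 0 ^ 2 = - of_real (zk' * zk\<^sup>2)"
    unfolding CD by (simp_all add: power_mult_distrib)
  have GH: "GG 0 = of_real zz" "HH 0 = of_real zk'"
    unfolding GG_0 HH_0' p theta3_q of_real_minus minus_minus by simp_all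
  have q1: "\<bar>- q\<bar> < 1" using q_pos q_lt_1 by auto
  have T: "\<i> * clambert_T s (\<i> * of_real p) = of_real (lambert_T_hat s q)"
    and C: "\<i> * clambert_C s (\<i> * of_real p) = of_real (lambert_C_hat s q)" for s
    using clambert_T_hat_eq[OF p(1,2), of s] clambert_C_hat_eq[OF p(1,2), of s] p(3) by simp_all
  show "(- 1) ^ n * (- 1) ^ tri n * (zk ^ n * (zk * zk') ^ (2 * tri n)) =
      4 ^ n * P_fac n * hankel n 1 (\<lambda>\<nu>. lambert_T_hat (2 * \<nu> - 2) q)"
  proof (rule clear_factorials[OF _ P_fac_prod])
    have "\<i> ^ n * hankel_det n (\<lambda>i. clambert_T (2 * i) (\<i> * of_real p)) = of_real (hankel n 1 (\<lambda>\<nu>. lambert_T_hat (2 * \<nu> - 2) q))"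
      unfolding hankel_altdef by (rule hankel_det_imaginary_eqI) (simp add: T)
    then have "complex_of_real (4 ^ n * hankel n 1 (\<lambda>\<nu>. lambert_T_hat (2 * \<nu> - 2) q)) =
        \<i> ^ n * (4 ^ n * hankel_det n (\<lambda>i. clambert_T (2 * i) (\<i> * of_real p)))"
      by (simp add: mult_ac)
    also have "\<dots> = (\<i> ^ n * (\<i> * of_real zk) ^ n) * (\<i> * of_real (zk * zk')) ^ (2 * tri n) * (\<Prod>m<n. fact (2 * m) ^ 2)"
      unfolding det_T CD' by (simp only: CD mult.assoc)
    finally show "complex_of_real (4 ^ n * hankel n 1 (\<lambda>\<nu>. lambert_T_hat (2 * \<nu> - 2) q)) =
        of_real ((- 1) ^ n * (- 1) ^ tri n * (zk ^ n * (zk * zk') ^ (2 * tri n)) * (\<Prod>m<n. fact (2 * m) ^ 2))"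
      unfolding imaginary_power by (simp add: mult_ac)
  qed
  show "(- 1) ^ n * (- 1) ^ tri n * ((zk * zk'\<^sup>2) ^ n * (zk * zk') ^ (2 * tri n)) =
    4 ^ n * Q_fac n * hankel n 1 (\<lambda>\<nu>. lambert_T_hat (2 * \<nu>) q)"
  proof (rule clear_factorials[OF _ Q_fac_prod])
    have "\<i> ^ n * hankel_det n (\<lambda>i. clambert_T (2 * i + 2) (\<i> * of_real p)) = of_real (hankel n 1 (\<lambda>\<nu>. lambert_T_hat (2 * \<nu>) q))"
      unfolding hankel_altdef by (rule hankel_det_imaginary_eqI) (simp add: T)
    then have "complex_of_real (4 ^ n * hankel n 1 (\<lambda>\<nu>. lambert_T_hat (2 * \<nu>) q)) =
        \<i> ^ n * (4 ^ n * hankel_det n (\<lambda>i. clambert_T (2 * i + 2) (\<i> * of_real p)))"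
      by (simp add: mult_ac)
    also have "\<dots> = (\<i> ^ n * (\<i> * of_real (zk * zk'\<^sup>2)) ^ n) * (\<i> * of_real (zk * zk')) ^ (2 * tri n) * (\<Prod>m<n. fact (2 * m + 1) ^ 2)"
      unfolding det_T2 CD' by (simp only: mult.assoc)
    finally show "complex_of_real (4 ^ n * hankel n 1 (\<lambda>\<nu>. lambert_T_hat (2 * \<nu>) q)) =
        of_real ((- 1) ^ n * (- 1) ^ tri n * ((zk * zk'\<^sup>2) ^ n * (zk * zk') ^ (2 * tri n)) * (\<Prod>m<n. fact (2 * m + 1) ^ 2))"
      unfolding imaginary_power by (simp add: mult_ac)
  qed
  show "(- 1) ^ n * (- 1) ^ tri n * (zk * zk') ^ (n + 2 * tri n) =
    4 ^ n * F_fac n * hankel n 1 (\<lambda>\<nu>. lambert_C_hat (2 * \<nu> - 1) q)"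
  proof (rule clear_factorials[OF _ F_fac_prod])
    have "\<i> ^ n * hankel_det n (\<lambda>i. clambert_C (2 * i + 1) (\<i> * of_real p)) = of_real (hankel n 1 (\<lambda>\<nu>. lambert_C_hat (2 * \<nu> - 1) q))"
      unfolding hankel_altdef by (rule hankel_det_imaginary_eqI) (simp add: C)
    then have "complex_of_real (4 ^ n * hankel n 1 (\<lambda>\<nu>. lambert_C_hat (2 * \<nu> - 1) q)) =
        \<i> ^ n * (4 ^ n * hankel_det n (\<lambda>i. clambert_C (2 * i + 1) (\<i> * of_real p)))"
      by (simp add: mult_ac)
    also have "\<dots> = (\<i> ^ n * (\<i> * of_real (zk * zk')) ^ (n + 2 * tri n)) * (\<Prod>m<n. fact (2 * m) * fact (2 * m + 1))"
      unfolding det_C CD' by (simp only: mult.assoc)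
    finally show "complex_of_real (4 ^ n * hankel n 1 (\<lambda>\<nu>. lambert_C_hat (2 * \<nu> - 1) q)) =
        of_real ((- 1) ^ n * (- 1) ^ tri n * (zk * zk') ^ (n + 2 * tri n) * (\<Prod>m<n. fact (2 * m) * fact (2 * m + 1)))"
      unfolding imaginary_power by (simp add: mult_ac)
  qed
  show "(- 1) ^ tri n * (zk' ^ n * (zk * zk') ^ (2 * tri n)) = 4 ^ n * 4 ^ (2 * tri n) * P_fac n *
    (hankel n 1 (\<lambda>\<nu>. lambert_N (2 * \<nu> - 2) (- q)) + 1 / 4 * hankel (n - 1) 3 (\<lambda>\<nu>. lambert_N (2 * \<nu> - 2) (- q)))" (is "_ = _ * ?H") if "n > 0"
  proof (rule clear_factorials[OF _ P_fac_prod])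
    obtain m where m: "n = Suc m" using \<open>n > 0\<close> by (cases n) auto
    have "hankel_det n (\<lambda>i. (if i = 0 then 1 / 4 else 0) + clambert_N (2 * i) (of_real (- q))) =
        of_real (hankel_det n (\<lambda>i. (if i = 0 then 1 / 4 else 0) + lambert_N (2 * i) (- q)))"
      unfolding clambert_N_eq[OF q1] by (rule hankel_det_of_real_eqI) simp
    also have "hankel_det n (\<lambda>i. (if i = 0 then 1 / 4 else 0) + lambert_N (2 * i) (- q)) = ?H"
      unfolding hankel_altdef m hankel_det_add_first by (simp add: numeral_eq_Suc)
    finally show "complex_of_real (4 ^ n * 4 ^ (2 * tri n) * ?H) =
        of_real ((- 1) ^ tri n * (zk' ^ n * (zk * zk') ^ (2 * tri n)) * (\<Prod>m<n. fact (2 * m) ^ 2))"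
      using det_N[of n] unfolding p CD' imaginary_power by (simp add: CD mult_ac)
  qed
  show "(- 1) ^ n * (- 1) ^ tri n * ((zk' * zk\<^sup>2) ^ n * (zk * zk') ^ (2 * tri n)) =
    16 ^ n * 4 ^ (2 * tri n) * Q_fac n * hankel n 1 (\<lambda>\<nu>. lambert_N (2 * \<nu>) (- q))"
  proof (rule clear_factorials[OF _ Q_fac_prod])
    have "hankel_det n (\<lambda>i. clambert_N (2 * i + 2) (of_real (- q))) = of_real (hankel n 1 (\<lambda>\<nu>. lambert_N (2 * \<nu>) (- q)))"
      unfolding hankel_altdef clambert_N_eq[OF q1] by (rule hankel_det_of_real_eqI) simp
    then show "complex_of_real (16 ^ n * 4 ^ (2 * tri n) * hankel n 1 (\<lambda>\<nu>. lambert_N (2 * \<nu>) (- q))) =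
        of_real ((- 1) ^ n * (- 1) ^ tri n * ((zk' * zk\<^sup>2) ^ n * (zk * zk') ^ (2 * tri n)) * (\<Prod>m<n. fact (2 * m + 1) ^ 2))"
      using det_N2[of n] unfolding p CD' imaginary_power power_minus[of "of_real (zk' * zk\<^sup>2)"] by (simp add: mult_ac)
  qed
  show "(- 1) ^ (n + tri n) * (zk * zk') ^ (2 * (n + tri n)) =
    32 ^ n * 4 ^ (2 * tri n) * F'_fac n * hankel n 1 (\<lambda>\<nu>. lambert_D (2 * \<nu> + 1) (- q))"
  proof (rule clear_factorials[OF _ F'_fac_prod])
    have "hankel_det n (\<lambda>i. clambert_D (2 * i + 3) (of_real (- q))) = of_real (hankel n 1 (\<lambda>\<nu>. lambert_D (2 * \<nu> + 1) (- q)))"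
      unfolding hankel_altdef clambert_D_eq[OF q1] by (rule hankel_det_of_real_eqI) (simp add: eval_nat_numeral)
    then show "complex_of_real (32 ^ n * 4 ^ (2 * tri n) * hankel n 1 (\<lambda>\<nu>. lambert_D (2 * \<nu> + 1) (- q))) =
        of_real ((- 1) ^ (n + tri n) * (zk * zk') ^ (2 * (n + tri n)) * (\<Prod>m<n. fact (2 * m + 1) * fact (2 * m + 2)))"
      using det_D[of n] unfolding p CD' distrib_left[symmetric] imaginary_power by (simp add: mult_ac)
  qed
  show "zz ^ n * (zz * zk') ^ (2 * tri n) =
    (- 4) ^ n * P_fac n * hankel n 1 (\<lambda>\<nu>. lambert_R (2 * \<nu> - 2) (- q) - eps_seq \<nu>)"
  proof (rule clear_factorials[OF _ P_fac_prod])
    have "hankel_det n (\<lambda>i. clambert_R (2 * i) (of_real (- q)) - of_real (eps_seq (i + 1))) =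
        of_real (hankel n 1 (\<lambda>\<nu>. lambert_R (2 * \<nu> - 2) (- q) - eps_seq \<nu>))"
      unfolding hankel_altdef clambert_R_eq[OF q1] by (rule hankel_det_of_real_eqI) simp
    then show "complex_of_real ((- 4) ^ n * hankel n 1 (\<lambda>\<nu>. lambert_R (2 * \<nu> - 2) (- q) - eps_seq \<nu>)) =
        of_real (zz ^ n * (zz * zk') ^ (2 * tri n) * (\<Prod>m<n. fact (2 * m) ^ 2))"
      using det_R[of n] unfolding p by (simp add: GH)
  qed
  show "(zz * zk'\<^sup>2) ^ n * (zz * zk') ^ (2 * tri n) =
    4 ^ n * Q_fac n * hankel n 1 (\<lambda>\<nu>. lambert_R (2 * \<nu>) (- q) - eps'_seq \<nu>)"
  proof (rule clear_factorials[OF _ Q_fac_prod])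
    have "hankel_det n (\<lambda>i. clambert_R (2 * i + 2) (of_real (- q)) - of_real (eps'_seq (i + 1))) =
        of_real (hankel n 1 (\<lambda>\<nu>. lambert_R (2 * \<nu>) (- q) - eps'_seq \<nu>))"
      unfolding hankel_altdef clambert_R_eq[OF q1] by (rule hankel_det_of_real_eqI) simp
    then show "complex_of_real (4 ^ n * hankel n 1 (\<lambda>\<nu>. lambert_R (2 * \<nu>) (- q) - eps'_seq \<nu>)) =
        of_real ((zz * zk'\<^sup>2) ^ n * (zz * zk') ^ (2 * tri n) * (\<Prod>m<n. fact (2 * m + 1) ^ 2))"
      using det_R2[of n] unfolding p by (simp add: GH)
  qed
qed

lemma rtheta3_minus_q_sqr: "0 < rtheta3 (- q\<^sup>2)" "(rtheta3 (- q\<^sup>2))\<^sup>2 = zz * zk'"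
proof -
  interpret real_nome q by unfold_locales (use q_pos q_lt_1 in auto)
  show "0 < rtheta3 (- q\<^sup>2)" by (rule rtheta3_minus_pos[OF q_sqr])
  show "(rtheta3 (- q\<^sup>2))\<^sup>2 = zz * zk'" by (rule rtheta3_prod[symmetric])
qed

text \<open>The evaluations at \<open>Q = q\<close>, with nome \<open>q^2\<close>. Duplication
  expresses the constants through \<open>q\<close>: \<open>DD 0 = HH 0\<close> is the mean of
  \<open>zz\<close> and \<open>zk'\<close>, and \<open>CC 0 * DD 0 = zk^2 / 4\<close> is a Landen
  transformation.\<close>

lemma hankel_C: "(zk\<^sup>2 / 4) ^ (n + 2 * tri n) = 4 ^ n * F_fac n * hankel n 1 (\<lambda>\<nu>. lambert_C (2 * \<nu> - 1) q)"
  and hankel_D_sqr: "(zk\<^sup>2 / 4) ^ (2 * n + 2 * tri n) =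
    32 ^ n * 4 ^ (2 * tri n) * F'_fac n * hankel n 1 (\<lambda>\<nu>. lambert_D (2 * \<nu> + 1) (q\<^sup>2))"
  and hankel_R_sqr: "rtheta3 (- q\<^sup>2) ^ n * (rtheta3 (- q\<^sup>2) * ((zz + zk') / 2)) ^ (2 * tri n) =
    (- 4) ^ n * P_fac n * hankel n 1 (\<lambda>\<nu>. lambert_R (2 * \<nu> - 2) (q\<^sup>2) - eps_seq \<nu>)"
proof -
  interpret nome "of_real q" by unfold_locales (use q_pos q_lt_1 in auto)
  have dup: "theta3 (of_real q) + theta3 (- of_real q) = 2 * theta3 ((of_real q)\<^sup>2)"
    "theta3 (of_real q) - theta3 (- of_real q) = 8 * clambert_T 0 (of_real q)"
    by (rule theta3_duplication[OF Q_lt_1])+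
  have H: "theta3 ((of_real q)\<^sup>2) = of_real ((zz + zk') / 2)"
    using dup(1) theta3_q by simp
  have "complex_of_real ((zz + zk') * (zz - zk')) = of_real (zk\<^sup>2)"
    unfolding sqr_diff[symmetric] by (simp add: power2_eq_square algebra_simps)
  then have "(2 * theta3 ((of_real q)\<^sup>2)) * (8 * clambert_T 0 (of_real q)) = of_real (zk\<^sup>2)"
    unfolding dup[symmetric] theta3_q of_real_mult of_real_add of_real_diff .
  then have CD: "CC 0 * DD 0 = of_real (zk\<^sup>2 / 4)"
    unfolding CC_0 DD_0 by (simp add: mult.commute)
  have GH: "GG 0 = of_real (rtheta3 (- q\<^sup>2))" "HH 0 = of_real ((zz + zk') / 2)"
    unfolding GG_0 HH_0' H using theta3_of_real[of "- q\<^sup>2"] q_sqr by simp_all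
  have q1: "\<bar>q\<bar> < 1" "\<bar>q\<^sup>2\<bar> < 1" using q_pos q_lt_1 q_sqr by auto
  have q2: "(complex_of_real q)\<^sup>2 = of_real (q\<^sup>2)" by simp
  show "(zk\<^sup>2 / 4) ^ (n + 2 * tri n) = 4 ^ n * F_fac n * hankel n 1 (\<lambda>\<nu>. lambert_C (2 * \<nu> - 1) q)"
  proof (rule clear_factorials[OF _ F_fac_prod])
    have "hankel_det n (\<lambda>i. clambert_C (2 * i + 1) (of_real q)) = of_real (hankel n 1 (\<lambda>\<nu>. lambert_C (2 * \<nu> - 1) q))"
      unfolding hankel_altdef clambert_C_eq[OF q1(1)] by (rule hankel_det_of_real_eqI) simp
    then show "complex_of_real (4 ^ n * hankel n 1 (\<lambda>\<nu>. lambert_C (2 * \<nu> - 1) q)) =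
        of_real ((zk\<^sup>2 / 4) ^ (n + 2 * tri n) * (\<Prod>m<n. fact (2 * m) * fact (2 * m + 1)))"
      using det_C[of n] by (simp add: CD)
  qed
  show "(zk\<^sup>2 / 4) ^ (2 * n + 2 * tri n) =
    32 ^ n * 4 ^ (2 * tri n) * F'_fac n * hankel n 1 (\<lambda>\<nu>. lambert_D (2 * \<nu> + 1) (q\<^sup>2))"
  proof (rule clear_factorials[OF _ F'_fac_prod])
    have "hankel_det n (\<lambda>i. clambert_D (2 * i + 3) (of_real (q\<^sup>2))) = of_real (hankel n 1 (\<lambda>\<nu>. lambert_D (2 * \<nu> + 1) (q\<^sup>2)))"
      unfolding hankel_altdef clambert_D_eq[OF q1(2)] by (rule hankel_det_of_real_eqI) (simp add: eval_nat_numeral)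
    then show "complex_of_real (32 ^ n * 4 ^ (2 * tri n) * hankel n 1 (\<lambda>\<nu>. lambert_D (2 * \<nu> + 1) (q\<^sup>2))) =
        of_real ((zk\<^sup>2 / 4) ^ (2 * n + 2 * tri n) * (\<Prod>m<n. fact (2 * m + 1) * fact (2 * m + 2)))"
      using det_D[of n] unfolding q2 CD by simp
  qed
  show "rtheta3 (- q\<^sup>2) ^ n * (rtheta3 (- q\<^sup>2) * ((zz + zk') / 2)) ^ (2 * tri n) =
    (- 4) ^ n * P_fac n * hankel n 1 (\<lambda>\<nu>. lambert_R (2 * \<nu> - 2) (q\<^sup>2) - eps_seq \<nu>)"
  proof (rule clear_factorials[OF _ P_fac_prod])
    have "hankel_det n (\<lambda>i. clambert_R (2 * i) (of_real (q\<^sup>2)) - of_real (eps_seq (i + 1))) =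
        of_real (hankel n 1 (\<lambda>\<nu>. lambert_R (2 * \<nu> - 2) (q\<^sup>2) - eps_seq \<nu>))"
      unfolding hankel_altdef clambert_R_eq[OF q1(2)] by (rule hankel_det_of_real_eqI) simp
    then show "complex_of_real ((- 4) ^ n * hankel n 1 (\<lambda>\<nu>. lambert_R (2 * \<nu> - 2) (q\<^sup>2) - eps_seq \<nu>)) =
        of_real (rtheta3 (- q\<^sup>2) ^ n * (rtheta3 (- q\<^sup>2) * ((zz + zk') / 2)) ^ (2 * tri n) * (\<Prod>m<n. fact (2 * m) ^ 2))"
      using det_R[of n] unfolding q2 by (simp add: GH)
  qed
qed

text \<open>For the parameter \<open>Q\<close> with \<open>(Q\<^sup>2)\<^sup>2 = x\<close> and \<open>x = q\<close> or \<open>x = - q\<close>, the product \<open>GG 0 * HH 0\<close> is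
  \<open>theta3 (Q\<^sup>2) * theta3 (- Q\<^sup>2) = theta3 (- x)\<^sup>2\<close>.\<close>

lemma hankel_U_G:
  fixes r :: complex
  assumes x: "\<bar>x\<bar> < 1" and r: "r\<^sup>2 = of_real x" "r \<noteq> 0"
  shows "(- 1) ^ n * ((rtheta3 (- x))\<^sup>2) ^ (n + 2 * tri n) =
      8 ^ n * 4 ^ (2 * tri n) * F_fac n * hankel n 1 (\<lambda>\<nu>. lambert_U (2 * \<nu> - 1) x - beta_seq \<nu>)"
    and "((rtheta3 (- x))\<^sup>2) ^ (2 * n + 2 * tri n) =
      32 ^ n * 4 ^ (2 * tri n) * F'_fac n * hankel n 1 (\<lambda>\<nu>. lambert_G (2 * \<nu> + 1) x - beta'_seq \<nu>)"
proof -
  have "norm (r\<^sup>2) < 1" using x r by simp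
  then have r1: "norm r < 1" by (simp add: norm_power power_less_one_iff)
  interpret R: nome r by unfold_locales (use r r1 in auto)
  \<comment> \<open>The statement involves only \<open>Q^2\<close> and \<open>Q^4\<close>, so either
    square root of \<open>r\<close> would do.\<close>
  define Q where "Q = csqrt r"
  have Q: "Q\<^sup>2 = r" by (simp add: Q_def)
  have "norm (Q\<^sup>2) < 1" using r1 Q by simp
  then have Q1: "norm Q < 1" by (simp add: norm_power power_less_one_iff)
  interpret nome Q by unfold_locales (use Q Q1 r in auto)
  have GH: "GG 0 * HH 0 = of_real ((rtheta3 (- x))\<^sup>2)"
    unfolding GG_0 HH_0' Q using R.theta3_prod theta3_of_real[of "- x"] x r by (simp add: mult.commute)
  have Q4: "(Q\<^sup>2)\<^sup>2 = of_real x" unfolding Q r ..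
  show "(- 1) ^ n * ((rtheta3 (- x))\<^sup>2) ^ (n + 2 * tri n) =
      8 ^ n * 4 ^ (2 * tri n) * F_fac n * hankel n 1 (\<lambda>\<nu>. lambert_U (2 * \<nu> - 1) x - beta_seq \<nu>)"
  proof (rule clear_factorials[OF _ F_fac_prod])
    have "hankel_det n (\<lambda>i. clambert_U (2 * i + 1) (of_real x) - of_real (beta_seq (i + 1))) =
        of_real (hankel n 1 (\<lambda>\<nu>. lambert_U (2 * \<nu> - 1) x - beta_seq \<nu>))"
      unfolding hankel_altdef clambert_U_eq[OF x] by (rule hankel_det_of_real_eqI) simp
    then show "complex_of_real (8 ^ n * 4 ^ (2 * tri n) * hankel n 1 (\<lambda>\<nu>. lambert_U (2 * \<nu> - 1) x - beta_seq \<nu>)) =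
        of_real ((- 1) ^ n * ((rtheta3 (- x))\<^sup>2) ^ (n + 2 * tri n) * (\<Prod>m<n. fact (2 * m) * fact (2 * m + 1)))"
      using det_U[of n] unfolding Q4 GH by simp
  qed
  show "((rtheta3 (- x))\<^sup>2) ^ (2 * n + 2 * tri n) =
      32 ^ n * 4 ^ (2 * tri n) * F'_fac n * hankel n 1 (\<lambda>\<nu>. lambert_G (2 * \<nu> + 1) x - beta'_seq \<nu>)"
  proof (rule clear_factorials[OF _ F'_fac_prod])
    have "hankel_det n (\<lambda>i. clambert_G (2 * i + 3) (of_real x) - of_real (beta'_seq (i + 1))) =
        of_real (hankel n 1 (\<lambda>\<nu>. lambert_G (2 * \<nu> + 1) x - beta'_seq \<nu>))"
      unfolding hankel_altdef clambert_G_eq[OF x] by (rule hankel_det_of_real_eqI) (simp add: eval_nat_numeral)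
    then show "complex_of_real (32 ^ n * 4 ^ (2 * tri n) * hankel n 1 (\<lambda>\<nu>. lambert_G (2 * \<nu> + 1) x - beta'_seq \<nu>)) =
        of_real (((rtheta3 (- x))\<^sup>2) ^ (2 * n + 2 * tri n) * (\<Prod>m<n. fact (2 * m + 1) * fact (2 * m + 2)))"
      using det_G[of n] unfolding Q4 GH by simp
  qed
qed

lemma hankel_U_G_q: "(- 1) ^ n * (zk'\<^sup>2) ^ (n + 2 * tri n) =
      8 ^ n * 4 ^ (2 * tri n) * F_fac n * hankel n 1 (\<lambda>\<nu>. lambert_U (2 * \<nu> - 1) q - beta_seq \<nu>)"
  "(zk'\<^sup>2) ^ (2 * n + 2 * tri n) =
      32 ^ n * 4 ^ (2 * tri n) * F'_fac n * hankel n 1 (\<lambda>\<nu>. lambert_G (2 * \<nu> + 1) q - beta'_seq \<nu>)"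
  using hankel_U_G[of q "of_real p" n] q_pos q_lt_1 p by auto

lemma hankel_U_G_minus_q: "(- 1) ^ n * (zz\<^sup>2) ^ (n + 2 * tri n) =
      8 ^ n * 4 ^ (2 * tri n) * F_fac n * hankel n 1 (\<lambda>\<nu>. lambert_U (2 * \<nu> - 1) (- q) - beta_seq \<nu>)"
  "(zz\<^sup>2) ^ (2 * n + 2 * tri n) =
      32 ^ n * 4 ^ (2 * tri n) * F'_fac n * hankel n 1 (\<lambda>\<nu>. lambert_G (2 * \<nu> + 1) (- q) - beta'_seq \<nu>)"
  using hankel_U_G[of "- q" "\<i> * of_real p" n] q_pos q_lt_1 p by auto

end

section \<open>The theorem\<close>

lemma two_tri: "2 * tri n + n = n\<^sup>2"
  by (induction n) (simp_all add: tri_def power2_eq_square)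

text \<open>\<open>u\<close> is the sign or power of two by which an evaluated determinant differs
  from the stated identity.\<close>

lemma rescale_identity: "M = c * P * h \<Longrightarrow> c' = u * c \<Longrightarrow> L = u * M \<Longrightarrow> L = c' * P * h"
  for M :: real by simp

lemma powers_of_two: "(4 :: real) ^ m = 2 ^ m * 2 ^ m" "(8 :: real) ^ m = 2 ^ m * 2 ^ m * 2 ^ m"
  "(16 :: real) ^ m = 2 ^ m * 2 ^ m * 2 ^ m * 2 ^ m" "(32 :: real) ^ m = 2 ^ m * 2 ^ m * 2 ^ m * 2 ^ m * 2 ^ m"
  by (simp_all flip: power_mult_distrib)

lemma scaled_square_power: "4 ^ m * (x\<^sup>2 / 4) ^ m = x ^ m * (x ^ m :: real)"
  by (simp flip: power_mult_distrib add: power2_eq_square)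

lemma sign_square: "(- 1) ^ m * (- 1) ^ m = (1 :: real)"
  by (simp flip: power_mult_distrib)

theorem theorem5p19:
  fixes k k' z q :: real and n :: nat
  assumes k: "0 < k" "k < 1"
    and k': "k' = sqrt (1 - k^2)"
    and z: "z = 2 * ellK k / pi"
    and q: "q = exp (- pi * ellK k' / ellK k)"
    and n: "n \<ge> 1"
  shows
   "(k^(n^2 - n) * z^(2*n^2 - n)
      = 4^(n^2) * P_fac n * hankel n 1 (\<lambda>\<nu>. lambert_N (2*\<nu> - 2) q)
        + 4^(n^2 - 1) * P_fac n * hankel (n - 1) 3 (\<lambda>\<nu>. lambert_N (2*\<nu> - 2) q)) \<and>
    (k'^(n^2 - n) * z^(2*n^2 - n)
      = (-1)^n * 4^n * P_fac n * hankel n 1 (\<lambda>\<nu>. lambert_R (2*\<nu> - 2) (- q) - eps_seq \<nu>)) \<and>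
    (k^(n^2) * z^(2*n^2 - n)
      = 4^n * P_fac n * hankel n 1 (\<lambda>\<nu>. lambert_T (2*\<nu> - 2) q)) \<and>
    (k^(n^2) * k'^(n^2 - n) * z^(2*n^2 - n)
      = (-1)^(n*(n+1) div 2) * 4^n * P_fac n * hankel n 1 (\<lambda>\<nu>. lambert_T_hat (2*\<nu> - 2) q)) \<and>
    (k'^(n^2) * z^(2*n^2 - n)
      = (-1)^n * 4^n * P_fac n * hankel n 1 (\<lambda>\<nu>. lambert_R (2*\<nu> - 2) q - eps_seq \<nu>)) \<and>
    (k^(n^2 - n) * k'^(n^2) * z^(2*n^2 - n)
      = (-1)^(n*(n-1) div 2) * 4^(n^2) * P_fac n
          * hankel n 1 (\<lambda>\<nu>. lambert_N (2*\<nu> - 2) (- q))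
        + (-1)^(n*(n-1) div 2) * 4^(n^2 - 1) * P_fac n
          * hankel (n - 1) 3 (\<lambda>\<nu>. lambert_N (2*\<nu> - 2) (- q))) \<and>
    (k' powr (real (n^2) / 2) * (1 + k')^(n^2 - n) * z^(2*n^2 - n)
      = (-1)^n * 2^(n*(n+1)) * P_fac n
        * hankel n 1 (\<lambda>\<nu>. lambert_R (2*\<nu> - 2) (q^2) - eps_seq \<nu>)) \<and>
    (z^(2*n^2)
      = (-1)^n * 2^(2*n^2 + n) * F_fac n
        * hankel n 1 (\<lambda>\<nu>. lambert_U (2*\<nu> - 1) (- q) - beta_seq \<nu>)) \<and>
    ((k * z)^(2*n^2)
      = 4^(n*(n+1)) * F_fac n * hankel n 1 (\<lambda>\<nu>. lambert_C (2*\<nu> - 1) q)) \<and>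
    ((k' * z)^(2*n^2)
      = (-1)^n * 2^(2*n^2 + n) * F_fac n
        * hankel n 1 (\<lambda>\<nu>. lambert_U (2*\<nu> - 1) q - beta_seq \<nu>)) \<and>
    ((k * k')^(n^2) * z^(2*n^2)
      = (-1)^(n*(n+1) div 2) * 4^n * F_fac n * hankel n 1 (\<lambda>\<nu>. lambert_C_hat (2*\<nu> - 1) q)) \<and>
    (k'^(n^2) * z^(2*n^2)
      = (-1)^n * 2^(2*n^2 + n) * F_fac n
        * hankel n 1 (\<lambda>\<nu>. lambert_U (2*\<nu> - 1) (q^2) - beta_seq \<nu>)) \<and>
    (k^(n^2) * z^(2*n^2)
      = 4^n * F_fac n * hankel n 1 (\<lambda>\<nu>. lambert_C (2*\<nu> - 1) (sqrt q))) \<and>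
    (k^(n^2) * z^(2*n^2 + n)
      = 4^n * Q_fac n * hankel n 1 (\<lambda>\<nu>. lambert_T (2*\<nu>) q)) \<and>
    (k'^(n^2) * z^(2*n^2 + n)
      = 4^n * Q_fac n * hankel n 1 (\<lambda>\<nu>. lambert_R (2*\<nu>) q - eps'_seq \<nu>)) \<and>
    (k^(n^2 + n) * z^(2*n^2 + n)
      = 4^(n*(n+1)) * Q_fac n * hankel n 1 (\<lambda>\<nu>. lambert_N (2*\<nu>) q)) \<and>
    (k^(n^2) * k'^(n^2 + n) * z^(2*n^2 + n)
      = (-1)^(n*(n+1) div 2) * 4^n * Q_fac n * hankel n 1 (\<lambda>\<nu>. lambert_T_hat (2*\<nu>) q)) \<and>
    (k'^(n^2 + n) * z^(2*n^2 + n)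
      = 4^n * Q_fac n * hankel n 1 (\<lambda>\<nu>. lambert_R (2*\<nu>) (- q) - eps'_seq \<nu>)) \<and>
    (k^(n^2 + n) * k'^(n^2) * z^(2*n^2 + n)
      = (-1)^(n*(n+1) div 2) * 4^(n*(n+1)) * Q_fac n
        * hankel n 1 (\<lambda>\<nu>. lambert_N (2*\<nu>) (- q))) \<and>
    (k^(n^2 + n) * z^(2*n^2 + 2*n)
      = 2^(2*n^2 + 3*n) * F'_fac n * hankel n 1 (\<lambda>\<nu>. lambert_D (2*\<nu> + 1) q)) \<and>
    (k^(n^2 + n) * k'^(n^2 + n) * z^(2*n^2 + 2*n)
      = (-1)^(n*(n+1) div 2) * 2^(2*n^2 + 3*n) * F'_fac n
        * hankel n 1 (\<lambda>\<nu>. lambert_D (2*\<nu> + 1) (- q))) \<and>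
    ((k * z)^(2*n^2 + 2*n)
      = 2^(4*n^2 + 5*n) * F'_fac n * hankel n 1 (\<lambda>\<nu>. lambert_D (2*\<nu> + 1) (q^2))) \<and>
    ((k' * z)^(2*n^2 + 2*n)
      = 2^(2*n^2 + 3*n) * F'_fac n
        * hankel n 1 (\<lambda>\<nu>. lambert_G (2*\<nu> + 1) q - beta'_seq \<nu>)) \<and>
    (z^(2*n^2 + 2*n)
      = 2^(2*n^2 + 3*n) * F'_fac n
        * hankel n 1 (\<lambda>\<nu>. lambert_G (2*\<nu> + 1) (- q) - beta'_seq \<nu>))"
proof -
  note K = ellK_nome[OF k k' z q]
  interpret theta_values q by unfold_locales (rule K(1,2))+
  note A = K(3-5)[symmetric]
  \<comment> \<open>With \<open>s = n (n - 1)\<close> the exponents become sums of copies of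
    \<open>s\<close> and \<open>n\<close>, and truncated subtraction disappears; the signs also use
    \<open>tri n\<close>.\<close>
  define s where "s = 2 * tri n"
  have t: "2 * tri n = s" by (simp add: s_def)
  have n2: "n\<^sup>2 = s + n" using two_tri[of n] by (simp add: s_def)
  have ph1: "n * (n + 1) div 2 = tri n + n" "n * (n - 1) div 2 = tri n"
    using n2 by (simp_all add: s_def power2_eq_square diff_mult_distrib2)
  have ph2: "s + n - n = s" "2 * (s + n) - n = s + s + n" "n * (n + 1) = s + n + n"
    using n2 by (simp_all add: power2_eq_square)
  have ph3: "2 * (s + n) = s + s + n + n" "4 * (s + n) = s + s + s + s + n + n + n + n"
    "2 * n = n + n" "3 * n = n + n + n" "5 * n = n + n + n + n + n" "2 * (n + tri n) = s + n + n"
    by (simp_all add: s_def)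
  have n0: "n > 0" using n by simp
  have four_powers: "4 ^ n\<^sup>2 = (4 ^ n * 4 ^ s :: real)" "4 ^ (n\<^sup>2 - 1) = (4 ^ n\<^sup>2 / 4 :: real)"
    using n0 by (simp_all add: n2 power_add power_diff)
  have k'0: "0 < k'" using k by (simp add: k' power_less_one_iff)
  have powr_half: "k' powr (real m / 2) = sqrt k' ^ m" for m
    using k'0 by (simp add: powr_half_sqrt[symmetric] powr_powr mult.commute flip: powr_realpow)
  \<comment> \<open>The square of \<open>rtheta3\<close> at the negative of \<open>q^2\<close> is
    \<open>zz * zk'\<close>, which is \<open>k'\<close> times the square of \<open>z\<close>;
    positivity selects the root.\<close>
  have w: "rtheta3 (- q\<^sup>2) = sqrt k' * z"
  proof -
    have z0: "0 < z" using ellK_pos[OF k] by (simp add: z)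
    have "(sqrt k' * z)\<^sup>2 = (rtheta3 (- q\<^sup>2))\<^sup>2"
      unfolding rtheta3_minus_q_sqr(2) A using k'0 by (simp add: power_mult_distrib power2_eq_square)
    then show ?thesis
      using rtheta3_minus_q_sqr(1) z0 k'0 by (simp add: power2_eq_iff_nonneg)
  qed
  note pw = power_add power_mult_distrib power2_eq_square powers_of_two power_minus[of 4] mult_1_left
  have sg: "(- 1) ^ m * ((- 1) ^ m * x) = x" for m and x :: real by simp
  have p1: "k^(n^2 - n) * z^(2*n^2 - n)
      = 4^(n^2) * P_fac n * hankel n 1 (\<lambda>\<nu>. lambert_N (2*\<nu> - 2) q)
        + 4^(n^2 - 1) * P_fac n * hankel (n - 1) 3 (\<lambda>\<nu>. lambert_N (2*\<nu> - 2) q)" (is "?L = ?R")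
  proof -
    let ?H = "hankel n 1 (\<lambda>\<nu>. lambert_N (2 * \<nu> - 2) q)"
    let ?H3 = "hankel (n - 1) 3 (\<lambda>\<nu>. lambert_N (2 * \<nu> - 2) q)"
    have "?L = (4 ^ n * 4 ^ s * P_fac n * (?H + 1 / 4 * ?H3))"
      unfolding hankel_N[OF n0, unfolded A t, symmetric] n2
      by (simp only: ph2, simp only: pw sg sign_square mult_1_right mult_ac)
    also have "\<dots> = ?R"
      unfolding four_powers(2) unfolding four_powers(1) ph1 by (simp add: algebra_simps)
    finally show ?thesis .
  qed
  have p2: "k'^(n^2 - n) * z^(2*n^2 - n)
      = (-1)^n * 4^n * P_fac n * hankel n 1 (\<lambda>\<nu>. lambert_R (2*\<nu> - 2) (- q) - eps_seq \<nu>)"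
    by (rule rescale_identity[OF hankel_R_minus[of n, unfolded A t], where u = "1"])
      ((simp_all only: n2 ph1)?, (simp_all only: ph2)?, (simp_all only: ph3 t)?, (simp_all only: pw sg sign_square mult_1_right mult_ac)?)
  have p3: "k^(n^2) * z^(2*n^2 - n)
      = 4^n * P_fac n * hankel n 1 (\<lambda>\<nu>. lambert_T (2*\<nu> - 2) q)"
    by (rule rescale_identity[OF hankel_T[of n, unfolded A t], where u = "1"])
      ((simp_all only: n2 ph1)?, (simp_all only: ph2)?, (simp_all only: ph3 t)?, (simp_all only: pw sg sign_square mult_1_right mult_ac)?)
  \<comment> \<open>Since \<open>n (n + 1) / 2 = tri n + n\<close>, the two sign factors in
    \<open>hankel_T_hat\<close> combine to the stated one.\<close>
  have p4: "k^(n^2) * k'^(n^2 - n) * z^(2*n^2 - n)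
      = (-1)^(n*(n+1) div 2) * 4^n * P_fac n * hankel n 1 (\<lambda>\<nu>. lambert_T_hat (2*\<nu> - 2) q)"
    by (rule rescale_identity[OF hankel_T_hat[of n, unfolded A t], where u = "(- 1) ^ (tri n + n)"])
      ((simp_all only: n2 ph1)?, (simp_all only: ph2)?, (simp_all only: ph3 t)?, (simp_all only: pw sg sign_square mult_1_right mult_ac)?)
  have p5: "k'^(n^2) * z^(2*n^2 - n)
      = (-1)^n * 4^n * P_fac n * hankel n 1 (\<lambda>\<nu>. lambert_R (2*\<nu> - 2) q - eps_seq \<nu>)"
    by (rule rescale_identity[OF hankel_R[of n, unfolded A t], where u = "1"])
      ((simp_all only: n2 ph1)?, (simp_all only: ph2)?, (simp_all only: ph3 t)?, (simp_all only: pw sg sign_square mult_1_right mult_ac)?)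
  have p6: "k^(n^2 - n) * k'^(n^2) * z^(2*n^2 - n)
      = (-1)^(n*(n-1) div 2) * 4^(n^2) * P_fac n
          * hankel n 1 (\<lambda>\<nu>. lambert_N (2*\<nu> - 2) (- q))
        + (-1)^(n*(n-1) div 2) * 4^(n^2 - 1) * P_fac n
          * hankel (n - 1) 3 (\<lambda>\<nu>. lambert_N (2*\<nu> - 2) (- q))" (is "?L = ?R")
  proof -
    let ?H = "hankel n 1 (\<lambda>\<nu>. lambert_N (2 * \<nu> - 2) (- q))"
    let ?H3 = "hankel (n - 1) 3 (\<lambda>\<nu>. lambert_N (2 * \<nu> - 2) (- q))"
    have "?L = (- 1) ^ tri n * (4 ^ n * 4 ^ s * P_fac n * (?H + 1 / 4 * ?H3))"
      unfolding hankel_N_minus[OF n0, unfolded A t, symmetric] n2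
      by (simp only: ph2, simp only: pw sg sign_square mult_1_right mult_ac)
    also have "\<dots> = ?R"
      unfolding four_powers(2) unfolding four_powers(1) ph1 by (simp add: algebra_simps)
    finally show ?thesis .
  qed
  have p7: "k' powr (real (n^2) / 2) * (1 + k')^(n^2 - n) * z^(2*n^2 - n)
      = (-1)^n * 2^(n*(n+1)) * P_fac n
        * hankel n 1 (\<lambda>\<nu>. lambert_R (2*\<nu> - 2) (q^2) - eps_seq \<nu>)"
  \<comment> \<open>The factor \<open>2^s\<close> clears the halves in the mean of \<open>z\<close>
    and \<open>k' * z\<close>, which occurs to the power \<open>s\<close>.\<close>
  proof (rule rescale_identity[OF hankel_R_sqr[of n, unfolded A t w], where u = "2 ^ s"])
    show "(- 1) ^ n * 2 ^ (n * (n + 1)) = (2 ^ s * (- 4) ^ n :: real)"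
      by (simp only: ph2, simp only: pw mult_ac)
    have "sqrt k' * z * ((z + k' * z) / 2) = (sqrt k' * (z * z) * (1 + k')) / 2"
      by (simp add: algebra_simps)
    note r1 = this
    have r2: "2 ^ s * (x / 2) ^ s = x ^ s" for x :: real
      by (simp flip: power_mult_distrib)
    show "k' powr (real (n\<^sup>2) / 2) * (1 + k') ^ (n\<^sup>2 - n) * z ^ (2 * n\<^sup>2 - n) =
        2 ^ s * ((sqrt k' * z) ^ n * (sqrt k' * z * ((z + k' * z) / 2)) ^ s)"
      unfolding mult.left_commute[of "2 ^ s"] r1 r2 powr_half n2
      by (simp only: ph2, simp only: pw mult_ac)
  qed
  have p8: "z^(2*n^2)
      = (-1)^n * 2^(2*n^2 + n) * F_fac n
        * hankel n 1 (\<lambda>\<nu>. lambert_U (2*\<nu> - 1) (- q) - beta_seq \<nu>)"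
    by (rule rescale_identity[OF hankel_U_G_minus_q(1)[of n, unfolded A t], where u = "(- 1) ^ n"])
      ((simp_all only: n2 ph1)?, (simp_all only: ph2)?, (simp_all only: ph3 t)?, (simp_all only: pw sg sign_square mult_1_right mult_ac)?)
  have p9: "(k * z)^(2*n^2)
      = 4^(n*(n+1)) * F_fac n * hankel n 1 (\<lambda>\<nu>. lambert_C (2*\<nu> - 1) q)"
  \<comment> \<open>The factor \<open>4^(n + s)\<close> clears the denominator of
    \<open>zk^2 / 4\<close>, which occurs to the power \<open>n + s\<close>.\<close>
  proof (rule rescale_identity[OF hankel_C[of n, unfolded A t], where u = "4 ^ (n + s)"])
    show "4 ^ (n * (n + 1)) = (4 ^ (n + s) * 4 ^ n :: real)"
      by (simp only: ph2, simp only: pw mult_ac)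
    show "(k * z) ^ (2 * n\<^sup>2) = 4 ^ (n + s) * ((k * z)\<^sup>2 / 4) ^ (n + s)"
      unfolding scaled_square_power n2 ph3 by (simp only: pw mult_ac)
  qed
  have p10: "(k' * z)^(2*n^2)
      = (-1)^n * 2^(2*n^2 + n) * F_fac n
        * hankel n 1 (\<lambda>\<nu>. lambert_U (2*\<nu> - 1) q - beta_seq \<nu>)"
    by (rule rescale_identity[OF hankel_U_G_q(1)[of n, unfolded A t], where u = "(- 1) ^ n"])
      ((simp_all only: n2 ph1)?, (simp_all only: ph2)?, (simp_all only: ph3 t)?, (simp_all only: pw sg sign_square mult_1_right mult_ac)?)
  have p11: "(k * k')^(n^2) * z^(2*n^2)
      = (-1)^(n*(n+1) div 2) * 4^n * F_fac n * hankel n 1 (\<lambda>\<nu>. lambert_C_hat (2*\<nu> - 1) q)"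
    by (rule rescale_identity[OF hankel_C_hat[of n, unfolded A t], where u = "(- 1) ^ (tri n + n)"])
      ((simp_all only: n2 ph1)?, (simp_all only: ph2)?, (simp_all only: ph3 t)?, (simp_all only: pw sg sign_square mult_1_right mult_ac)?)
  have p12: "k'^(n^2) * z^(2*n^2)
      = (-1)^n * 2^(2*n^2 + n) * F_fac n
        * hankel n 1 (\<lambda>\<nu>. lambert_U (2*\<nu> - 1) (q^2) - beta_seq \<nu>)"
    by (rule rescale_identity[OF hankel_U_sqr[of n, unfolded A t], where u = "(- 1) ^ n"])
      ((simp_all only: n2 ph1)?, (simp_all only: ph2)?, (simp_all only: ph3 t)?, (simp_all only: pw sg sign_square mult_1_right mult_ac)?)
  have p13: "k^(n^2) * z^(2*n^2)
      = 4^n * F_fac n * hankel n 1 (\<lambda>\<nu>. lambert_C (2*\<nu> - 1) (sqrt q))"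
    by (rule rescale_identity[OF hankel_C_sqrt[of n, unfolded A t], where u = "1"])
      ((simp_all only: n2 ph1)?, (simp_all only: ph2)?, (simp_all only: ph3 t)?, (simp_all only: pw sg sign_square mult_1_right mult_ac)?)
  have p14: "k^(n^2) * z^(2*n^2 + n)
      = 4^n * Q_fac n * hankel n 1 (\<lambda>\<nu>. lambert_T (2*\<nu>) q)"
    by (rule rescale_identity[OF hankel_T2[of n, unfolded A t], where u = "1"])
      ((simp_all only: n2 ph1)?, (simp_all only: ph2)?, (simp_all only: ph3 t)?, (simp_all only: pw sg sign_square mult_1_right mult_ac)?)
  have p15: "k'^(n^2) * z^(2*n^2 + n)
      = 4^n * Q_fac n * hankel n 1 (\<lambda>\<nu>. lambert_R (2*\<nu>) q - eps'_seq \<nu>)"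
    by (rule rescale_identity[OF hankel_R2[of n, unfolded A t], where u = "1"])
      ((simp_all only: n2 ph1)?, (simp_all only: ph2)?, (simp_all only: ph3 t)?, (simp_all only: pw sg sign_square mult_1_right mult_ac)?)
  have p16: "k^(n^2 + n) * z^(2*n^2 + n)
      = 4^(n*(n+1)) * Q_fac n * hankel n 1 (\<lambda>\<nu>. lambert_N (2*\<nu>) q)"
    by (rule rescale_identity[OF hankel_N2[of n, unfolded A t], where u = "1"])
      ((simp_all only: n2 ph1)?, (simp_all only: ph2)?, (simp_all only: ph3 t)?, (simp_all only: pw sg sign_square mult_1_right mult_ac)?)
  have p17: "k^(n^2) * k'^(n^2 + n) * z^(2*n^2 + n)
      = (-1)^(n*(n+1) div 2) * 4^n * Q_fac n * hankel n 1 (\<lambda>\<nu>. lambert_T_hat (2*\<nu>) q)"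
    by (rule rescale_identity[OF hankel_T_hat2[of n, unfolded A t], where u = "(- 1) ^ (tri n + n)"])
      ((simp_all only: n2 ph1)?, (simp_all only: ph2)?, (simp_all only: ph3 t)?, (simp_all only: pw sg sign_square mult_1_right mult_ac)?)
  have p18: "k'^(n^2 + n) * z^(2*n^2 + n)
      = 4^n * Q_fac n * hankel n 1 (\<lambda>\<nu>. lambert_R (2*\<nu>) (- q) - eps'_seq \<nu>)"
    by (rule rescale_identity[OF hankel_R2_minus[of n, unfolded A t], where u = "1"])
      ((simp_all only: n2 ph1)?, (simp_all only: ph2)?, (simp_all only: ph3 t)?, (simp_all only: pw sg sign_square mult_1_right mult_ac)?)
  have p19: "k^(n^2 + n) * k'^(n^2) * z^(2*n^2 + n)
      = (-1)^(n*(n+1) div 2) * 4^(n*(n+1)) * Q_fac n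
        * hankel n 1 (\<lambda>\<nu>. lambert_N (2*\<nu>) (- q))"
    by (rule rescale_identity[OF hankel_N2_minus[of n, unfolded A t], where u = "(- 1) ^ (tri n + n)"])
      ((simp_all only: n2 ph1)?, (simp_all only: ph2)?, (simp_all only: ph3 t)?, (simp_all only: pw sg sign_square mult_1_right mult_ac)?)
  have p20: "k^(n^2 + n) * z^(2*n^2 + 2*n)
      = 2^(2*n^2 + 3*n) * F'_fac n * hankel n 1 (\<lambda>\<nu>. lambert_D (2*\<nu> + 1) q)"
    by (rule rescale_identity[OF hankel_D[of n, unfolded A t], where u = "1"])
      ((simp_all only: n2 ph1)?, (simp_all only: ph2)?, (simp_all only: ph3 t)?, (simp_all only: pw sg sign_square mult_1_right mult_ac)?)
  have p21: "k^(n^2 + n) * k'^(n^2 + n) * z^(2*n^2 + 2*n)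
      = (-1)^(n*(n+1) div 2) * 2^(2*n^2 + 3*n) * F'_fac n
        * hankel n 1 (\<lambda>\<nu>. lambert_D (2*\<nu> + 1) (- q))"
    by (rule rescale_identity[OF hankel_D_minus[of n, unfolded A t], where u = "(- 1) ^ (tri n + n)"])
      ((simp_all only: n2 ph1)?, (simp_all only: ph2)?, (simp_all only: ph3 t)?, (simp_all only: pw sg sign_square mult_1_right mult_ac)?)
  have p22: "(k * z)^(2*n^2 + 2*n)
      = 2^(4*n^2 + 5*n) * F'_fac n * hankel n 1 (\<lambda>\<nu>. lambert_D (2*\<nu> + 1) (q^2))"
  proof (rule rescale_identity[OF hankel_D_sqr[of n, unfolded A t], where u = "4 ^ (2 * n + s)"])
    show "2 ^ (4 * n\<^sup>2 + 5 * n) = (4 ^ (2 * n + s) * (32 ^ n * 4 ^ s) :: real)"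
      by (simp only: n2, simp only: ph3, simp only: pw mult_ac)
    show "(k * z) ^ (2 * n\<^sup>2 + 2 * n) = 4 ^ (2 * n + s) * ((k * z)\<^sup>2 / 4) ^ (2 * n + s)"
      unfolding scaled_square_power n2 ph3 by (simp only: pw mult_ac)
  qed
  have p23: "(k' * z)^(2*n^2 + 2*n)
      = 2^(2*n^2 + 3*n) * F'_fac n
        * hankel n 1 (\<lambda>\<nu>. lambert_G (2*\<nu> + 1) q - beta'_seq \<nu>)"
    by (rule rescale_identity[OF hankel_U_G_q(2)[of n, unfolded A t], where u = "1"])
      ((simp_all only: n2 ph1)?, (simp_all only: ph2)?, (simp_all only: ph3 t)?, (simp_all only: pw sg sign_square mult_1_right mult_ac)?)
  have p24: "z^(2*n^2 + 2*n)
      = 2^(2*n^2 + 3*n) * F'_fac n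
        * hankel n 1 (\<lambda>\<nu>. lambert_G (2*\<nu> + 1) (- q) - beta'_seq \<nu>)"
    by (rule rescale_identity[OF hankel_U_G_minus_q(2)[of n, unfolded A t], where u = "1"])
      ((simp_all only: n2 ph1)?, (simp_all only: ph2)?, (simp_all only: ph3 t)?, (simp_all only: pw sg sign_square mult_1_right mult_ac)?)
  show ?thesis
    by (intro conjI p1 p2 p3 p4 p5 p6 p7 p8 p9 p10 p11 p12 p13 p14 p15 p16 p17 p18 p19 p20 p21 p22 p23 p24)
qed

end
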